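(* Every $n$-qubit Clifford circuit can be implemented (up to global phase) by a circuit on $n$ qubits consisting of local Clifford gates and $O(n^2/\log(n))$ untargeted $n$-qubit $\mathrm{GZZ}(\frac{\pi}{2^{k+1}})$ gates, where $k\in\mathbb{N}$ is the smallest number such that $n-1\leq 2^k$.
   Context: $\mathbb{N}=\{0,1,2,\dots\}$. For a set $Q$ of qubits and a real $\alpha$, $\mathrm{GZZ}_Q(\alpha)=\prod_{i<j\in Q}\exp(-i\frac{\alpha}{2}Z_iZ_j)$, where $Z_i$ is the Pauli $Z$ on qubit $i$. An untargeted $n$-qubit $\mathrm{GZZ}(\alpha)$ gate is $\mathrm{GZZ}_Q(\alpha)$ with $Q$ the set of all $n$ qubits of the circuit. A Clifford circuit is one built from Hadamard, $S=\mathrm{diag}(1,i)$, CNOT and CZ gates. A local Clifford gate is a single-qubit Clifford unitary; any number of these may be used. The bound $O(n^2/\log(n))$ means at most $C\,n^2/\log(n)$ for all $n\ge2$, with $C$ an absolute constant independent of $n$ and the circuit. *)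

theory Defs
  imports Complex_Main "Jordan_Normal_Form.Matrix"
begin

text \<open>
  The qubits of an \<open>n\<close>-qubit circuit are \<open>0, \<dots>, n - 1\<close>. Operators are complex matrices of
  dimension \<open>2 ^ n\<close> whose indices encode the computational basis states: the state of qubit \<open>q\<close>
  in basis state \<open>x\<close> is \<open>bit x q\<close>.
\<close>

definition on_qubit :: "nat \<Rightarrow> nat \<Rightarrow> complex mat \<Rightarrow> complex mat" where
  "on_qubit n q U = mat (2 ^ n) (2 ^ n) (\<lambda>(x, y).
     if \<forall>j<n. j \<noteq> q \<longrightarrow> bit x j = bit y j
     then U $$ (of_bool (bit x q), of_bool (bit y q)) else 0)"

definition Z_mat :: "complex mat" where
  "Z_mat = mat_of_rows_list 2 [[1, 0], [0, -1]]"

definition H_mat :: "complex mat" where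
  "H_mat = complex_of_real (1 / sqrt 2) \<cdot>\<^sub>m mat_of_rows_list 2 [[1, 1], [1, -1]]"

definition S_mat :: "complex mat" where
  "S_mat = mat_of_rows_list 2 [[1, 0], [0, \<i>]]"

definition CNOT_mat :: "nat \<Rightarrow> nat \<Rightarrow> nat \<Rightarrow> complex mat" where
  "CNOT_mat n c t = mat (2 ^ n) (2 ^ n) (\<lambda>(x, y).
     if x = (if bit y c then flip_bit t y else y) then 1 else 0)"

definition CZ_mat :: "nat \<Rightarrow> nat \<Rightarrow> nat \<Rightarrow> complex mat" where
  "CZ_mat n a b = mat (2 ^ n) (2 ^ n) (\<lambda>(x, y).
     if x = y then (if bit x a \<and> bit x b then -1 else 1) else 0)"

text \<open>A circuit is a list of gates in order of application: the first gate is the rightmost factor.\<close>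

fun circuit_mat :: "nat \<Rightarrow> ('g \<Rightarrow> complex mat) \<Rightarrow> 'g list \<Rightarrow> complex mat" where
  "circuit_mat n M [] = 1\<^sub>m (2 ^ n)"
| "circuit_mat n M (g # gs) = circuit_mat n M gs * M g"

datatype clifford_gate = H nat | S nat | CNOT nat nat | CZ nat nat

fun clifford_gate_on :: "nat \<Rightarrow> clifford_gate \<Rightarrow> bool" where
  "clifford_gate_on n (H q) \<longleftrightarrow> q < n"
| "clifford_gate_on n (S q) \<longleftrightarrow> q < n"
| "clifford_gate_on n (CNOT c t) \<longleftrightarrow> c < n \<and> t < n \<and> c \<noteq> t"
| "clifford_gate_on n (CZ a b) \<longleftrightarrow> a < n \<and> b < n \<and> a \<noteq> b"

fun clifford_gate_mat :: "nat \<Rightarrow> clifford_gate \<Rightarrow> complex mat" where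
  "clifford_gate_mat n (H q) = on_qubit n q H_mat"
| "clifford_gate_mat n (S q) = on_qubit n q S_mat"
| "clifford_gate_mat n (CNOT c t) = CNOT_mat n c t"
| "clifford_gate_mat n (CZ a b) = CZ_mat n a b"

definition clifford_circuit :: "nat \<Rightarrow> clifford_gate list \<Rightarrow> bool" where
  "clifford_circuit n gs \<longleftrightarrow> (\<forall>g\<in>set gs. clifford_gate_on n g)"

definition clifford_mat :: "nat \<Rightarrow> clifford_gate list \<Rightarrow> complex mat" where
  "clifford_mat n gs = circuit_mat n (clifford_gate_mat n) gs"

definition single_qubit_clifford :: "complex mat \<Rightarrow> bool" where
  "single_qubit_clifford U \<longleftrightarrow> (\<exists>gs. clifford_circuit 1 gs \<and> U = clifford_mat 1 gs)"

text \<open>The matrix exponential, as the entrywise sum of the exponential series.\<close>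

definition mat_exp :: "complex mat \<Rightarrow> complex mat" where
  "mat_exp A = mat (dim_row A) (dim_row A) (\<lambda>(x, y). \<Sum>k. (A ^\<^sub>m k) $$ (x, y) / fact k)"

definition ZZ_rotation :: "nat \<Rightarrow> real \<Rightarrow> nat \<Rightarrow> nat \<Rightarrow> complex mat" where
  "ZZ_rotation n \<alpha> i j =
     mat_exp ((- \<i> * complex_of_real \<alpha> / 2) \<cdot>\<^sub>m (on_qubit n i Z_mat * on_qubit n j Z_mat))"

text \<open>The factors of the product commute, so the order in which the pairs are listed is immaterial.\<close>

definition GZZ_mat :: "nat \<Rightarrow> nat set \<Rightarrow> real \<Rightarrow> complex mat" where
  "GZZ_mat n Q \<alpha> = foldr (\<lambda>(i, j) A. ZZ_rotation n \<alpha> i j * A)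
     [(i, j). i \<leftarrow> [0..<n], j \<leftarrow> [0..<n], i < j \<and> i \<in> Q \<and> j \<in> Q] (1\<^sub>m (2 ^ n))"

datatype gzz_gate = Local nat "complex mat" | GZZ

fun gzz_gate_on :: "nat \<Rightarrow> gzz_gate \<Rightarrow> bool" where
  "gzz_gate_on n (Local q U) \<longleftrightarrow> q < n \<and> single_qubit_clifford U"
| "gzz_gate_on n GZZ \<longleftrightarrow> True"

fun gzz_gate_mat :: "nat \<Rightarrow> real \<Rightarrow> gzz_gate \<Rightarrow> complex mat" where
  "gzz_gate_mat n \<alpha> (Local q U) = on_qubit n q U"
| "gzz_gate_mat n \<alpha> GZZ = GZZ_mat n {0..<n} \<alpha>"

text \<open>
  Circuits of local Clifford gates and untargeted \<open>GZZ\<close> gates; all \<open>GZZ\<close> gates of such a circuit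
  have the same angle \<open>\<alpha>\<close>, which is a parameter of its matrix.
\<close>

definition gzz_circuit :: "nat \<Rightarrow> gzz_gate list \<Rightarrow> bool" where
  "gzz_circuit n gs \<longleftrightarrow> (\<forall>g\<in>set gs. gzz_gate_on n g)"

definition gzz_circuit_mat :: "nat \<Rightarrow> real \<Rightarrow> gzz_gate list \<Rightarrow> complex mat" where
  "gzz_circuit_mat n \<alpha> gs = circuit_mat n (gzz_gate_mat n \<alpha>) gs"

definition eq_up_to_phase :: "complex mat \<Rightarrow> complex mat \<Rightarrow> bool" where
  "eq_up_to_phase A B \<longleftrightarrow> (\<exists>\<theta>::real. A = cis \<theta> \<cdot>\<^sub>m B)"

end

theory Submission imports Defs begin

text \<open>
  Conjugating \<open>GZZ(\<pi>/2\<^sup>k\<^sup>+\<^sup>1)\<close> by Pauli \<open>X\<close> gates changes the signs of its terms \<open>Z\<^sub>i Z\<^sub>j\<close>. If the sign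
  patterns of \<open>2\<^sup>k\<close> such gates assign to each qubit a row of a Hadamard matrix, then the terms of pairs
  with different rows cancel, and those of pairs with equal rows add up to the angle of a CZ gate: up to local
  gates, \<open>2\<^sup>k\<close> gates implement the CZ gates along any disjoint union of cliques, and \<open>2\<cdot>2\<^sup>k\<close> gates those
  along any disjoint union of bicliques.

  It remains to write a Clifford circuit with \<open>O(n/log n)\<close> layers of disjoint bicliques. Let \<open>B\<close> be generated by the
  gates S, CZ and the CNOT gates from smaller to larger qubits, and \<open>J = H\<^sup>\<otimes>\<^sup>n\<close>. Every Clifford operator lies in
  \<open>B (J B J) B\<close>: this set absorbs the rank one subgroup of every simple root (adjacent CNOT gates, and the
  single-qubit Clifford group of the last qubit). An element of \<open>B\<close> is a quadratic phase, i.e. a CZ graph, times a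
  unitriangular CNOT circuit. Divide the qubits into groups of \<open>g\<close> blocks of \<open>b \<approx> (log n)/2\<close> qubits with \<open>4g = 2\<^sup>b\<close>.
  The edges between a group and other qubits take \<open>2\<^sup>b\<close> layers, one for each subset \<open>t\<close> of \<open>{0..<b}\<close>: the neighbourhood
  of a qubit in each block is the symmetric difference of two subsets, and all subsets chosen for the blocks of a
  group can be taken distinct, so that in layer \<open>t\<close> every qubit is joined to (the subset \<open>t\<close> of) at most one block.
  The edges inside the groups are stars, treated in parallel for all groups.
\<close>

text \<open>A batch of \<open>2^k\<close> gates costs about n gates however many edges it realizes,
  so what counts is the number of layers. Stars alone need about n layers per graph, hence about n^2
  gates; the logarithm is gained by encoding the adjacency to a block of b qubits as a subset. A
  layer must be a disjoint union of bicliques, which is why the subsets of different blocks have to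
  be distinct, and why a group has only \<open>2^b / 4\<close> blocks. A group of g*b qubits then
  costs \<open>2^b = 4 g\<close> layers, i.e. 4/b per qubit, and with \<open>2^b\<close> of the
  order of sqrt(n) the g*b stars inside the groups are of lower order. The three factor form
  replaces the Bruhat decomposition: as every Clifford gate is a product of elements of B and of the
  simple rank one subgroups, it is enough that B (J B J) B absorbs these on the right, and no
  combinatorics of the Weyl group enters. Each rank one subgroup must itself have this form, which
  is a computation with two generators. Scalars belong to B because S H S H S is H only up to an
  eighth root of unity.\<close>

section \<open>Operators on functions of bit strings\<close>

type_synonym state = "nat \<Rightarrow> bool"
type_synonym state_op = "(state \<Rightarrow> complex) \<Rightarrow> state \<Rightarrow> complex"

text \<open>
  Bit strings are infinite here, so that the operators do not depend on the number of qubits.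
\<close>

definition Dg :: "(state \<Rightarrow> complex) \<Rightarrow> state_op" where
  "Dg c \<psi> x = c x * \<psi> x"

text \<open>A pullback, so \<open>Pm\<close> reverses composition: the leftmost operator of a
  product contributes the map that is applied first.\<close>

definition Pm :: "(state \<Rightarrow> state) \<Rightarrow> state_op" where
  "Pm f \<psi> x = \<psi> (f x)"

definition Had :: "nat \<Rightarrow> state_op" where
  "Had q \<psi> x = (\<psi> (x(q := False)) + (if x q then -1 else 1) * \<psi> (x(q := True))) / complex_of_real (sqrt 2)"

abbreviation Ph :: "real \<Rightarrow> state_op" where
  "Ph \<theta> \<equiv> Dg (\<lambda>_. cis \<theta>)"

definition Sg :: "nat \<Rightarrow> state_op" where
  "Sg q = Dg (\<lambda>x. if x q then \<i> else 1)"

definition Cz :: "nat \<Rightarrow> nat \<Rightarrow> state_op" where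
  "Cz a b = Dg (\<lambda>x. if x a \<and> x b then -1 else 1)"

definition Cx :: "nat \<Rightarrow> nat \<Rightarrow> state_op" where
  "Cx c t = Pm (\<lambda>x. x(t := (x t \<noteq> x c)))"

lemma Dg_comp: "Dg c \<circ> Dg d = Dg (\<lambda>x. c x * d x)"
  by (auto simp: Dg_def fun_eq_iff)

lemma Dg_one: "Dg (\<lambda>_. 1) = id"
  by (auto simp: Dg_def fun_eq_iff)

lemma Pm_comp: "Pm f \<circ> Pm g = Pm (g \<circ> f)"
  by (auto simp: Pm_def fun_eq_iff)

lemma Pm_id: "Pm (\<lambda>x. x) = id"
  by (auto simp: Pm_def fun_eq_iff)

lemma Pm_cong: "(\<And>x j. f x j = g x j) \<Longrightarrow> Pm f = Pm g"
  by (rule arg_cong[of f g Pm]) (auto simp: fun_eq_iff)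

lemma Pm_Dg: "Pm f \<circ> Dg c = Dg (\<lambda>x. c (f x)) \<circ> Pm f"
  by (auto simp: Pm_def Dg_def fun_eq_iff)

lemma Dg_commute: "Dg c \<circ> Dg d = Dg d \<circ> Dg c"
  by (auto simp: Dg_def fun_eq_iff)

lemma Ph_Pm: "Ph \<theta> \<circ> Pm f = Pm f \<circ> Ph \<theta>"
  by (auto simp: Pm_def Dg_def fun_eq_iff)

lemma Ph_Had: "Ph \<theta> \<circ> Had q = Had q \<circ> Ph \<theta>"
  by (auto simp: Had_def Dg_def fun_eq_iff field_simps)

lemma Ph_add: "Ph \<theta> \<circ> Ph \<eta> = Ph (\<theta> + \<eta>)"
  by (simp add: Dg_comp cis_mult)

lemma sqrt2_mult [simp]: "complex_of_real (sqrt 2) * complex_of_real (sqrt 2) = 2"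
  by (metis of_real_mult of_real_numeral real_sqrt_mult_self abs_numeral)

lemma Had_Had: "Had q \<circ> Had q = id"
proof (intro ext)
  fix \<psi> and x :: state
  have "x(q := x q) = x" by simp
  then show "(Had q \<circ> Had q) \<psi> x = id \<psi> x"
    by (cases "x q") (auto simp: Had_def field_simps)
qed

lemma Had_commute: "Had p \<circ> Had q = Had q \<circ> Had p"
proof (cases "p = q")
  case False
  then show ?thesis
    by (intro ext) (auto simp: Had_def fun_upd_twist[of p q] field_simps)
qed simp

definition indep :: "nat \<Rightarrow> (state \<Rightarrow> 'a) \<Rightarrow> bool" where
  "indep q c \<longleftrightarrow> (\<forall>x v. c (x(q := v)) = c x)"

lemma Had_Dg: "indep q c \<Longrightarrow> Had q \<circ> Dg c = Dg c \<circ> Had q"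
  by (intro ext) (auto simp: Had_def Dg_def indep_def field_simps)

lemma Had_Pm_row:
  assumes "indep q p" "q \<noteq> t"
  shows "Had q \<circ> Pm (\<lambda>x. x(t := (x t \<noteq> p x))) = Pm (\<lambda>x. x(t := (x t \<noteq> p x))) \<circ> Had q"
  using assms by (intro ext) (auto simp: Had_def Pm_def indep_def fun_upd_twist[of t q])

text \<open>This is H Z H = X under an arbitrary classical control \<open>p\<close>. The CNOT gate,
  the X gate (\<open>p\<close> constantly true) and a target that collects the parity of several
  sources are all instances.\<close>

lemma Had_row:
  assumes "indep t p"
  shows "Had t \<circ> Dg (\<lambda>x. if x t \<and> p x then -1 else 1) \<circ> Had t = Pm (\<lambda>x. x(t := (x t \<noteq> p x)))"
proof (intro ext)
  fix \<psi> and x :: state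
  have "x(t := x t) = x" by simp
  moreover have "p (x(t := v)) = p x" for v using assms by (auto simp: indep_def)
  ultimately show "(Had t \<circ> Dg (\<lambda>x. if x t \<and> p x then -1 else 1) \<circ> Had t) \<psi> x
     = Pm (\<lambda>x. x(t := (x t \<noteq> p x))) \<psi> x"
    by (cases "x t"; cases "p x") (auto simp: Had_def Pm_def Dg_def field_simps)
qed

lemma Cx_eq: "a \<noteq> b \<Longrightarrow> Cx a b = Had b \<circ> Cz a b \<circ> Had b"
  using Had_row[of b "\<lambda>x. x a"] by (auto simp: Cx_def Cz_def indep_def conj_commute)

lemma Cz_sym: "Cz a b = Cz b a"
  by (simp add: Cz_def conj_commute)

lemma Had_Sg: "q \<noteq> a \<Longrightarrow> Had q \<circ> Sg a = Sg a \<circ> Had q"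
  unfolding Sg_def by (rule Had_Dg) (auto simp: indep_def)

lemma Had_Cz: "q \<noteq> a \<Longrightarrow> q \<noteq> b \<Longrightarrow> Had q \<circ> Cz a b = Cz a b \<circ> Had q"
  unfolding Cz_def by (rule Had_Dg) (auto simp: indep_def)

lemma Had_Cx: "q \<noteq> a \<Longrightarrow> q \<noteq> b \<Longrightarrow> Had q \<circ> Cx a b = Cx a b \<circ> Had q"
  unfolding Cx_def by (rule Had_Pm_row) (auto simp: indep_def)

lemma Cx_Cx: "a \<noteq> b \<Longrightarrow> Cx a b \<circ> Cx a b = id"
  unfolding Cx_def Pm_comp Pm_id[symmetric] by (rule Pm_cong) auto

lemma Sg4: "Sg a \<circ> (Sg a \<circ> (Sg a \<circ> Sg a)) = id"
  by (auto simp: Sg_def Dg_def fun_eq_iff)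

text \<open>The rank one relation of the last simple root: up to phase, the Weyl element H is a
  product of one element of U = <S>, one of H U H and one of U.\<close>

lemma Sg_Had_Sg: "Ph (pi / 4) \<circ> Had q = Sg q \<circ> (Had q \<circ> Sg q \<circ> Had q) \<circ> Sg q"
proof (intro ext)
  fix \<psi> and x :: state
  define s where "s = 1 / complex_of_real (sqrt 2)"
  have s: "s * s = 1 / 2" "s * (s * z) = z / 2" for z
    by (auto simp: s_def field_simps simp flip: mult.assoc)
  have d: "z / complex_of_real (sqrt 2) = s * z" for z
    by (simp add: s_def)
  have x: "x(q := x q) = x" by simp
  have c: "cis (pi / 4) = s + \<i> * s"
    by (simp add: s_def complex_eq_iff cos_45 sin_45 field_simps Re_divide Im_divide power2_eq_square)
  show "(Ph (pi / 4) \<circ> Had q) \<psi> x = (Sg q \<circ> (Had q \<circ> Sg q \<circ> Had q) \<circ> Sg q) \<psi> x"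
    unfolding comp_apply Dg_def Sg_def Had_def d c
    using s x by (cases "x q") (auto simp: algebra_simps)
qed

text \<open>This and the following rules are commutator relations of root subgroups: moving a
  generator past another one creates only further generators. They yield the normality of the
  radicals.\<close>

lemma Cx_Cx_target: "i \<noteq> a \<Longrightarrow> i \<noteq> b \<Longrightarrow> a \<noteq> b \<Longrightarrow> Cx a b \<circ> Cx i a = Cx i b \<circ> Cx i a \<circ> Cx a b"
  unfolding Cx_def Pm_comp by (rule Pm_cong) auto

lemma Cx_Cx_control: "j \<noteq> a \<Longrightarrow> j \<noteq> b \<Longrightarrow> a \<noteq> b \<Longrightarrow> Cx a b \<circ> Cx b j = Cx b j \<circ> Cx a j \<circ> Cx a b"
  unfolding Cx_def Pm_comp by (rule Pm_cong) auto

lemma Cx_Cx_commute: "j \<noteq> a \<Longrightarrow> i \<noteq> b \<Longrightarrow> i \<noteq> j \<Longrightarrow> a \<noteq> b \<Longrightarrow> Cx a b \<circ> Cx i j = Cx i j \<circ> Cx a b"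
  unfolding Cx_def Pm_comp by (rule Pm_cong) auto

lemma Cx_Cz: "j \<noteq> a \<Longrightarrow> j \<noteq> b \<Longrightarrow> a \<noteq> b \<Longrightarrow> Cx a b \<circ> Cz b j = Cz b j \<circ> Cz a j \<circ> Cx a b"
  by (auto simp: Cx_def Cz_def Dg_def Pm_def fun_eq_iff)

lemma Cx_Cz_same: "a \<noteq> b \<Longrightarrow> Cx a b \<circ> Cz a b = Cz a b \<circ> Sg a \<circ> Sg a \<circ> Cx a b"
  by (auto simp: Cx_def Cz_def Dg_def Sg_def Pm_def fun_eq_iff)

lemma Cx_Cz_commute: "i \<noteq> b \<Longrightarrow> j \<noteq> b \<Longrightarrow> Cx a b \<circ> Cz i j = Cz i j \<circ> Cx a b"
  by (auto simp: Cx_def Cz_def Dg_def Pm_def fun_eq_iff)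

lemma Cx_Sg: "a \<noteq> b \<Longrightarrow> Cx a b \<circ> Sg b = Sg b \<circ> Sg a \<circ> Cz a b \<circ> Cx a b"
  unfolding Cx_def Cz_def Sg_def Pm_Dg Dg_comp
  by (rule arg_cong[where f = "\<lambda>c. Dg c \<circ> _"]) (auto simp: fun_eq_iff)

lemma Cx_Sg_commute: "i \<noteq> b \<Longrightarrow> Cx a b \<circ> Sg i = Sg i \<circ> Cx a b"
  by (auto simp: Cx_def Dg_def Sg_def Pm_def fun_eq_iff)

lemma Sg_Cx: "a \<noteq> b \<Longrightarrow> Sg b \<circ> Cx a b = Cx a b \<circ> Cz a b \<circ> Sg a \<circ> Sg b"
  by (auto simp: Cx_def Cz_def Dg_def Sg_def Pm_def fun_eq_iff)

text \<open>Both sides exchange the two bits. Together with involutivity this presents the symmetric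
  group on three letters, i.e. SL(2,2).\<close>

lemma Cx_braid: "a \<noteq> b \<Longrightarrow> Cx a b \<circ> (Cx b a \<circ> Cx a b) = Cx b a \<circ> (Cx a b \<circ> Cx b a)"
  unfolding Cx_def Pm_comp by (rule Pm_cong) auto

lemma Had_swap: assumes "a \<noteq> b"
  shows "Had a = (Cx a b \<circ> Cx b a \<circ> Cx a b) \<circ> Had b \<circ> (Cx a b \<circ> Cx b a \<circ> Cx a b)"
proof (intro ext)
  fix \<psi> and x :: state
  have swap: "Cx a b \<circ> Cx b a \<circ> Cx a b = Pm (\<lambda>x. x(a := x b, b := x a))"
    unfolding Cx_def Pm_comp using assms by (intro Pm_cong) auto
  have "x(a := x a) = x" "x(b := x b) = x" "x(a:=v, b := x b) = x(a:=v)" for v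
    using assms by (auto simp: fun_eq_iff)
  then show "Had a \<psi> x = ((Cx a b \<circ> Cx b a \<circ> Cx a b) \<circ> Had b \<circ> (Cx a b \<circ> Cx b a \<circ> Cx a b)) \<psi> x"
    unfolding swap using assms by (auto simp: Had_def Pm_def fun_upd_twist[of a b])
qed

section \<open>Clifford circuits as products of three Borel factors\<close>

text \<open>Generated as a monoid; inverses come from the finite order of the generators
  (\<open>words_inverse\<close>), or from the negated angle in the case of phases.\<close>

inductive_set op_words :: "state_op set \<Rightarrow> state_op set" for X where
  words_id: "id \<in> op_words X"
| words_step: "g \<in> X \<Longrightarrow> F \<in> op_words X \<Longrightarrow> g \<circ> F \<in> op_words X"

lemma words_gen: "g \<in> X \<Longrightarrow> g \<in> op_words X"
  using words_step[OF _ words_id, of g X] by simp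

lemma words_comp: "F \<in> op_words X \<Longrightarrow> G \<in> op_words X \<Longrightarrow> F \<circ> G \<in> op_words X"
  by (induction rule: op_words.induct) (auto simp: comp_assoc intro: words_step)

lemma words_mono: "F \<in> op_words X \<Longrightarrow> X \<subseteq> op_words Y \<Longrightarrow> F \<in> op_words Y"
  by (induction rule: op_words.induct) (auto intro: words_id words_comp)

lemma words_normal:
  assumes "\<And>g. g \<in> X \<Longrightarrow> \<exists>r\<in>op_words X. y \<circ> g = r \<circ> y"
  shows "r \<in> op_words X \<Longrightarrow> \<exists>r'\<in>op_words X. y \<circ> r = r' \<circ> y"
proof (induction rule: op_words.induct)
  case words_id
  show ?case by (rule bexI[of _ id]) (auto intro: op_words.words_id)
next
  case (words_step g F)
  obtain r1 r2 where r: "r1 \<in> op_words X" "y \<circ> g = r1 \<circ> y" "r2 \<in> op_words X" "y \<circ> F = r2 \<circ> y"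
    using words_step assms by blast
  have "y \<circ> (g \<circ> F) = (r1 \<circ> r2) \<circ> y"
    using r by (metis comp_assoc)
  then show ?case using words_comp r by blast
qed

lemma words_normal_words:
  assumes "\<And>y g. y \<in> Y \<Longrightarrow> g \<in> X \<Longrightarrow> \<exists>r\<in>op_words X. y \<circ> g = r \<circ> y"
  shows "y \<in> op_words Y \<Longrightarrow> r \<in> op_words X \<Longrightarrow> \<exists>r'\<in>op_words X. y \<circ> r = r' \<circ> y"
proof (induction arbitrary: r rule: op_words.induct)
  case words_id
  then show ?case by (auto intro!: bexI[of _ r])
next
  case (words_step g F)
  obtain r1 where r1: "r1 \<in> op_words X" "F \<circ> r = r1 \<circ> F" using words_step by blast
  obtain r2 where "r2 \<in> op_words X" "g \<circ> r1 = r2 \<circ> g"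
    using words_normal[of X g, OF assms[OF words_step(1)] r1(1)] by blast
  then show ?case using r1 by (metis comp_assoc)
qed

lemma words_inverse:
  assumes "\<And>y. y \<in> Y \<Longrightarrow> \<exists>z\<in>op_words Y. y \<circ> z = id \<and> z \<circ> y = id"
  shows "y \<in> op_words Y \<Longrightarrow> \<exists>z\<in>op_words Y. y \<circ> z = id \<and> z \<circ> y = id"
proof (induction rule: op_words.induct)
  case words_id
  show ?case by (rule bexI[of _ id]) (auto intro: op_words.words_id)
next
  case (words_step g F)
  obtain z w where z: "z \<in> op_words Y" "F \<circ> z = id" "z \<circ> F = id" and w: "w \<in> op_words Y" "g \<circ> w = id" "w \<circ> g = id"
    using words_step assms by blast
  have "g \<circ> F \<circ> (z \<circ> w) = id" "(z \<circ> w) \<circ> (g \<circ> F) = id"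
    using z w by (metis comp_assoc comp_id)+
  then show ?case using z w words_comp by blast
qed

text \<open>Applies left normality to the inverse of \<open>y\<close>, which is again a word in
  \<open>Y\<close>.\<close>

lemma words_normal_right:
  assumes "\<And>y g. y \<in> Y \<Longrightarrow> g \<in> X \<Longrightarrow> \<exists>r\<in>op_words X. y \<circ> g = r \<circ> y"
    and "\<And>y. y \<in> Y \<Longrightarrow> \<exists>z\<in>op_words Y. y \<circ> z = id \<and> z \<circ> y = id"
    and "y \<in> op_words Y" "r \<in> op_words X"
  shows "\<exists>r'\<in>op_words X. r \<circ> y = y \<circ> r'"
proof -
  obtain z where z: "z \<in> op_words Y" "y \<circ> z = id" "z \<circ> y = id"
    using words_inverse[OF assms(2,3)] by blast
  obtain r' where r: "r' \<in> op_words X" "z \<circ> r = r' \<circ> z"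
    using words_normal_words[OF assms(1) z(1) assms(4)] by blast
  have "r \<circ> y = y \<circ> (z \<circ> r) \<circ> y" using z by (simp add: o_assoc)
  also have "\<dots> = y \<circ> r'" using r z by (simp add: comp_assoc)
  finally show ?thesis using r by blast
qed

definition triple :: "state_op \<Rightarrow> state_op set \<Rightarrow> state_op set" where
  "triple J B = {b1 \<circ> (J \<circ> b2 \<circ> J) \<circ> b3 | b1 b2 b3. b1 \<in> B \<and> b2 \<in> B \<and> b3 \<in> B}"

text \<open>
  Tavgen's rank reduction. \<open>R\<close> plays the role of the unipotent radical of a minimal parabolic subgroup with Levi
  factor \<open>L\<close>, which normalizes both \<open>R\<close> and \<open>J R J\<close>; everything outside of \<open>L\<close> can therefore be moved to the left.
\<close>

lemma triple_absorb:
  assumes JJ: "J \<circ> J = id"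
    and B: "\<And>b c. b \<in> B \<Longrightarrow> c \<in> B \<Longrightarrow> b \<circ> c \<in> B" "R \<subseteq> B" "U \<subseteq> B"
    and BRU: "\<And>b. b \<in> B \<Longrightarrow> \<exists>r\<in>R. \<exists>u\<in>U. b = r \<circ> u"
    and L: "\<And>k l. k \<in> L \<Longrightarrow> l \<in> L \<Longrightarrow> k \<circ> l \<in> L" "U \<subseteq> L" "\<And>l. l \<in> L \<Longrightarrow> J \<circ> l \<circ> J \<in> L"
    and LU: "\<And>l. l \<in> L \<Longrightarrow> l \<in> triple J U"
    and nl: "\<And>l r. l \<in> L \<Longrightarrow> r \<in> R \<Longrightarrow> \<exists>r'\<in>R. l \<circ> r = r' \<circ> l"
    and nr: "\<And>l r. l \<in> L \<Longrightarrow> r \<in> R \<Longrightarrow> \<exists>r'\<in>R. r \<circ> l = l \<circ> r'"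
    and y: "y \<in> triple J B" and l: "l \<in> L"
  shows "y \<circ> l \<in> triple J B"
proof -
  have JJx: "J \<circ> (J \<circ> x) = x" for x :: state_op
    using JJ by (simp add: o_assoc)
  obtain b1 b2 b3 where b: "b1 \<in> B" "b2 \<in> B" "b3 \<in> B" "y = b1 \<circ> (J \<circ> b2 \<circ> J) \<circ> b3"
    using y by (auto simp: triple_def)
  obtain r1 v1 where 1: "r1 \<in> R" "v1 \<in> U" "b1 = r1 \<circ> v1" using BRU b(1) by blast
  \<comment> \<open>Here the radical part is put on the right, unlike in \<open>b1\<close> and
    \<open>b3\<close>, so that \<open>v1\<close> and \<open>J \<circ> v2 \<circ> J\<close> become
    neighbours and merge into the Levi element \<open>g\<close>.\<close>
  obtain r2 v2 where 2: "r2 \<in> R" "v2 \<in> U" "b2 = v2 \<circ> r2" using BRU[OF b(2)] nr L(2) by blast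
  obtain r3 v3 where 3: "r3 \<in> R" "v3 \<in> U" "b3 = r3 \<circ> v3" using BRU b(3) by blast
  define g where "g = v1 \<circ> (J \<circ> v2 \<circ> J)"
  have g: "g \<in> L" unfolding g_def using 1 2 L by blast
  have Jg: "J \<circ> g \<circ> J \<in> L" using g L by blast
  obtain r2' where r2': "r2' \<in> R" "(J \<circ> g \<circ> J) \<circ> r2 = r2' \<circ> (J \<circ> g \<circ> J)" using nl[OF Jg 2(1)] by blast
  obtain r3' where r3': "r3' \<in> R" "g \<circ> r3 = r3' \<circ> g" using nl[OF g 3(1)] by blast
  have e1: "g \<circ> (J \<circ> r2 \<circ> J) = (J \<circ> r2' \<circ> J) \<circ> g"
  proof -
    have "g \<circ> (J \<circ> r2 \<circ> J) = J \<circ> ((J \<circ> g \<circ> J) \<circ> r2) \<circ> J" by (simp add: comp_assoc JJx)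
    also have "\<dots> = (J \<circ> r2' \<circ> J) \<circ> g" unfolding r2' by (simp add: comp_assoc JJ)
    finally show ?thesis .
  qed
  \<comment> \<open>With all radical parts moved to the left, the new factor only meets a single
    Levi element. Its rank one decomposition provides one factor for each of the three positions,
    and \<open>w1\<close>, \<open>w2\<close> are moved back to theirs.\<close>
  have "g \<circ> v3 \<circ> l \<in> L" using g 3 l L by blast
  then obtain w1 w2 w3 where w: "w1 \<in> U" "w2 \<in> U" "w3 \<in> U" "g \<circ> v3 \<circ> l = w1 \<circ> (J \<circ> w2 \<circ> J) \<circ> w3"
    using LU by (force simp: triple_def)
  have w1L: "w1 \<in> L" "J \<circ> w1 \<circ> J \<in> L" and w2L: "J \<circ> w2 \<circ> J \<in> L" using w L by blast+
  obtain r3'' where r3'': "r3'' \<in> R" "r3' \<circ> w1 = w1 \<circ> r3''" using nr[OF w1L(1) r3'(1)] by blast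
  obtain r2'' where r2'': "r2'' \<in> R" "r2' \<circ> (J \<circ> w1 \<circ> J) = (J \<circ> w1 \<circ> J) \<circ> r2''" using nr[OF w1L(2) r2'(1)] by blast
  obtain r3c where r3c: "r3c \<in> R" "r3'' \<circ> (J \<circ> w2 \<circ> J) = (J \<circ> w2 \<circ> J) \<circ> r3c" using nr[OF w2L r3''(1)] by blast
  have e2: "(J \<circ> r2' \<circ> J) \<circ> w1 = w1 \<circ> (J \<circ> r2'' \<circ> J)"
  proof -
    have "(J \<circ> r2' \<circ> J) \<circ> w1 = J \<circ> (r2' \<circ> (J \<circ> w1 \<circ> J)) \<circ> J" by (simp add: comp_assoc JJ)
    also have "\<dots> = w1 \<circ> (J \<circ> r2'' \<circ> J)" unfolding r2'' by (simp add: comp_assoc JJx)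
    finally show ?thesis .
  qed
  have "y \<circ> l = r1 \<circ> (g \<circ> (J \<circ> r2 \<circ> J)) \<circ> r3 \<circ> v3 \<circ> l"
    unfolding b 1 2 3 g_def by (simp add: comp_assoc JJx)
  also have "\<dots> = r1 \<circ> (J \<circ> r2' \<circ> J) \<circ> (g \<circ> r3) \<circ> v3 \<circ> l"
    unfolding e1 by (simp add: comp_assoc)
  also have "\<dots> = r1 \<circ> (J \<circ> r2' \<circ> J) \<circ> r3' \<circ> (g \<circ> v3 \<circ> l)"
    unfolding r3' by (simp add: comp_assoc)
  also have "\<dots> = r1 \<circ> (J \<circ> r2' \<circ> J) \<circ> (r3' \<circ> w1) \<circ> (J \<circ> w2 \<circ> J) \<circ> w3"
    unfolding w by (simp add: comp_assoc)
  also have "\<dots> = r1 \<circ> ((J \<circ> r2' \<circ> J) \<circ> w1) \<circ> (r3'' \<circ> (J \<circ> w2 \<circ> J)) \<circ> w3"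
    unfolding r3'' by (simp add: comp_assoc)
  also have "\<dots> = (r1 \<circ> w1) \<circ> (J \<circ> (r2'' \<circ> w2) \<circ> J) \<circ> (r3c \<circ> w3)"
    unfolding e2 r3c by (simp add: comp_assoc JJx)
  finally have "y \<circ> l = (r1 \<circ> w1) \<circ> (J \<circ> (r2'' \<circ> w2) \<circ> J) \<circ> (r3c \<circ> w3)" .
  moreover have "r1 \<circ> w1 \<in> B" "r2'' \<circ> w2 \<in> B" "r3c \<circ> w3 \<in> B"
    using 1 r2'' r3c w B by blast+
  ultimately show ?thesis unfolding triple_def by blast
qed

section \<open>Conjugation by layers of Hadamard gates\<close>

primrec hadamards :: "nat set \<Rightarrow> nat \<Rightarrow> state_op" where
  "hadamards A 0 = id"
| "hadamards A (Suc k) = (if k \<in> A then Had k else id) \<circ> hadamards A k"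

lemma hadamards_commute:
  assumes "\<And>q. q < n \<Longrightarrow> q \<in> A \<Longrightarrow> Had q \<circ> F = F \<circ> Had q"
  shows "hadamards A n \<circ> F = F \<circ> hadamards A n"
  using assms
proof (induction n)
  case (Suc k)
  then show ?case
    by (auto simp: comp_assoc) (metis comp_assoc lessI)
qed simp

lemma hadamards_hadamards: "hadamards A n \<circ> hadamards A n = id"
proof (induction n)
  case (Suc k)
  have "hadamards A k \<circ> Had k = Had k \<circ> hadamards A k" by (rule hadamards_commute) (rule Had_commute)
  then have "Had k \<circ> hadamards A k \<circ> (Had k \<circ> hadamards A k) = (Had k \<circ> Had k) \<circ> (hadamards A k \<circ> hadamards A k)"
    by (metis comp_assoc)
  then have "Had k \<circ> hadamards A k \<circ> (Had k \<circ> hadamards A k) = id"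
    using Suc by (simp only: Had_Had comp_id)
  then show ?case using Suc by (cases "k \<in> A") (simp_all only: hadamards.simps if_True if_False id_comp)
qed simp

lemma hadamards_split: "a < n \<Longrightarrow> a \<in> A \<Longrightarrow> hadamards A n = Had a \<circ> hadamards (A - {a}) n"
proof (induction n)
  case (Suc k)
  have eq: "hadamards A a = hadamards (A - {a}) a" for a
  proof -
    have "k \<le> a \<Longrightarrow> hadamards A k = hadamards (A - {a}) k" for k by (induction k) auto
    then show ?thesis by blast
  qed
  show ?case
  proof (cases "a = k")
    case True
    then show ?thesis using Suc.prems eq[of k] by simp
  next
    case False
    then have "hadamards A k = Had a \<circ> hadamards (A - {a}) k" using Suc by auto
    moreover have "Had k \<circ> (Had a \<circ> hadamards (A - {a}) k) = Had a \<circ> (Had k \<circ> hadamards (A - {a}) k)"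
      by (metis Had_commute comp_assoc)
    ultimately show ?thesis using False by (cases "k \<in> A") (simp_all add: comp_assoc del: o_apply)
  qed
qed simp

text \<open>The Hadamards away from \<open>a\<close> commute with \<open>F\<close> and cancel in
  pairs.\<close>

lemma hadamards_conj1:
  assumes "a < n" "\<And>q. q < n \<Longrightarrow> q \<noteq> a \<Longrightarrow> Had q \<circ> F = F \<circ> Had q"
  shows "hadamards UNIV n \<circ> F \<circ> hadamards UNIV n = Had a \<circ> F \<circ> Had a"
proof -
  let ?K = "hadamards (UNIV - {a}) n"
  have 1: "Had a \<circ> ?K = ?K \<circ> Had a" by (rule hadamards_commute[symmetric]) (rule Had_commute)
  have 2: "?K \<circ> F = F \<circ> ?K" by (rule hadamards_commute) (use assms in auto)
  have "(Had a \<circ> ?K) \<circ> F \<circ> (Had a \<circ> ?K) = Had a \<circ> (?K \<circ> F) \<circ> (Had a \<circ> ?K)"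
    by (simp only: comp_assoc)
  also have "\<dots> = Had a \<circ> F \<circ> (?K \<circ> ?K) \<circ> Had a"
    unfolding 1 2 by (simp only: comp_assoc)
  also have "\<dots> = Had a \<circ> F \<circ> Had a" by (simp only: hadamards_hadamards comp_id)
  finally show ?thesis using hadamards_split[OF assms(1), of UNIV] by (simp only: UNIV_I simp_thms)
qed

lemma hadamards_conj2:
  assumes "a < n" "b < n" "a \<noteq> b" "\<And>q. q < n \<Longrightarrow> q \<noteq> a \<Longrightarrow> q \<noteq> b \<Longrightarrow> Had q \<circ> F = F \<circ> Had q"
  shows "hadamards UNIV n \<circ> F \<circ> hadamards UNIV n = Had a \<circ> (Had b \<circ> F \<circ> Had b) \<circ> Had a"
proof -
  let ?K = "hadamards (UNIV - {a} - {b}) n"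
  have 1: "Had a \<circ> ?K = ?K \<circ> Had a" by (rule hadamards_commute[symmetric]) (rule Had_commute)
  have 2: "Had b \<circ> ?K = ?K \<circ> Had b" by (rule hadamards_commute[symmetric]) (rule Had_commute)
  have 3: "?K \<circ> F = F \<circ> ?K" by (rule hadamards_commute) (use assms in auto)
  have "(Had a \<circ> (Had b \<circ> ?K)) \<circ> F \<circ> (Had a \<circ> (Had b \<circ> ?K)) = Had a \<circ> Had b \<circ> (?K \<circ> F) \<circ> (Had a \<circ> Had b) \<circ> ?K"
    by (simp add: comp_assoc)
  also have "\<dots> = Had a \<circ> Had b \<circ> F \<circ> (?K \<circ> Had a) \<circ> Had b \<circ> ?K"
    by (simp add: 3 comp_assoc)
  also have "\<dots> = Had a \<circ> Had b \<circ> F \<circ> (Had a \<circ> (?K \<circ> Had b)) \<circ> ?K"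
    by (simp add: 1[symmetric] comp_assoc)
  also have "\<dots> = Had a \<circ> Had b \<circ> F \<circ> (Had a \<circ> Had b) \<circ> (?K \<circ> ?K)"
    by (simp add: 2[symmetric] comp_assoc)
  also have "\<dots> = Had a \<circ> (Had b \<circ> F \<circ> Had b) \<circ> Had a"
    unfolding hadamards_hadamards comp_id comp_assoc by (metis Had_commute)
  finally show ?thesis
    using hadamards_split[OF assms(1), of UNIV] hadamards_split[OF assms(2), of "UNIV - {a}"] assms(3) by simp
qed

lemma hadamards_Had: "hadamards UNIV n \<circ> Had a \<circ> hadamards UNIV n = Had a"
proof -
  have "hadamards UNIV n \<circ> Had a = Had a \<circ> hadamards UNIV n" by (rule hadamards_commute) (rule Had_commute)
  then show ?thesis by (simp add: comp_assoc hadamards_hadamards)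
qed

lemma hadamards_Ph: "hadamards A n \<circ> Ph \<theta> = Ph \<theta> \<circ> hadamards A n"
  by (rule hadamards_commute) (rule Ph_Had[symmetric])

text \<open>Conjugation by \<open>J\<close> thus turns upward CNOT gates into downward ones, as is
  expected of the passage to the opposite Borel group.\<close>

lemma hadamards_Cx: assumes "a < n" "b < n" "a \<noteq> b" shows "hadamards UNIV n \<circ> Cx a b \<circ> hadamards UNIV n = Cx b a"
proof -
  have "Had b \<circ> Cx a b \<circ> Had b = Had b \<circ> Had b \<circ> Cz a b \<circ> (Had b \<circ> Had b)"
    using Cx_eq assms by (simp add: comp_assoc)
  also have "\<dots> = Cz b a" by (simp add: Had_Had Cz_sym)
  finally have "Had b \<circ> Cx a b \<circ> Had b = Cz b a" .
  then show ?thesis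
    using hadamards_conj2[OF assms Had_Cx] Cx_eq[of b a] assms by simp
qed

text \<open>The predicates serve to leave out one simple root, the CNOT of an adjacent pair or the S
  of the last qubit; the remaining generators then generate the radical of the corresponding minimal
  parabolic group.\<close>

definition gens :: "nat \<Rightarrow> (nat \<Rightarrow> nat \<Rightarrow> bool) \<Rightarrow> (nat \<Rightarrow> bool) \<Rightarrow> state_op set" where
  "gens n P Q = {Cx i j | i j. i < j \<and> j < n \<and> P i j} \<union> {Cz i j | i j. i \<noteq> j \<and> i < n \<and> j < n}
     \<union> {Sg i | i. i < n \<and> Q i} \<union> range Ph"

lemma gens_words:
  "i < j \<Longrightarrow> j < n \<Longrightarrow> P i j \<Longrightarrow> Cx i j \<in> op_words (gens n P Q)"
  "i \<noteq> j \<Longrightarrow> i < n \<Longrightarrow> j < n \<Longrightarrow> Cz i j \<in> op_words (gens n P Q)"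
  "i < n \<Longrightarrow> Q i \<Longrightarrow> Sg i \<in> op_words (gens n P Q)"
  "Ph \<theta> \<in> op_words (gens n P Q)"
  by (auto simp: gens_def intro!: words_gen)

lemma gens_cases:
  assumes "g \<in> gens n P Q"
  obtains (Cx) i j where "g = Cx i j" "i < j" "j < n" "P i j"
    | (Cz) i j where "g = Cz i j" "i \<noteq> j" "i < n" "j < n"
    | (Sg) i where "g = Sg i" "i < n" "Q i"
    | (Ph) \<theta> where "g = Ph \<theta>"
  using assms unfolding gens_def by blast

abbreviation borel_ops :: "nat \<Rightarrow> state_op set" where
  "borel_ops n \<equiv> op_words (gens n (\<lambda>_ _. True) (\<lambda>_. True))"

abbreviation big_cell :: "nat \<Rightarrow> state_op set" where
  "big_cell n \<equiv> triple (hadamards UNIV n) (borel_ops n)"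

text \<open>Reduces the hypotheses of \<open>triple_absorb\<close> to generators: \<open>XR\<close>
  for the radical, \<open>XL\<close> for the Levi factor, \<open>XU\<close> for the part of the Levi
  factor that lies in the Borel group.\<close>

lemma triple_absorb_gens:
  assumes JJ: "J \<circ> J = id"
    and X: "XB = XR \<union> XU" "XU \<subseteq> XL"
    and LJ: "\<And>g. g \<in> XL \<Longrightarrow> J \<circ> g \<circ> J \<in> op_words XL"
    and LU: "\<And>g l. g \<in> XL \<Longrightarrow> l \<in> triple J (op_words XU) \<Longrightarrow> g \<circ> l \<in> triple J (op_words XU)"
    and n: "\<And>y g. y \<in> XL \<Longrightarrow> g \<in> XR \<Longrightarrow> \<exists>r\<in>op_words XR. y \<circ> g = r \<circ> y"
    and i: "\<And>y. y \<in> XL \<Longrightarrow> \<exists>z\<in>op_words XL. y \<circ> z = id \<and> z \<circ> y = id"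
    and y: "y \<in> triple J (op_words XB)" and l: "l \<in> op_words XL"
  shows "y \<circ> l \<in> triple J (op_words XB)"
proof (rule triple_absorb[OF JJ _ _ _ _ _ _ _ _ _ _ y l])
  show "\<exists>r\<in>op_words XR. \<exists>u\<in>op_words XU. b = r \<circ> u" if "b \<in> op_words XB" for b
    using that
  proof (induction rule: op_words.induct)
    case words_id
    show ?case using op_words.words_id by (metis comp_id)
  next
    case (words_step g F)
    then obtain r u where ru: "r \<in> op_words XR" "u \<in> op_words XU" "F = r \<circ> u" by blast
    show ?case
    proof (cases "g \<in> XR")
      case True
      then have "g \<circ> r \<in> op_words XR" using ru by (auto intro: op_words.words_step)
      moreover have "g \<circ> F = (g \<circ> r) \<circ> u" unfolding ru by (simp only: comp_assoc)
      ultimately show ?thesis using ru by blast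
    next
      case False
      then have g: "g \<in> XU" using words_step X by auto
      then obtain r' where r': "r' \<in> op_words XR" "g \<circ> r = r' \<circ> g"
        using words_normal[OF n ru(1)] X by blast
      have "g \<circ> F = (g \<circ> r) \<circ> u" unfolding ru by (simp only: comp_assoc)
      also have "\<dots> = r' \<circ> (g \<circ> u)" unfolding r' by (simp only: comp_assoc)
      finally show ?thesis using r'(1) op_words.words_step[OF g ru(2)] by blast
    qed
  qed
  show "J \<circ> l \<circ> J \<in> op_words XL" if "l \<in> op_words XL" for l
    using that
  proof (induction rule: op_words.induct)
    case words_id
    show ?case by (simp only: JJ comp_id op_words.words_id)
  next
    case (words_step g F)
    have "J \<circ> (g \<circ> F) \<circ> J = J \<circ> g \<circ> (J \<circ> J) \<circ> F \<circ> J" using JJ by (simp add: comp_assoc)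
    also have "\<dots> = (J \<circ> g \<circ> J) \<circ> (J \<circ> F \<circ> J)" by (simp add: comp_assoc)
    finally show ?case using words_step LJ words_comp by metis
  qed
  show "l \<in> triple J (op_words XU)" if "l \<in> op_words XL" for l
    using that
  proof (induction rule: op_words.induct)
    case words_id
    show ?case unfolding triple_def using op_words.words_id JJ
      by (auto intro!: exI[of _ id])
  qed (use LU in blast)
  show "\<exists>r'\<in>op_words XR. l \<circ> r = r' \<circ> l" if "l \<in> op_words XL" "r \<in> op_words XR" for l r
    using words_normal_words[OF n that] .
  show "\<exists>r'\<in>op_words XR. r \<circ> l = l \<circ> r'" if "l \<in> op_words XL" "r \<in> op_words XR" for l r
    using words_normal_right[OF n i that] .
qed (use X in \<open>auto intro: words_comp words_gen elim!: words_mono\<close>)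

lemma Ph_gens: "g \<in> gens n P Q \<Longrightarrow> Ph \<theta> \<circ> g = g \<circ> Ph \<theta>"
  by (auto simp: gens_def Cx_def Cz_def Sg_def Ph_Pm Dg_commute)

lemma triple_Ph:
  assumes "Ph \<theta> \<in> W" "\<And>b c. b \<in> W \<Longrightarrow> c \<in> W \<Longrightarrow> b \<circ> c \<in> W" "l \<in> triple J W"
  shows "Ph \<theta> \<circ> l \<in> triple J W"
proof -
  obtain b1 b2 b3 where b: "b1 \<in> W" "b2 \<in> W" "b3 \<in> W" "l = b1 \<circ> (J \<circ> b2 \<circ> J) \<circ> b3"
    using assms by (auto simp: triple_def)
  have "Ph \<theta> \<circ> l = (Ph \<theta> \<circ> b1) \<circ> (J \<circ> b2 \<circ> J) \<circ> b3" unfolding b by (simp add: comp_assoc)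
  then show ?thesis using assms(2)[OF assms(1) b(1)] b unfolding triple_def by blast
qed

lemma Ph_inverse: "\<exists>\<eta>. Ph \<theta> \<circ> Ph \<eta> = id \<and> Ph \<eta> \<circ> Ph \<theta> = id"
  by (rule exI[of _ "-\<theta>"]) (simp add: Dg_comp cis_mult Dg_one)

section \<open>The simple root of an adjacent pair of qubits\<close>

lemma Cx_normal:
  assumes p: "Suc p < n" and ab: "(a, b) = (p, Suc p) \<or> (a, b) = (Suc p, p)"
    and g: "g \<in> gens n (\<lambda>i j. (i, j) \<noteq> (p, Suc p)) (\<lambda>_. True)"
  shows "\<exists>r\<in>op_words (gens n (\<lambda>i j. (i, j) \<noteq> (p, Suc p)) (\<lambda>_. True)). Cx a b \<circ> g = r \<circ> Cx a b"
    (is "\<exists>r\<in>?W. _")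
  using g
proof (cases rule: gens_cases)
  case (Cx i j)
  note W = words_comp gens_words(1)
  have ab': "a \<noteq> b" "a < n" "b < n" using p ab by auto
  consider "j = a" "i \<noteq> b" | "i = b" "j \<noteq> a" | "j \<noteq> a" "i \<noteq> b"
  proof -
    have "\<not> (j = a \<and> i = b)" using Cx ab by auto
    then show thesis using that by blast
  qed
  then show ?thesis
  proof cases
    case 1
    \<comment> \<open>Adjacency enters here: an index that is below one of \<open>p\<close>,
      \<open>Suc p\<close> and differs from the other is below both. Hence no downward CNOT
      arises.\<close>
    then have "i \<noteq> a" "i < b" using Cx ab by auto
    moreover from this 1 have "Cx i b \<circ> Cx i a \<in> ?W" using Cx ab ab' by (intro W) auto
    ultimately show ?thesis using Cx_Cx_target[of i a b] Cx 1 ab' by auto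
  next
    case 2
    then have "j \<noteq> b" "a < j" using Cx ab by auto
    moreover from this 2 have "Cx b j \<circ> Cx a j \<in> ?W" using Cx ab ab' by (intro W) auto
    ultimately show ?thesis using Cx_Cx_control[of j a b] Cx 2 ab' by auto
  next
    case 3
    then have "Cx a b \<circ> g = g \<circ> Cx a b" using Cx_Cx_commute[of j a i b] Cx ab' by auto
    then show ?thesis using words_gen[OF g] by blast
  qed
next
  case (Cz i j)
  have ab': "a \<noteq> b" "a < n" "b < n" using p ab by auto
  have main: "\<exists>r\<in>?W. Cx a b \<circ> Cz b k = r \<circ> Cx a b" if "k \<noteq> b" "k < n" for k
  proof (cases "k = a")
    case True
    have "Cz a b \<circ> Sg a \<circ> Sg a \<in> ?W" using ab' by (intro words_comp gens_words) auto
    then show ?thesis using Cx_Cz_same[of a b] True ab' by (auto simp: Cz_sym[of b a])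
  next
    case False
    have "Cz b k \<circ> Cz a k \<in> ?W" using ab' that False by (intro words_comp gens_words) auto
    then show ?thesis using Cx_Cz[of k a b] False that ab' by auto
  qed
  consider "i = b" | "j = b" | "i \<noteq> b" "j \<noteq> b" by blast
  then show ?thesis
  proof cases
    case 1
    then show ?thesis using main[of j] Cz by auto
  next
    case 2
    then show ?thesis using main[of i] Cz by (auto simp: Cz_sym[of i b])
  next
    case 3
    then show ?thesis using Cx_Cz_commute[of i b j a] Cz words_gen[OF g] by auto
  qed
next
  case (Sg i)
  have ab': "a \<noteq> b" "a < n" "b < n" using p ab by auto
  show ?thesis
  proof (cases "i = b")
    case True
    have "Sg b \<circ> Sg a \<circ> Cz a b \<in> ?W" using ab' by (intro words_comp gens_words) auto
    then show ?thesis using Cx_Sg[of a b] True Sg ab' by auto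
  next
    case False
    then show ?thesis using Cx_Sg_commute[of i b a] Sg words_gen[OF g] by auto
  qed
next
  case (Ph \<theta>)
  then have "Cx a b \<circ> g = g \<circ> Cx a b" by (simp add: Cx_def Ph_Pm)
  then show ?thesis using words_gen[OF g] by blast
qed

text \<open>Modulo phases, the Levi factor is the group SL(2,2) generated by \<open>?u\<close> and
  \<open>?v = J \<circ> ?u \<circ> J\<close>. All its six elements have the form c1 (J c2 J) c3 with
  each ci either trivial or \<open>?u\<close>, so the rank one case is a finite check.\<close>

lemma big_cell_Cx:
  assumes p: "Suc p < n" and y: "y \<in> big_cell n"
  shows "y \<circ> Cx (Suc p) p \<in> big_cell n"
proof -
  let ?u = "Cx p (Suc p)" and ?v = "Cx (Suc p) p"
  let ?XR = "gens n (\<lambda>i j. (i, j) \<noteq> (p, Suc p)) (\<lambda>_. True)"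
  let ?XU = "insert ?u (range Ph)" and ?XL = "insert ?u (insert ?v (range Ph))"
  let ?J = "hadamards UNIV n" and ?T = "triple (hadamards UNIV n) (op_words (insert ?u (range Ph)))"
  have XB: "gens n (\<lambda>_ _. True) (\<lambda>_. True) = ?XR \<union> ?XU"
    using p unfolding gens_def by auto
  have Ju: "?J \<circ> ?u \<circ> ?J = ?v" "?J \<circ> ?v \<circ> ?J = ?u" using hadamards_Cx p by auto
  have uu: "?u \<circ> ?u = id" "?v \<circ> ?v = id" by (auto intro: Cx_Cx)
  have uux: "?u \<circ> (?u \<circ> x) = x" "?v \<circ> (?v \<circ> x) = x" for x :: state_op
    using uu by (auto simp: o_assoc)
  have JJ: "?J \<circ> ?J = id" by (rule hadamards_hadamards)
  have PhT: "Ph \<theta> \<circ> l \<in> ?T" if "l \<in> ?T" for \<theta> l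
    by (rule triple_Ph[OF _ words_comp that]) (auto intro: words_gen)
  have U: "\<exists>\<theta>. w = Ph \<theta> \<or> w = Ph \<theta> \<circ> ?u" if "w \<in> op_words ?XU" for w
    using that
  proof (induction rule: op_words.induct)
    case words_id
    show ?case using Dg_one by (metis cis_zero)
  next
    case (words_step g F)
    then obtain \<theta> where t: "F = Ph \<theta> \<or> F = Ph \<theta> \<circ> ?u" by blast
    have c: "?u \<circ> (Ph \<theta> \<circ> x) = Ph \<theta> \<circ> (?u \<circ> x)" "?u \<circ> Ph \<theta> = Ph \<theta> \<circ> ?u" for x :: state_op
      by (simp_all add: Ph_Pm Cx_def o_assoc)
    show ?case
    proof (cases "g = ?u")
      case True
      then have "g \<circ> F = Ph \<theta> \<circ> ?u \<or> g \<circ> F = Ph \<theta>"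
        using t by (metis c uu(1) comp_id)
      then show ?thesis by blast
    next
      case False
      then obtain \<eta> where "g = Ph \<eta>" using words_step by auto
      then have "g \<circ> F = Ph (\<eta> + \<theta>) \<or> g \<circ> F = Ph (\<eta> + \<theta>) \<circ> ?u"
        using t by (metis Ph_add comp_assoc)
      then show ?thesis by blast
    qed
  qed
  \<comment> \<open>The complete list of the group; involutivity and the braid relation bring every
    product \<open>g \<circ> l\<close> below back to it.\<close>
  have six: "id \<in> ?T" "?u \<in> ?T" "?v \<in> ?T" "?u \<circ> ?v \<in> ?T" "?v \<circ> ?u \<in> ?T" "?u \<circ> (?v \<circ> ?u) \<in> ?T"
  proof -
    have mem: "id \<in> op_words ?XU" "?u \<in> op_words ?XU" by (auto intro: words_id words_gen)
    have T: "b1 \<circ> (?J \<circ> b2 \<circ> ?J) \<circ> b3 \<in> ?T" if "b1 \<in> op_words ?XU" "b2 \<in> op_words ?XU" "b3 \<in> op_words ?XU" for b1 b2 b3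
      unfolding triple_def using that by blast
    note T' = T[OF mem(1) mem(1) mem(1)] T[OF mem(2) mem(1) mem(1)] T[OF mem(1) mem(2) mem(1)]
        T[OF mem(2) mem(2) mem(1)] T[OF mem(1) mem(2) mem(2)] T[OF mem(2) mem(2) mem(2)]
    have "id \<in> ?T" "?u \<in> ?T" "?v \<in> ?T" "?u \<circ> ?v \<in> ?T" "?v \<circ> ?u \<in> ?T" "?u \<circ> ?v \<circ> ?u \<in> ?T"
      using T' unfolding Ju JJ comp_id id_comp by blast+
    then show "id \<in> ?T" "?u \<in> ?T" "?v \<in> ?T" "?u \<circ> ?v \<in> ?T" "?v \<circ> ?u \<in> ?T" "?u \<circ> (?v \<circ> ?u) \<in> ?T"
      by (simp_all only: comp_assoc)
  qed
  have LU: "g \<circ> l \<in> ?T" if g: "g \<in> ?XL" and l: "l \<in> ?T" for g l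
  proof (cases "g \<in> range Ph")
    case True
    then show ?thesis using PhT l by auto
  next
    case False
    then have g: "g = ?u \<or> g = ?v" using g by auto
    obtain b1 b2 b3 where b: "b1 \<in> op_words ?XU" "b2 \<in> op_words ?XU" "b3 \<in> op_words ?XU"
      "l = b1 \<circ> (?J \<circ> b2 \<circ> ?J) \<circ> b3"
      using l by (auto simp: triple_def)
    obtain t1 c1 t2 c2 t3 c3 where c: "b1 = Ph t1 \<circ> c1" "b2 = Ph t2 \<circ> c2" "b3 = Ph t3 \<circ> c3"
      "c1 = id \<or> c1 = ?u" "c2 = id \<or> c2 = ?u" "c3 = id \<or> c3 = ?u"
      using U[OF b(1)] U[OF b(2)] U[OF b(3)] by (metis comp_id)
    have k: "x \<circ> Ph t = Ph t \<circ> x" "x \<circ> (Ph t \<circ> z) = Ph t \<circ> (x \<circ> z)" if "x = ?J \<or> x = ?u \<or> x = ?v" for x z t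
      using that hadamards_Ph by (auto simp: o_assoc Cx_def Ph_Pm)
    have J2: "?J \<circ> (?J \<circ> x) = x" for x :: state_op
      using JJ by (simp add: o_assoc)
    have Jux: "?J \<circ> (?u \<circ> (?J \<circ> x)) = ?v \<circ> x" "?J \<circ> (?u \<circ> ?J) = ?v" for x :: state_op
      using Ju by (auto simp: o_assoc)
    have braid: "?u \<circ> (?v \<circ> ?u) = ?v \<circ> (?u \<circ> ?v)" using Cx_braid[of p "Suc p"] by simp
    have braidx: "?u \<circ> (?v \<circ> (?u \<circ> x)) = ?v \<circ> (?u \<circ> (?v \<circ> x))" for x :: state_op
      using arg_cong[OF braid, of "\<lambda>f. f \<circ> x"] by (simp only: comp_assoc)
    have six7: "?v \<circ> (?u \<circ> ?v) \<in> ?T" using six(6) unfolding braid .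
    have "g \<circ> l = Ph t1 \<circ> (Ph t2 \<circ> (Ph t3 \<circ> (g \<circ> (c1 \<circ> (?J \<circ> (c2 \<circ> (?J \<circ> c3)))))))"
      unfolding b c(1-3) using g c(4-6) by (elim disjE) (simp_all add: comp_assoc k)
    moreover have "g \<circ> (c1 \<circ> (?J \<circ> (c2 \<circ> (?J \<circ> c3)))) \<in> ?T"
      using g c(4-6)
      by (elim disjE; simp only: J2 JJ Jux uux uu six six7 braid braidx comp_id id_comp)
    ultimately show ?thesis using PhT by (simp only:)
  qed
  show ?thesis
  proof (rule triple_absorb_gens[OF JJ XB _ _ LU])
    show "?XU \<subseteq> ?XL" by auto
    show "?J \<circ> g \<circ> ?J \<in> op_words ?XL" if "g \<in> ?XL" for g
    proof (cases "g \<in> range Ph")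
      case True
      then obtain \<theta> where g: "g = Ph \<theta>" by blast
      have "?J \<circ> g \<circ> ?J = g" unfolding g hadamards_Ph comp_assoc JJ by (rule comp_id)
      then show ?thesis using words_gen[OF that] by simp
    next
      case False
      then have "g = ?u \<or> g = ?v" using that by auto
      then show ?thesis using Ju words_gen[of _ ?XL] by auto
    qed
    show "\<exists>r\<in>op_words ?XR. y \<circ> g = r \<circ> y" if "y \<in> ?XL" "g \<in> ?XR" for y g
    proof (cases "y \<in> range Ph")
      case True
      then show ?thesis using Ph_gens[OF that(2)] words_gen[OF that(2)] by auto
    next
      case False
      then show ?thesis using that Cx_normal[OF p _ that(2)] by blast
    qed
    show "\<exists>z\<in>op_words ?XL. y \<circ> z = id \<and> z \<circ> y = id" if "y \<in> ?XL" for y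
    proof (cases "y \<in> range Ph")
      case True
      then show ?thesis using Ph_inverse words_gen[of _ ?XL] by blast
    next
      case False
      then show ?thesis using that uu words_gen[of _ ?XL] by blast
    qed
  qed (use y in \<open>auto intro: words_gen\<close>)
qed


section \<open>The simple root of the last qubit\<close>

lemma Sg_Dg: "Sg a \<circ> Dg c = Dg c \<circ> Sg a"
  unfolding Sg_def by (rule Dg_commute)

text \<open>Conjugation by \<open>Had l\<close> exchanges \<open>Cx i l\<close> and
  \<open>Cz i l\<close>. As \<open>l\<close> is the last qubit it is never a control of an upward
  CNOT, so nothing leaves the radical; this is why the single-qubit group is attached to the last
  qubit.\<close>

lemma last_normal:
  assumes l: "l < n" "\<not> Suc l < n" and y: "y \<in> insert (Sg l) (insert (Had l) (range Ph))"
    and g: "g \<in> gens n (\<lambda>_ _. True) (\<lambda>i. i \<noteq> l)"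
  shows "\<exists>r\<in>op_words (gens n (\<lambda>_ _. True) (\<lambda>i. i \<noteq> l)). y \<circ> g = r \<circ> y"
    (is "\<exists>r\<in>?W. _")
proof -
  have comm: ?thesis if "y \<circ> g = g \<circ> y"
    using that words_gen[OF g] by blast
  have HH: "Had q \<circ> (Had q \<circ> x) = x" for q and x :: state_op
    using Had_Had[of q] by (simp only: o_assoc id_comp)
  consider "y = Sg l" | "y = Had l" | \<theta> where "y = Ph \<theta>" using y by auto
  then show ?thesis
  proof cases
    case 1
    show ?thesis
      using g
    proof (cases rule: gens_cases)
      case (Cx i j)
      show ?thesis
      proof (cases "j = l")
        case True
        have "Cx i l \<circ> Cz i l \<circ> Sg i \<in> ?W"
          using Cx True l by (intro words_comp gens_words) auto
        then show ?thesis using Sg_Cx[of i l] 1 Cx True by auto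
      next
        case False
        then have "Cx i j \<circ> Sg l = Sg l \<circ> Cx i j" by (intro Cx_Sg_commute) auto
        then show ?thesis using comm 1 Cx by simp
      qed
    qed (use 1 comm in \<open>auto simp: Sg_def Cz_def Dg_commute\<close>)
  next
    case 2
    show ?thesis
      using g
    proof (cases rule: gens_cases)
      case (Cx i j)
      show ?thesis
      proof (cases "j = l")
        case True
        have "Had l \<circ> Cx i l = Cz i l \<circ> Had l" using Cx True Cx_eq[of i l] by (simp only: comp_assoc HH)
        moreover have "Cz i l \<in> ?W" using Cx True by (intro gens_words) auto
        ultimately show ?thesis using 2 Cx True by auto
      next
        case False
        then show ?thesis using comm 2 Cx l Had_Cx[of l i j] by auto
      qed
    next
      case (Cz i j)
      have main: ?thesis if "g = Cz k l" "k < l" for k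
      proof -
        have "Had l \<circ> Cz k l = Cx k l \<circ> Had l" using that Cx_eq[of k l] by (simp only: comp_assoc Had_Had comp_id)
        moreover have "Cx k l \<in> ?W" using that l by (intro gens_words) auto
        ultimately show ?thesis using 2 that by auto
      qed
      consider "j = l" | "i = l" | "i \<noteq> l" "j \<noteq> l" by blast
      then show ?thesis
      proof cases
        case 1 then show ?thesis using main[of i] Cz l by auto
      next
        case 2
        have "g = Cz j l" unfolding Cz 2 by (rule Cz_sym)
        then show ?thesis using main[of j] Cz l 2 by auto
      next
        case 3 then show ?thesis using comm 2 Cz Had_Cz[of l i j] by auto
      qed
    next
      case (Sg i)
      then show ?thesis using comm 2 Had_Sg[of l i] by auto
    next
      case (Ph \<theta>)
      then show ?thesis using comm 2 Ph_Had[of \<theta> l] by auto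
    qed
  next
    case 3
    then show ?thesis using comm Ph_gens[OF g] by simp
  qed
qed

text \<open>The Levi factor is the single-qubit Clifford group with U = <S>, of order four modulo
  phases. Multiplying H by s H b2 H b3 with s a power of S: for s = S or its inverse the relation S
  H S H S ~ H shortens H s H; for s = 1 two Hadamards cancel and the remaining one is expanded by
  the same relation; for s = S S the Pauli gate X = H S S H is moved across \<open>b2\<close>
  first.\<close>

lemma big_cell_Had_last:
  assumes l: "l < n" "\<not> Suc l < n" and y: "y \<in> big_cell n"
  shows "y \<circ> Had l \<in> big_cell n"
proof -
  let ?XR = "gens n (\<lambda>_ _. True) (\<lambda>i. i \<noteq> l)"
  let ?XU = "insert (Sg l) (range Ph)" and ?XL = "insert (Sg l) (insert (Had l) (range Ph))"
  let ?J = "hadamards UNIV n" and ?T = "triple (hadamards UNIV n) (op_words (insert (Sg l) (range Ph)))"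
  let ?S = "Sg l" and ?H = "Had l"
  have XB: "gens n (\<lambda>_ _. True) (\<lambda>_. True) = ?XR \<union> ?XU"
    using l unfolding gens_def by auto
  have JJ: "?J \<circ> ?J = id" by (rule hadamards_hadamards)
  have HHx: "?H \<circ> (?H \<circ> x) = x" for x :: state_op
    using Had_Had[of l] by (simp only: o_assoc id_comp)
  have S4x: "?S \<circ> (?S \<circ> (?S \<circ> (?S \<circ> x))) = x" for x :: state_op
    using arg_cong[OF Sg4[of l], of "\<lambda>f. f \<circ> x"] by (simp only: comp_assoc id_comp)
  have HPh1: "?H \<circ> Ph t = Ph t \<circ> ?H" for t
    by (rule Ph_Had[symmetric])
  have HPh2: "?H \<circ> (Ph t \<circ> x) = Ph t \<circ> (?H \<circ> x)" for t and x :: state_op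
    using arg_cong[OF HPh1, of "\<lambda>f. f \<circ> x" t] by (simp only: comp_assoc)
  note HPh = HPh1 HPh2
  have SPh1: "?S \<circ> Ph t = Ph t \<circ> ?S" for t
    by (rule Sg_Dg)
  have SPh2: "?S \<circ> (Ph t \<circ> x) = Ph t \<circ> (?S \<circ> x)" for t and x :: state_op
    using arg_cong[OF SPh1, of "\<lambda>f. f \<circ> x" t] by (simp only: comp_assoc)
  note SPh = SPh1 SPh2
  have PhU: "Ph t \<in> op_words ?XU" and SU: "?S \<in> op_words ?XU" for t by (auto intro: words_gen)
  have PhT: "Ph \<theta> \<circ> x \<in> ?T" if "x \<in> ?T" for \<theta> x
    by (rule triple_Ph[OF PhU words_comp that])
  have Uconj: "?J \<circ> b \<circ> ?J = ?H \<circ> b \<circ> ?H" if "b \<in> op_words ?XU" for b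
  proof (rule hadamards_conj1[OF l(1)])
    fix q assume q: "q \<noteq> l"
    show "Had q \<circ> b = b \<circ> Had q"
      using that
    proof (induction rule: op_words.induct)
      case (words_step g F)
      then have "Had q \<circ> g = g \<circ> Had q" using Had_Sg[of q l] q Ph_Had by auto
      then show ?case using words_step by (metis comp_assoc)
    qed simp
  qed
  have T: "b1 \<circ> (?H \<circ> b2 \<circ> ?H) \<circ> b3 \<in> ?T" if "b1 \<in> op_words ?XU" "b2 \<in> op_words ?XU" "b3 \<in> op_words ?XU" for b1 b2 b3
    unfolding triple_def Uconj[OF that(2), symmetric] using that by blast
  have U: "\<exists>\<theta> s. b = Ph \<theta> \<circ> s \<and> s \<in> {id, ?S, ?S \<circ> ?S, ?S \<circ> (?S \<circ> ?S)}" if "b \<in> op_words ?XU" for b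
    using that
  proof (induction rule: op_words.induct)
    case words_id
    show ?case by (rule exI[of _ 0], rule exI[of _ id]) (simp add: Dg_one)
  next
    case (words_step g F)
    then obtain \<theta> s where s: "F = Ph \<theta> \<circ> s" "s \<in> {id, ?S, ?S \<circ> ?S, ?S \<circ> (?S \<circ> ?S)}" by blast
    show ?case
    proof (cases "g = ?S")
      case True
      then have "g \<circ> F = Ph \<theta> \<circ> (?S \<circ> s)" using s SPh by (simp only:)
      moreover have "?S \<circ> s \<in> {id, ?S, ?S \<circ> ?S, ?S \<circ> (?S \<circ> ?S)}"
        using s(2) Sg4[of l] by (elim insertE emptyE) (simp_all only: comp_id insert_iff simp_thms)
      ultimately show ?thesis by blast
    next
      case False
      then obtain \<eta> where "g = Ph \<eta>" using words_step by auto
      then have "g \<circ> F = Ph (\<eta> + \<theta>) \<circ> s" using s Ph_add by (metis comp_assoc)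
      then show ?thesis using s(2) by blast
    qed
  qed
  have E1: "?S \<circ> (?H \<circ> (?S \<circ> (?H \<circ> ?S))) = Ph (pi / 4) \<circ> ?H"
    using Sg_Had_Sg[of l] by (simp only: comp_assoc)
  have E1x: "?H \<circ> x = Ph (- pi / 4) \<circ> (?S \<circ> (?H \<circ> (?S \<circ> (?H \<circ> (?S \<circ> x)))))" for x :: state_op
  proof -
    have "Ph (- pi / 4) \<circ> (?S \<circ> (?H \<circ> (?S \<circ> (?H \<circ> (?S \<circ> x))))) = Ph (- pi / 4) \<circ> (?S \<circ> (?H \<circ> (?S \<circ> (?H \<circ> ?S)))) \<circ> x"
      by (simp only: comp_assoc)
    also have "\<dots> = (Ph (- pi / 4) \<circ> Ph (pi / 4)) \<circ> (?H \<circ> x)"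
      unfolding E1 by (simp only: comp_assoc)
    also have "\<dots> = ?H \<circ> x" by (simp add: Ph_add Dg_one)
    finally show ?thesis by simp
  qed
  have HU: "?H \<circ> (?H \<circ> (b2 \<circ> (?H \<circ> b3))) \<in> ?T" if "b2 \<in> op_words ?XU" "b3 \<in> op_words ?XU" for b2 b3
  proof -
    have "?H \<circ> (?H \<circ> (b2 \<circ> (?H \<circ> b3))) = b2 \<circ> (Ph (- pi / 4) \<circ> (?S \<circ> (?H \<circ> (?S \<circ> (?H \<circ> (?S \<circ> b3))))))"
      unfolding HHx by (subst E1x) (rule refl)
    also have "\<dots> = (b2 \<circ> Ph (- pi / 4) \<circ> ?S) \<circ> (?H \<circ> ?S \<circ> ?H) \<circ> (?S \<circ> b3)"
      by (simp only: comp_assoc)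
    also have "\<dots> \<in> ?T" by (intro T words_comp that PhU SU)
    finally show ?thesis .
  qed
  have HS3: "?H \<circ> (?S \<circ> (?S \<circ> (?S \<circ> (?H \<circ> x)))) = Ph (- pi / 4) \<circ> (?S \<circ> (?H \<circ> (?S \<circ> x)))" for x :: state_op
    by (subst E1x) (simp only: S4x HHx)
  have HS1: "?H \<circ> (?S \<circ> (?H \<circ> x)) = Ph (pi / 4) \<circ> (?S \<circ> (?S \<circ> (?S \<circ> (?H \<circ> (?S \<circ> (?S \<circ> (?S \<circ> x)))))))" for x :: state_op
    using arg_cong[OF E1, of "\<lambda>f. ?S \<circ> (?S \<circ> (?S \<circ> (f \<circ> (?S \<circ> (?S \<circ> (?S \<circ> x))))))"]
    by (simp only: comp_assoc S4x SPh)
  have HS2: "?H \<circ> (?S \<circ> (?S \<circ> (?H \<circ> x))) = Ph (pi / 2) \<circ> (?S \<circ> (?S \<circ> (?S \<circ> (?H \<circ> (?S \<circ> (?S \<circ> (?H \<circ> (?S \<circ> (?S \<circ> (?S \<circ> x))))))))))" for x :: state_op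
  proof -
    \<comment> \<open>H S S H is the square of H S H, and \<open>HS1\<close> rewrites both
      factors.\<close>
    have "?H \<circ> (?S \<circ> (?S \<circ> (?H \<circ> x))) = ?H \<circ> (?S \<circ> (?H \<circ> (?H \<circ> (?S \<circ> (?H \<circ> x)))))"
      by (simp only: HHx)
    also have "\<dots> = (Ph (pi / 4) \<circ> Ph (pi / 4)) \<circ> (?S \<circ> (?S \<circ> (?S \<circ> (?H \<circ> (?S \<circ> (?S \<circ> (?H \<circ> (?S \<circ> (?S \<circ> (?S \<circ> x))))))))))"
      unfolding HS1 by (simp only: comp_assoc S4x SPh HPh)
    finally have "?H \<circ> (?S \<circ> (?S \<circ> (?H \<circ> x))) = (Ph (pi / 4) \<circ> Ph (pi / 4)) \<circ> (?S \<circ> (?S \<circ> (?S \<circ> (?H \<circ> (?S \<circ> (?S \<circ> (?H \<circ> (?S \<circ> (?S \<circ> (?S \<circ> x))))))))))" .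
    moreover have "pi / 4 + pi / 4 = pi / 2" by simp
    ultimately show ?thesis unfolding Ph_add by (simp only:)
  qed
  \<comment> \<open>The Pauli gate X. It normalizes U, since X S is the inverse of S times X, up to
    a phase.\<close>
  define X where "X = ?H \<circ> (?S \<circ> (?S \<circ> ?H))"
  have X: "\<exists>r\<in>op_words ?XU. X \<circ> g = r \<circ> X" if gU: "g \<in> ?XU" for g
  proof (cases "g = ?S")
    case True
    have "X \<circ> ?S = (Ph (pi / 2) \<circ> (?S \<circ> (?S \<circ> ?S))) \<circ> X"
      using HS2[of ?S] unfolding X_def by (simp only: comp_assoc Sg4 comp_id)
    moreover have "Ph (pi / 2) \<circ> (?S \<circ> (?S \<circ> ?S)) \<in> op_words ?XU"
      by (intro words_comp PhU SU)
    ultimately show ?thesis using True by blast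
  next
    case False
    then obtain \<theta> where "g = Ph \<theta>" using gU by auto
    then have "X \<circ> g = g \<circ> X" unfolding X_def by (simp only: comp_assoc HPh SPh)
    then show ?thesis using words_gen[OF that] by blast
  qed
  have LH: "?H \<circ> x \<in> ?T" if x: "x \<in> ?T" for x
  proof -
    obtain b1 b2 b3 where b: "b1 \<in> op_words ?XU" "b2 \<in> op_words ?XU" "b3 \<in> op_words ?XU"
      "x = b1 \<circ> (?J \<circ> b2 \<circ> ?J) \<circ> b3"
      using x by (auto simp: triple_def)
    obtain \<theta> s where s: "b1 = Ph \<theta> \<circ> s" "s \<in> {id, ?S, ?S \<circ> ?S, ?S \<circ> (?S \<circ> ?S)}"
      using U[OF b(1)] by blast
    have "?H \<circ> x = Ph \<theta> \<circ> (?H \<circ> (s \<circ> (?H \<circ> (b2 \<circ> (?H \<circ> b3)))))"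
      unfolding b(4) Uconj[OF b(2)] s(1) by (simp only: comp_assoc HPh)
    moreover have "?H \<circ> (s \<circ> (?H \<circ> (b2 \<circ> (?H \<circ> b3)))) \<in> ?T"
    proof -
      consider "s = id" | "s = ?S" | "s = ?S \<circ> ?S" | "s = ?S \<circ> (?S \<circ> ?S)" using s(2) by blast
      then show ?thesis
      proof cases
        case 1
        then show ?thesis using HU[OF b(2,3)] by (simp only: id_comp)
      next
        case 2
        have "?H \<circ> (s \<circ> (?H \<circ> (b2 \<circ> (?H \<circ> b3)))) =
          (Ph (pi / 4) \<circ> (?S \<circ> (?S \<circ> ?S))) \<circ> (?H \<circ> (?S \<circ> (?S \<circ> (?S \<circ> b2))) \<circ> ?H) \<circ> b3"
          unfolding 2 HS1 by (simp only: comp_assoc)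
        also have "\<dots> \<in> ?T" by (intro T words_comp b PhU SU)
        finally show ?thesis .
      next
        case 3
        obtain r where r: "r \<in> op_words ?XU" "X \<circ> b2 = r \<circ> X"
          using words_normal[OF X b(2)] by blast
        have "?H \<circ> (s \<circ> (?H \<circ> (b2 \<circ> (?H \<circ> b3)))) = (X \<circ> b2) \<circ> (?H \<circ> b3)"
          unfolding 3 X_def by (simp only: comp_assoc)
        also have "\<dots> = r \<circ> (?H \<circ> (?S \<circ> (?S \<circ> b3)))"
          unfolding r(2) unfolding X_def by (simp only: comp_assoc HHx)
        also have "\<dots> = r \<circ> (Ph (- pi / 4) \<circ> (?S \<circ> (?H \<circ> (?S \<circ> (?H \<circ> (?S \<circ> (?S \<circ> (?S \<circ> b3))))))))"
          by (subst E1x) (rule refl)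
        also have "\<dots> = (r \<circ> Ph (- pi / 4) \<circ> ?S) \<circ> (?H \<circ> ?S \<circ> ?H) \<circ> (?S \<circ> (?S \<circ> (?S \<circ> b3)))"
          by (simp only: comp_assoc)
        also have "\<dots> \<in> ?T" by (intro T words_comp b r PhU SU)
        finally show ?thesis .
      next
        case 4
        have "?H \<circ> (s \<circ> (?H \<circ> (b2 \<circ> (?H \<circ> b3)))) =
          (Ph (- pi / 4) \<circ> ?S) \<circ> (?H \<circ> (?S \<circ> b2) \<circ> ?H) \<circ> b3"
          unfolding 4 comp_assoc HS3 by (simp only:)
        also have "\<dots> \<in> ?T" by (intro T words_comp b PhU SU)
        finally show ?thesis .
      qed
    qed
    ultimately show ?thesis using PhT by (simp only:)
  qed
  have LU: "g \<circ> x \<in> ?T" if g: "g \<in> ?XL" and x: "x \<in> ?T" for g x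
  proof -
    consider "g = ?S" | "g = ?H" | "g \<in> range Ph" using g by blast
    then show ?thesis
    proof cases
      case 1
      obtain b1 b2 b3 where b: "b1 \<in> op_words ?XU" "b2 \<in> op_words ?XU" "b3 \<in> op_words ?XU"
        "x = b1 \<circ> (?J \<circ> b2 \<circ> ?J) \<circ> b3"
        using x by (auto simp: triple_def)
      have "g \<circ> x = (?S \<circ> b1) \<circ> (?J \<circ> b2 \<circ> ?J) \<circ> b3" unfolding 1 b by (simp only: comp_assoc)
      then show ?thesis unfolding triple_def using b words_comp[OF SU b(1)] by blast
    next
      case 2
      then show ?thesis using LH x by simp
    next
      case 3
      then show ?thesis using PhT x by auto
    qed
  qed
  show ?thesis
  proof (rule triple_absorb_gens[OF JJ XB _ _ LU])
    show "?XU \<subseteq> ?XL" by auto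
    show "?J \<circ> g \<circ> ?J \<in> op_words ?XL" if gL: "g \<in> ?XL" for g
    proof -
      consider "g = ?S" | "g = ?H" | \<theta> where "g = Ph \<theta>" using gL by blast
      then show ?thesis
      proof cases
        case 1
        have "?H \<circ> ?S \<circ> ?H \<in> op_words ?XL" by (intro words_comp words_gen) auto
        then show ?thesis using Uconj[OF SU] 1 by simp
      next
        case 2
        then show ?thesis using hadamards_Had words_gen[OF that] by simp
      next
        case 3
        have "?J \<circ> g \<circ> ?J = g" unfolding 3 hadamards_Ph comp_assoc JJ by (rule comp_id)
        then show ?thesis using words_gen[OF that] by simp
      qed
    qed
    show "\<exists>r\<in>op_words ?XR. y \<circ> g = r \<circ> y" if "y \<in> ?XL" "g \<in> ?XR" for y g
      using last_normal[OF l that] .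
    show "\<exists>z\<in>op_words ?XL. y \<circ> z = id \<and> z \<circ> y = id" if yL: "y \<in> ?XL" for y
    proof -
      have gen: "?S \<in> op_words ?XL" "?H \<in> op_words ?XL" "Ph t \<in> op_words ?XL" for t
        by (auto intro: words_gen)
      consider "y = ?S" | "y = ?H" | \<theta> where "y = Ph \<theta>" using yL by blast
      then show ?thesis
      proof cases
        case 1
        have "?S \<circ> (?S \<circ> ?S) \<in> op_words ?XL" by (intro words_comp gen)
        moreover have "?S \<circ> (?S \<circ> ?S) \<circ> ?S = id" using Sg4 by (simp only: comp_assoc)
        ultimately show ?thesis using Sg4 1 by blast
      next
        case 2
        then show ?thesis using Had_Had gen by blast
      next
        case 3
        then show ?thesis using Ph_inverse gen by blast
      qed
    qed
  qed (use y in \<open>auto intro: words_gen\<close>)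
qed

lemma big_cell_borel: "y \<in> big_cell n \<Longrightarrow> b \<in> borel_ops n \<Longrightarrow> y \<circ> b \<in> big_cell n"
  unfolding triple_def using words_comp by (auto simp: comp_assoc) (metis comp_assoc)

lemma big_cell_id: "id \<in> big_cell n"
  unfolding triple_def using op_words.words_id hadamards_hadamards
  by (auto intro!: exI[of _ id])

text \<open>Conjugation by a swap of neighbours, a product of three adjacent CNOT gates, moves the
  Hadamard one qubit closer to the last one.\<close>

lemma big_cell_Had: "q < n \<Longrightarrow> y \<in> big_cell n \<Longrightarrow> y \<circ> Had q \<in> big_cell n"
proof (induction "n - q" arbitrary: q y)
  case (Suc d)
  show ?case
  proof (cases "Suc q < n")
    case True
    have c: "z \<circ> (Cx q (Suc q) \<circ> Cx (Suc q) q \<circ> Cx q (Suc q)) \<in> big_cell n" if "z \<in> big_cell n" for z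
      using that True by (auto simp: o_assoc intro!: big_cell_borel big_cell_Cx gens_words)
    have "y \<circ> Had q = (y \<circ> (Cx q (Suc q) \<circ> Cx (Suc q) q \<circ> Cx q (Suc q))) \<circ> Had (Suc q)
      \<circ> (Cx q (Suc q) \<circ> Cx (Suc q) q \<circ> Cx q (Suc q))"
      using Had_swap[of q "Suc q"] by (simp only: comp_assoc n_not_Suc_n not_False_eq_True)
    then show ?thesis using c Suc True by simp
  next
    case False
    then show ?thesis using big_cell_Had_last Suc by blast
  qed
qed simp

lemma big_cell_Cx_any:
  assumes "a < n" "b < n" "a \<noteq> b" "y \<in> big_cell n"
  shows "y \<circ> Cx a b \<in> big_cell n"
proof -
  have "y \<circ> Cx a b = ((y \<circ> Had b) \<circ> Cz a b) \<circ> Had b"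
    using Cx_eq[of a b] assms by (simp only: comp_assoc not_False_eq_True)
  moreover have "Cz a b \<in> borel_ops n" using assms by (intro gens_words)
  ultimately show ?thesis using assms big_cell_Had[OF assms(2)] big_cell_borel by simp
qed

section \<open>Matrices and local gates\<close>

text \<open>The bridge between matrices and operators: quantifying over all \<open>\<psi>\<close>
  determines the matrix, so operator identities transfer to matrices by
  \<open>acts_as_unique\<close>.\<close>

definition acts_as :: "nat \<Rightarrow> complex mat \<Rightarrow> state_op \<Rightarrow> bool" where
  "acts_as n M F \<longleftrightarrow> M \<in> carrier_mat (2 ^ n) (2 ^ n) \<and>
     (\<forall>\<psi>. \<forall>x<2 ^ n. (\<Sum>y<2 ^ n. M $$ (x, y) * \<psi> (bit y)) = F \<psi> (bit x))"

lemma bit_less: "(x::nat) < 2 ^ n \<Longrightarrow> bit x j \<Longrightarrow> j < n"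
  by (metis bit_take_bit_iff take_bit_nat_eq_self)

lemma acts_as_one: "acts_as n (1\<^sub>m (2 ^ n)) id"
  unfolding acts_as_def by (auto simp: if_distrib[of "\<lambda>z. z * _"] cong: if_cong)

lemma acts_as_mult:
  assumes A: "acts_as n A F" and B: "acts_as n B G"
  shows "acts_as n (A * B) (F \<circ> G)"
  unfolding acts_as_def
proof (intro conjI allI impI)
  have c: "A \<in> carrier_mat (2 ^ n) (2 ^ n)" "B \<in> carrier_mat (2 ^ n) (2 ^ n)"
    using A B by (auto simp: acts_as_def)
  then show "A * B \<in> carrier_mat (2 ^ n) (2 ^ n)" by simp
  fix \<psi> and x :: nat assume x: "x < 2 ^ n"
  have "(\<Sum>y<2 ^ n. (A * B) $$ (x, y) * \<psi> (bit y))
      = (\<Sum>y<2 ^ n. \<Sum>z<2 ^ n. A $$ (x, z) * (B $$ (z, y) * \<psi> (bit y)))"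
    using c x by (intro sum.cong) (auto simp: scalar_prod_def sum_distrib_right atLeast0LessThan mult.assoc)
  also have "\<dots> = (\<Sum>z<2 ^ n. A $$ (x, z) * (\<Sum>y<2 ^ n. B $$ (z, y) * \<psi> (bit y)))"
    by (subst sum.swap) (simp add: sum_distrib_left)
  also have "\<dots> = (\<Sum>z<2 ^ n. A $$ (x, z) * (G \<psi>) (bit z))"
    using B by (intro sum.cong) (auto simp: acts_as_def)
  also have "\<dots> = F (G \<psi>) (bit x)" using A x by (auto simp: acts_as_def)
  finally show "(\<Sum>y<2 ^ n. (A * B) $$ (x, y) * \<psi> (bit y)) = (F \<circ> G) \<psi> (bit x)" by simp
qed

lemma acts_as_unique:
  assumes "acts_as n A F" "acts_as n B F"
  shows "A = B"
proof (rule eq_matI)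
  have c: "A \<in> carrier_mat (2 ^ n) (2 ^ n)" "B \<in> carrier_mat (2 ^ n) (2 ^ n)"
    using assms by (auto simp: acts_as_def)
  then show "dim_row A = dim_row B" "dim_col A = dim_col B" by auto
  fix x y assume "x < dim_row B" "y < dim_col B"
  then have x: "x < 2 ^ n" "y < 2 ^ n" using c by auto
  define \<psi> where "\<psi> s = (if s = bit y then 1 else 0 :: complex)" for s
  have "bit z = bit y \<longleftrightarrow> z = y" for z by (metis bit_eq_iff)
  then have "(\<Sum>z<2 ^ n. M $$ (x, z) * \<psi> (bit z)) = M $$ (x, y)" for M
    unfolding \<psi>_def using x by (simp add: if_distrib[of "\<lambda>z. _ * z"] cong: if_cong)
  then show "A $$ (x, y) = B $$ (x, y)"
    using assms x unfolding acts_as_def by metis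
qed

lemma acts_as_on_qubit:
  assumes q: "q < n"
  shows "acts_as n (on_qubit n q U) (\<lambda>\<psi> x. U $$ (of_bool (x q), 0) * \<psi> (x(q := False))
    + U $$ (of_bool (x q), 1) * \<psi> (x(q := True)))"
  unfolding acts_as_def
proof (intro conjI allI impI)
  show "on_qubit n q U \<in> carrier_mat (2 ^ n) (2 ^ n)" by (simp add: on_qubit_def)
  fix \<psi> and x :: nat assume x: "x < 2 ^ n"
  let ?a = "unset_bit q x" and ?b = "set_bit q x"
  have ab: "?a < 2 ^ n" "?b < 2 ^ n"
  proof -
    have "take_bit n x = x" using x by (simp add: take_bit_nat_eq_self)
    then have "take_bit n ?a = ?a" "take_bit n ?b = ?b"
      using q by (simp_all add: take_bit_unset_bit_eq take_bit_set_bit_eq)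
    then show "?a < 2 ^ n" "?b < 2 ^ n" by (simp_all add: take_bit_nat_eq_self_iff)
  qed
  have bits: "bit ?a = (bit x)(q := False)" "bit ?b = (bit x)(q := True)"
    by (auto simp: fun_eq_iff bit_unset_bit_iff bit_set_bit_iff)
  then have ne: "?a \<noteq> ?b" by (metis fun_upd_same)
  have set: "{y. y < 2 ^ n \<and> (\<forall>j<n. j \<noteq> q \<longrightarrow> bit x j = bit y j)} = {?a, ?b}"
  proof (intro equalityI subsetI)
    fix y :: nat assume "y \<in> {y. y < 2 ^ n \<and> (\<forall>j<n. j \<noteq> q \<longrightarrow> bit x j = bit y j)}"
    then have y: "y < 2 ^ n" "\<And>j. j < n \<Longrightarrow> j \<noteq> q \<Longrightarrow> bit x j = bit y j" by auto
    have "bit x j = bit y j" if "j \<noteq> q" for j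
      using y that bit_less[OF x] bit_less[OF y(1)] by blast
    then have "bit y = (bit x)(q := bit y q)" by (auto simp: fun_eq_iff)
    then have "bit y = bit ?a \<or> bit y = bit ?b" using bits by (metis (full_types))
    then show "y \<in> {?a, ?b}" by (metis bit_eq_iff insertI1 insertI2)
  next
    fix y assume "y \<in> {?a, ?b}"
    then show "y \<in> {y. y < 2 ^ n \<and> (\<forall>j<n. j \<noteq> q \<longrightarrow> bit x j = bit y j)}"
      using ab bits by auto
  qed
  have "(\<Sum>y<2 ^ n. on_qubit n q U $$ (x, y) * \<psi> (bit y))
    = (\<Sum>y<(2::nat) ^ n. if \<forall>j<n. j \<noteq> q \<longrightarrow> bit x j = bit y j
         then U $$ (of_bool (bit x q), of_bool (bit y q)) * \<psi> (bit y) else 0)"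
    using x by (intro sum.cong) (auto simp: on_qubit_def)
  also have "\<dots> = (\<Sum>y\<in>{?a, ?b}. U $$ (of_bool (bit x q), of_bool (bit y q)) * \<psi> (bit y))"
    unfolding set[symmetric] by (subst sum.inter_filter[symmetric]) (auto simp: lessThan_def)
  also have "\<dots> = U $$ (of_bool (bit x q), 0) * \<psi> ((bit x)(q := False))
      + U $$ (of_bool (bit x q), 1) * \<psi> ((bit x)(q := True))"
    using ne bits by (simp add: bit_unset_bit_iff bit_set_bit_iff)
  finally show "(\<Sum>y<2 ^ n. on_qubit n q U $$ (x, y) * \<psi> (bit y)) = \<dots>" .
qed

lemma acts_as_H: assumes "q < n" shows "acts_as n (on_qubit n q H_mat) (Had q)"
proof -
  have "(\<lambda>\<psi> x. H_mat $$ (of_bool (x q), 0) * \<psi> (x(q := False))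
    + H_mat $$ (of_bool (x q), 1) * \<psi> (x(q := True))) = Had q"
    by (auto simp: fun_eq_iff Had_def H_mat_def mat_of_rows_list_def field_simps)
  then show ?thesis using acts_as_on_qubit[OF assms, of H_mat] by simp
qed

lemma acts_as_S: assumes "q < n" shows "acts_as n (on_qubit n q S_mat) (Sg q)"
proof -
  have "(\<lambda>\<psi> x. S_mat $$ (of_bool (x q), 0) * \<psi> (x(q := False))
    + S_mat $$ (of_bool (x q), 1) * \<psi> (x(q := True))) = Sg q"
    by (intro ext) (auto simp: Sg_def Dg_def S_mat_def mat_of_rows_list_def fun_upd_idem)
  then show ?thesis using acts_as_on_qubit[OF assms, of S_mat] by simp
qed

section \<open>Diagonal matrices and the matrix of the GZZ gate\<close>

definition diagm :: "nat \<Rightarrow> (state \<Rightarrow> complex) \<Rightarrow> complex mat" where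
  "diagm n c = mat (2 ^ n) (2 ^ n) (\<lambda>(x, y). if x = y then c (bit x) else 0)"

lemma diagm_carrier [simp]: "diagm n c \<in> carrier_mat (2 ^ n) (2 ^ n)"
  by (simp add: diagm_def)

lemma acts_as_diagm: "acts_as n (diagm n c) (Dg c)"
  unfolding acts_as_def
  by (auto simp: diagm_def Dg_def if_distrib[of "\<lambda>z. z * _"] cong: if_cong)

lemma acts_as_CZ: "acts_as n (CZ_mat n a b) (Cz a b)"
proof -
  have "CZ_mat n a b = diagm n (\<lambda>x. if x a \<and> x b then -1 else 1)"
    unfolding CZ_mat_def diagm_def by (rule cong_mat) auto
  then show ?thesis using acts_as_diagm by (simp add: Cz_def)
qed

lemma acts_as_CNOT:
  assumes "c < n" "t < n" "c \<noteq> t"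
  shows "acts_as n (CNOT_mat n c t) (Cx c t)"
  unfolding acts_as_def
proof (intro conjI allI impI)
  show "CNOT_mat n c t \<in> carrier_mat (2 ^ n) (2 ^ n)" by (simp add: CNOT_mat_def)
  fix \<psi> and x :: nat assume x: "x < 2 ^ n"
  define f where "f y = (if bit y c then flip_bit t y else y)" for y :: nat
  have bit_f: "bit (f y) = (bit y)(t := (bit y t \<noteq> bit y c))" for y
    using assms by (auto simp: f_def fun_eq_iff bit_flip_bit_iff)
  have ff: "f (f y) = y" for y
  proof -
    have "bit (f (f y)) = bit y" unfolding bit_f using assms by (auto simp: fun_eq_iff)
    then show ?thesis by (metis bit_eq_iff)
  qed
  have f: "f x < 2 ^ n"
  proof -
    have "take_bit n x = x" using x by (simp add: take_bit_nat_eq_self)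
    then have "take_bit n (f x) = f x" using assms by (simp add: f_def take_bit_flip_bit_eq)
    then show ?thesis by (simp add: take_bit_nat_eq_self_iff)
  qed
  have "(\<Sum>y<2 ^ n. CNOT_mat n c t $$ (x, y) * \<psi> (bit y)) = (\<Sum>y<2 ^ n. if y = f x then \<psi> (bit y) else 0)"
  proof (intro sum.cong refl)
    fix y :: nat assume "y \<in> {..<2 ^ n}"
    moreover have "x = f y \<longleftrightarrow> y = f x" using ff by metis
    ultimately show "CNOT_mat n c t $$ (x, y) * \<psi> (bit y) = (if y = f x then \<psi> (bit y) else 0)"
      using x by (simp add: CNOT_mat_def f_def)
  qed
  also have "\<dots> = Cx c t \<psi> (bit x)" using f by (simp add: Cx_def Pm_def bit_f)
  finally show "(\<Sum>y<2 ^ n. CNOT_mat n c t $$ (x, y) * \<psi> (bit y)) = Cx c t \<psi> (bit x)" .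
qed

lemma diagm_mult: "diagm n c * diagm n d = diagm n (\<lambda>x. c x * d x)"
  using acts_as_unique[OF acts_as_mult[OF acts_as_diagm acts_as_diagm, unfolded Dg_comp] acts_as_diagm] .

lemma diagm_smult: "a \<cdot>\<^sub>m diagm n c = diagm n (\<lambda>x. a * c x)"
  by (rule eq_matI) (auto simp: diagm_def)

lemma diagm_one: "1\<^sub>m (2 ^ n) = diagm n (\<lambda>_. 1)"
  by (rule eq_matI) (auto simp: diagm_def)

lemma diagm_pow: "diagm n c ^\<^sub>m k = diagm n (\<lambda>x. c x ^ k)"
proof (induction k)
  case 0
  show ?case using diagm_one by (simp add: diagm_def)
next
  case (Suc k)
  then show ?case by (simp add: diagm_mult mult.commute)
qed

lemma mat_exp_diagm: "mat_exp (diagm n c) = diagm n (\<lambda>x. exp (c x))"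
proof (rule eq_matI)
  fix x y assume "x < dim_row (diagm n (\<lambda>x. exp (c x)))" "y < dim_col (diagm n (\<lambda>x. exp (c x)))"
  then have xy: "x < 2 ^ n" "y < 2 ^ n" by (auto simp: diagm_def)
  have "(\<Sum>k. (diagm n c ^\<^sub>m k) $$ (x, y) / fact k) = (if x = y then exp (c (bit x)) else 0)"
    unfolding diagm_pow using xy
    by (auto simp: diagm_def exp_def scaleR_conv_of_real divide_inverse mult.commute)
  then show "mat_exp (diagm n c) $$ (x, y) = diagm n (\<lambda>x. exp (c x)) $$ (x, y)"
    using xy by (simp add: mat_exp_def diagm_def)
qed (auto simp: mat_exp_def diagm_def)

abbreviation zsign :: "bool \<Rightarrow> real" where
  "zsign b \<equiv> (if b then -1 else 1)"

lemma on_qubit_Z: assumes "q < n" shows "on_qubit n q Z_mat = diagm n (\<lambda>x. complex_of_real (zsign (x q)))"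
proof -
  have "(\<lambda>\<psi> x. Z_mat $$ (of_bool (x q), 0) * \<psi> (x(q := False))
    + Z_mat $$ (of_bool (x q), 1) * \<psi> (x(q := True))) = Dg (\<lambda>x. complex_of_real (zsign (x q)))"
    by (intro ext) (auto simp: Dg_def Z_mat_def mat_of_rows_list_def fun_upd_idem)
  then show ?thesis using acts_as_on_qubit[OF assms, of Z_mat] acts_as_diagm acts_as_unique by metis
qed

lemma ZZ_rotation_eq:
  assumes "i < n" "j < n"
  shows "ZZ_rotation n \<alpha> i j = diagm n (\<lambda>x. cis (- (\<alpha> / 2) * (zsign (x i) * zsign (x j))))"
proof -
  have "(\<lambda>x. exp (- \<i> * complex_of_real \<alpha> / 2 * (complex_of_real (zsign (x i)) * complex_of_real (zsign (x j)))))
      = (\<lambda>x. cis (- (\<alpha> / 2) * (zsign (x i) * zsign (x j))))"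
    by (auto simp: fun_eq_iff cis_conv_exp)
  then show ?thesis
    unfolding ZZ_rotation_def on_qubit_Z[OF assms(1)] on_qubit_Z[OF assms(2)] diagm_mult diagm_smult mat_exp_diagm
    by simp
qed

lemma foldr_diagm:
  assumes "\<And>i j. (i, j) \<in> set L \<Longrightarrow> M i j = diagm n (\<lambda>x. cis (e i j x))"
  shows "foldr (\<lambda>(i, j) A. M i j * A) L (1\<^sub>m (2 ^ n)) = diagm n (\<lambda>x. cis (\<Sum>(i, j)\<leftarrow>L. e i j x))"
  using assms
proof (induction L)
  case Nil
  then show ?case by (simp add: diagm_one)
next
  case (Cons p L)
  then show ?case by (cases p) (auto simp: diagm_mult cis_mult)
qed

definition pair_sum :: "nat \<Rightarrow> (nat \<Rightarrow> nat \<Rightarrow> real) \<Rightarrow> real" where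
  "pair_sum n e = (\<Sum>j<n. \<Sum>i<j. e i j)"

lemma sum_list_pairs:
  "(\<Sum>(i, j)\<leftarrow>[(i, j). i \<leftarrow> [0..<n], j \<leftarrow> [0..<n], i < j \<and> i \<in> {0..<n} \<and> j \<in> {0..<n}]. e i j) = pair_sum n e"
proof -
  have cc: "sum_list (map f (concat xs)) = (\<Sum>l\<leftarrow>xs. sum_list (map f l))" for f :: "nat \<times> nat \<Rightarrow> real" and xs
    by (induction xs) auto
  have "(\<Sum>(i, j)\<leftarrow>[(i, j). i \<leftarrow> [0..<n], j \<leftarrow> [0..<n], i < j \<and> i \<in> {0..<n} \<and> j \<in> {0..<n}]. e i j)
    = (\<Sum>i\<leftarrow>[0..<n]. \<Sum>j\<leftarrow>[0..<n]. if i < j \<and> i \<in> {0..<n} \<and> j \<in> {0..<n} then e i j else 0)"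
    by (simp add: cc comp_def if_distrib[of sum_list] if_distrib[of "map _"] cong: if_cong)
  also have "\<dots> = (\<Sum>i<n. \<Sum>j<n. if i < j then e i j else 0)"
    unfolding interv_sum_list_conv_sum_set_nat set_upt atLeast0LessThan by (intro sum.cong refl) simp
  also have "\<dots> = (\<Sum>j<n. \<Sum>i<n. if i < j then e i j else 0)"
    by (rule sum.swap)
  also have "\<dots> = pair_sum n e"
    unfolding pair_sum_def
  proof (rule sum.cong[OF refl])
    fix j assume "j \<in> {..<n}"
    then have "{i \<in> {..<n}. i < j} = {..<j}" by auto
    then show "(\<Sum>i<n. if i < j then e i j else 0) = (\<Sum>i<j. e i j)"
      by (simp add: sum.inter_filter[symmetric])
  qed
  finally show ?thesis .
qed

lemma GZZ_mat_eq:
  "GZZ_mat n {0..<n} \<alpha> = diagm n (\<lambda>x. cis (- (\<alpha> / 2) * pair_sum n (\<lambda>i j. zsign (x i) * zsign (x j))))"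
proof -
  have "GZZ_mat n {0..<n} \<alpha> = diagm n (\<lambda>x. cis (pair_sum n (\<lambda>i j. - (\<alpha> / 2) * (zsign (x i) * zsign (x j)))))"
    unfolding GZZ_mat_def sum_list_pairs[symmetric]
    by (rule foldr_diagm) (auto simp: ZZ_rotation_eq)
  then show ?thesis by (simp add: pair_sum_def sum_distrib_left)
qed

section \<open>Local gates, circuits and gate counts\<close>

lemma on_qubit_one: assumes "U \<in> carrier_mat 2 2" shows "on_qubit 1 0 U = U"
proof (rule eq_matI)
  fix i j assume "i < dim_row U" "j < dim_col U"
  then have "i < 2" "j < 2" using assms by auto
  moreover from this have "of_bool (odd i) = i" "of_bool (odd j) = j"
    by (auto simp: less_2_cases_iff)
  ultimately show "on_qubit 1 0 U $$ (i, j) = U $$ (i, j)"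
    by (simp add: on_qubit_def bit_0)
qed (use assms in \<open>auto simp: on_qubit_def\<close>)

lemma single_qubit_H: "single_qubit_clifford H_mat"
  unfolding single_qubit_clifford_def
proof (intro exI conjI)
  show "clifford_circuit 1 [H 0]" by (simp add: clifford_circuit_def)
  have c: "H_mat \<in> carrier_mat 2 2" by (auto simp: H_mat_def mat_of_rows_list_def intro!: carrier_matI)
  then show "H_mat = clifford_mat 1 [H 0]"
    using on_qubit_one[OF c] by (simp add: clifford_mat_def)
qed

lemma single_qubit_S: "single_qubit_clifford S_mat"
  unfolding single_qubit_clifford_def
proof (intro exI conjI)
  show "clifford_circuit 1 [S 0]" by (simp add: clifford_circuit_def)
  have c: "S_mat \<in> carrier_mat 2 2" by (auto simp: S_mat_def mat_of_rows_list_def intro!: carrier_matI)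
  then show "S_mat = clifford_mat 1 [S 0]"
    using on_qubit_one[OF c] by (simp add: clifford_mat_def)
qed

lemma gzz_gate_carrier: "gzz_gate_mat n \<alpha> g \<in> carrier_mat (2 ^ n) (2 ^ n)"
  by (cases g) (auto simp: on_qubit_def GZZ_mat_eq)

lemma gzz_circuit_carrier: "gzz_circuit_mat n \<alpha> gs \<in> carrier_mat (2 ^ n) (2 ^ n)"
  unfolding gzz_circuit_mat_def by (induction gs) (auto intro: mult_carrier_mat gzz_gate_carrier)

lemma gzz_circuit_append:
  "gzz_circuit_mat n \<alpha> (gs @ hs) = gzz_circuit_mat n \<alpha> hs * gzz_circuit_mat n \<alpha> gs"
proof (induction gs)
  case Nil
  show ?case using gzz_circuit_carrier[of n \<alpha> hs] by (simp add: gzz_circuit_mat_def)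
next
  case (Cons g gs)
  then show ?case
    using gzz_circuit_carrier[of n \<alpha> hs] gzz_circuit_carrier[of n \<alpha> gs] gzz_gate_carrier[of n \<alpha> g]
    by (auto simp: gzz_circuit_mat_def assoc_mult_mat)
qed

text \<open>Local gates are free, so only the \<open>GZZ\<close> gates are counted. The phase is
  absorbed here, so that all operator identities can be exact.\<close>

definition implementable :: "nat \<Rightarrow> nat \<Rightarrow> nat \<Rightarrow> state_op \<Rightarrow> bool" where
  "implementable n k m F \<longleftrightarrow> (\<exists>gs \<theta>. gzz_circuit n gs \<and> count_list gs GZZ \<le> m \<and>
     acts_as n (cis \<theta> \<cdot>\<^sub>m gzz_circuit_mat n (pi / 2 ^ (k + 1)) gs) F)"

lemma implementable_mono: "implementable n k m F \<Longrightarrow> m \<le> m' \<Longrightarrow> implementable n k m' F"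
  unfolding implementable_def by (meson le_trans)

lemma smult_smult: "a \<cdot>\<^sub>m (b \<cdot>\<^sub>m A) = (a * b) \<cdot>\<^sub>m (A :: complex mat)"
  by (rule eq_matI) auto

lemma implementable_comp:
  assumes "implementable n k m F" "implementable n k m' G"
  shows "implementable n k (m + m') (F \<circ> G)"
proof -
  let ?M = "gzz_circuit_mat n (pi / 2 ^ (k + 1))"
  obtain gs \<theta> hs \<eta> where F: "gzz_circuit n gs" "count_list gs GZZ \<le> m" "acts_as n (cis \<theta> \<cdot>\<^sub>m ?M gs) F"
    and G: "gzz_circuit n hs" "count_list hs GZZ \<le> m'" "acts_as n (cis \<eta> \<cdot>\<^sub>m ?M hs) G"
    using assms unfolding implementable_def by blast
  have "(cis \<theta> \<cdot>\<^sub>m ?M gs) * (cis \<eta> \<cdot>\<^sub>m ?M hs) = cis (\<theta> + \<eta>) \<cdot>\<^sub>m ?M (hs @ gs)"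
    using gzz_circuit_carrier[of n "pi / 2 ^ (k + 1)" gs] gzz_circuit_carrier[of n "pi / 2 ^ (k + 1)" hs]
    unfolding gzz_circuit_append
    by (simp add: mult_smult_distrib[of _ "2 ^ n" "2 ^ n" _ "2 ^ n"] mult_smult_assoc_mat[of _ "2 ^ n" "2 ^ n" _ "2 ^ n"]
      smult_smult cis_mult add.commute)
  then have "acts_as n (cis (\<theta> + \<eta>) \<cdot>\<^sub>m ?M (hs @ gs)) (F \<circ> G)"
    using acts_as_mult[OF F(3) G(3)] by simp
  moreover have "gzz_circuit n (hs @ gs)" using F G by (auto simp: gzz_circuit_def)
  moreover have "count_list (hs @ gs) GZZ \<le> m + m'" using F G by simp
  ultimately show ?thesis unfolding implementable_def by blast
qed

lemma smult_cis_0: "cis 0 \<cdot>\<^sub>m A = A"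
  by (rule eq_matI) auto

lemma implementable_gate:
  assumes "gzz_gate_on n g" "acts_as n (gzz_gate_mat n (pi / 2 ^ (k + 1)) g) F" "(if g = GZZ then 1 else 0) \<le> m"
  shows "implementable n k m F"
  unfolding implementable_def
proof (intro exI conjI)
  show "gzz_circuit n [g]" using assms by (simp add: gzz_circuit_def)
  show "count_list [g] GZZ \<le> m" using assms by (simp split: if_splits)
  show "acts_as n (cis 0 \<cdot>\<^sub>m gzz_circuit_mat n (pi / 2 ^ (k + 1)) [g]) F"
    using assms(2) unfolding smult_cis_0
    by (simp add: gzz_circuit_mat_def left_mult_one_mat[OF gzz_gate_carrier])
qed

lemma implementable_Had: "q < n \<Longrightarrow> implementable n k 0 (Had q)"
  by (rule implementable_gate[of n "Local q H_mat"]) (auto simp: single_qubit_H acts_as_H)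

lemma implementable_Sg: "q < n \<Longrightarrow> implementable n k 0 (Sg q)"
  by (rule implementable_gate[of n "Local q S_mat"]) (auto simp: single_qubit_S acts_as_S)

lemma implementable_Ph: "implementable n k 0 (Ph \<theta>)"
  unfolding implementable_def
proof (intro exI conjI)
  show "acts_as n (cis \<theta> \<cdot>\<^sub>m gzz_circuit_mat n (pi / 2 ^ (k + 1)) []) (Ph \<theta>)"
    using acts_as_diagm[of n "\<lambda>_. cis \<theta>"] by (simp add: gzz_circuit_mat_def diagm_one diagm_smult)
qed (auto simp: gzz_circuit_def)

lemma implementable_id: "implementable n k 0 id"
  using implementable_Ph[of n k 0] by (simp add: Dg_one)

lemma implementable_GZZ: "implementable n k 1 (Dg (\<lambda>x. cis (- (pi / 2 ^ (k + 2)) * pair_sum n (\<lambda>i j. zsign (x i) * zsign (x j)))))"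
  by (rule implementable_gate[of n GZZ]) (use acts_as_diagm in \<open>auto simp: GZZ_mat_eq\<close>)

section \<open>Cliques from Hadamard matrices\<close>

lemma implementable_comp0: "implementable n k 0 F \<Longrightarrow> implementable n k m G \<Longrightarrow> implementable n k m (F \<circ> G)"
  "implementable n k m F \<Longrightarrow> implementable n k 0 G \<Longrightarrow> implementable n k m (F \<circ> G)"
  using implementable_comp[of n k 0 F m G] implementable_comp[of n k m F 0 G] by auto

lemma implementable_hadamards: "implementable n k 0 (hadamards A n)"
proof -
  have "j \<le> n \<Longrightarrow> implementable n k 0 (hadamards A j)" for j
    by (induction j) (auto simp only: hadamards.simps if_True if_False id_comp intro!: implementable_id implementable_comp0(1) implementable_Had split: if_split)
  then show ?thesis by simp
qed

lemma implementable_X: assumes "q < n" shows "implementable n k 0 (Pm (\<lambda>x. x(q := \<not> x q)))"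
proof -
  have "Had q \<circ> (Sg q \<circ> Sg q) \<circ> Had q = Pm (\<lambda>x. x(q := (x q \<noteq> True)))"
    unfolding Had_row[of q "\<lambda>_. True", symmetric, unfolded indep_def, OF allI[OF allI[OF refl]]]
    by (rule arg_cong[where f = "\<lambda>c. _ \<circ> c \<circ> _"]) (auto simp: Sg_def Dg_comp intro!: arg_cong[where f = Dg])
  moreover have "implementable n k 0 (Had q \<circ> (Sg q \<circ> Sg q) \<circ> Had q)"
    by (intro implementable_comp0 implementable_Had implementable_Sg assms)
  ultimately show ?thesis by simp
qed

lemma implementable_flip: "implementable n k 0 (Pm (\<lambda>x j. if j < n \<and> A j then \<not> x j else x j))"
proof -
  have "m \<le> n \<Longrightarrow> implementable n k 0 (Pm (\<lambda>x j. if j < m \<and> A j then \<not> x j else x j))" for m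
  proof (induction m)
    case 0
    show ?case using implementable_id[of n k, unfolded id_def] by (simp add: Pm_id)
  next
    case (Suc m)
    show ?case
    proof (cases "A m")
      case True
      have eq: "Pm (\<lambda>x j. if j < Suc m \<and> A j then \<not> x j else x j)
        = Pm (\<lambda>x. x(m := \<not> x m)) \<circ> Pm (\<lambda>x j. if j < m \<and> A j then \<not> x j else x j)"
        unfolding Pm_comp by (rule Pm_cong) (use True in \<open>auto simp: less_Suc_eq\<close>)
      show ?thesis unfolding eq by (rule implementable_comp0(1)[OF implementable_X]) (use Suc in auto)
    next
      case False
      have "Pm (\<lambda>x j. if j < Suc m \<and> A j then \<not> x j else x j)
        = Pm (\<lambda>x j. if j < m \<and> A j then \<not> x j else x j)"
        by (rule Pm_cong) (use False in \<open>auto simp: less_Suc_eq\<close>)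
      then show ?thesis using Suc by simp
    qed
  qed
  then show ?thesis by simp
qed

lemma implementable_signed:
  "implementable n k 1 (Dg (\<lambda>x. cis (- (pi / 2 ^ (k + 2)) * pair_sum n (\<lambda>i j. zsign (A i) * zsign (A j) * (zsign (x i) * zsign (x j))))))"
proof -
  let ?f = "\<lambda>x j. if j < n \<and> A j then \<not> x j else x j"
  let ?c = "\<lambda>x. cis (- (pi / 2 ^ (k + 2)) * pair_sum n (\<lambda>i j. zsign (x i) * zsign (x j)))"
  have "pair_sum n (\<lambda>i j. zsign (?f x i) * zsign (?f x j)) = pair_sum n (\<lambda>i j. zsign (A i) * zsign (A j) * (zsign (x i) * zsign (x j)))" for x
    unfolding pair_sum_def by (intro sum.cong refl) auto
  then have "Dg (\<lambda>x. ?c (?f x)) = Dg (\<lambda>x. cis (- (pi / 2 ^ (k + 2)) * pair_sum n (\<lambda>i j. zsign (A i) * zsign (A j) * (zsign (x i) * zsign (x j)))))"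
    by (simp only:)
  moreover have "Pm ?f \<circ> Dg ?c \<circ> Pm ?f = Dg (\<lambda>x. ?c (?f x)) \<circ> (Pm ?f \<circ> Pm ?f)"
    by (simp only: Pm_Dg comp_assoc)
  moreover have "Pm ?f \<circ> Pm ?f = id"
    unfolding Pm_comp Pm_id[symmetric] by (rule Pm_cong) auto
  moreover have "implementable n k 1 (Pm ?f \<circ> Dg ?c \<circ> Pm ?f)"
    by (intro implementable_comp0(2)[OF implementable_comp0(1)] implementable_flip implementable_GZZ)
  ultimately show ?thesis by (simp only: comp_id)
qed

lemma implementable_signed_sum:
  "implementable n k M (Dg (\<lambda>x. cis (- (pi / 2 ^ (k + 2)) * pair_sum n (\<lambda>i j. (\<Sum>m<M. zsign (A m i) * zsign (A m j)) * (zsign (x i) * zsign (x j))))))"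
proof (induction M)
  case 0
  show ?case using implementable_id[of n k, unfolded id_def] by (simp add: pair_sum_def Dg_one)
next
  case (Suc M)
  have eq: "Dg (\<lambda>x. cis (- (pi / 2 ^ (k + 2)) * pair_sum n (\<lambda>i j. (\<Sum>m<Suc M. zsign (A m i) * zsign (A m j)) * (zsign (x i) * zsign (x j)))))
    = Dg (\<lambda>x. cis (- (pi / 2 ^ (k + 2)) * pair_sum n (\<lambda>i j. zsign (A M i) * zsign (A M j) * (zsign (x i) * zsign (x j)))))
      \<circ> Dg (\<lambda>x. cis (- (pi / 2 ^ (k + 2)) * pair_sum n (\<lambda>i j. (\<Sum>m<M. zsign (A m i) * zsign (A m j)) * (zsign (x i) * zsign (x j)))))"
    unfolding Dg_comp cis_mult
    by (rule arg_cong[where f = Dg])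
      (simp only: sum.lessThan_Suc distrib_right pair_sum_def sum.distrib distrib_left add.commute)
  show ?case unfolding eq using implementable_comp[OF implementable_signed Suc, of "A M"] by (simp only: plus_1_eq_Suc)
qed

text \<open>Sylvester's matrix, with \<open>True\<close> for the entry -1: the parity of the bitwise
  inner product of row and column index.\<close>

primrec hadamard :: "nat \<Rightarrow> nat \<Rightarrow> nat \<Rightarrow> bool" where
  "hadamard 0 a m = False"
| "hadamard (Suc k) a m = ((odd a \<and> odd m) \<noteq> hadamard k (a div 2) (m div 2))"

lemma sum_even_odd: "(\<Sum>m<2 * (N::nat). f m) = (\<Sum>m<N. f (2 * m) + f (2 * m + 1) :: real)"
  by (induction N) auto

text \<open>Columns 2m and 2m+1 contribute equal terms if the lowest bits of \<open>a\<close> and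
  \<open>b\<close> agree, and opposite ones if they differ.\<close>

lemma hadamard_orthogonal:
  "a < 2 ^ k \<Longrightarrow> b < 2 ^ k \<Longrightarrow>
     (\<Sum>m<2 ^ k. zsign (hadamard k a m) * zsign (hadamard k b m)) = (if a = b then 2 ^ k else 0)"
proof (induction k arbitrary: a b)
  case (Suc k)
  have m: "(\<lambda>m. zsign (hadamard (Suc k) a (2 * m)) * zsign (hadamard (Suc k) b (2 * m))
      + zsign (hadamard (Suc k) a (2 * m + 1)) * zsign (hadamard (Suc k) b (2 * m + 1)))
    = (\<lambda>m. (if odd a = odd b then 2 else 0) * (zsign (hadamard k (a div 2) m) * zsign (hadamard k (b div 2) m)))"
    by (auto simp: fun_eq_iff)
  have "(\<Sum>m<2 ^ Suc k. zsign (hadamard (Suc k) a m) * zsign (hadamard (Suc k) b m))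
    = (if odd a = odd b then 2 else 0) * (\<Sum>m<2 ^ k. zsign (hadamard k (a div 2) m) * zsign (hadamard k (b div 2) m))"
    unfolding power_Suc sum_even_odd m sum_distrib_left ..
  also have "\<dots> = (if odd a = odd b then 2 else 0) * (if a div 2 = b div 2 then 2 ^ k else 0)"
    using Suc by simp
  also have "\<dots> = (if a = b then 2 ^ Suc k else 0)"
  proof -
    have "a = b \<longleftrightarrow> odd a = odd b \<and> a div 2 = b div 2"
      by (metis bit_eq_rec)
    then show ?thesis by auto
  qed
  finally show ?case .
qed simp

text \<open>The CZ gates along the edges of a graph. The outer index is the larger endpoint, so that
  \<open>cz_phase_Suc\<close> splits off the last qubit.\<close>

definition cz_phase :: "nat \<Rightarrow> (nat \<Rightarrow> nat \<Rightarrow> bool) \<Rightarrow> state \<Rightarrow> complex" where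
  "cz_phase n E x = (\<Prod>j<n. \<Prod>i<j. if E i j \<and> x i \<and> x j then -1 else 1)"

lemma cz_phase_cong: "(\<And>i j. i < j \<Longrightarrow> j < n \<Longrightarrow> E i j = E' i j) \<Longrightarrow> cz_phase n E = cz_phase n E'"
  unfolding cz_phase_def fun_eq_iff by (intro allI prod.cong refl) auto

lemma cz_phase_mult: "cz_phase n E x * cz_phase n E' x = cz_phase n (\<lambda>i j. E i j \<noteq> E' i j) x"
  unfolding cz_phase_def prod.distrib[symmetric] by (intro prod.cong refl) auto

lemma implementable_prod:
  assumes "finite A" "\<And>i. i \<in> A \<Longrightarrow> implementable n k 0 (Dg (c i))"
  shows "implementable n k 0 (Dg (\<lambda>x. \<Prod>i\<in>A. c i x))"
  using assms
proof (induction A rule: finite_induct)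
  case empty
  show ?case using implementable_id[of n k, unfolded id_def] by (simp add: Dg_one)
next
  case (insert a A)
  then have "implementable n k 0 (Dg (c a) \<circ> Dg (\<lambda>x. \<Prod>i\<in>A. c i x))"
    by (intro implementable_comp0) auto
  then show ?case using insert by (simp add: Dg_comp)
qed

lemma cis_sum: "finite A \<Longrightarrow> cis (\<Sum>i\<in>A. f i) = (\<Prod>i\<in>A. cis (f i))"
  by (induction A rule: finite_induct) (auto simp: cis_mult[symmetric])

text \<open>CZ is the ZZ rotation of angle pi/2 (exponent pi/4) times the inverse of S on both
  qubits and a phase.\<close>

lemma cis_zsign: "cis (- (pi / 4) * (zsign a * zsign b)) * (cis (pi / 4) * ((if a then - \<i> else 1) * (if b then - \<i> else 1)))
  = (if a \<and> b then -1 else 1)"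
proof -
  have c: "cis (- (pi / 4)) * cis (pi / 4) = 1" "cis (pi / 4) * cis (pi / 4) = \<i>"
    by (simp_all add: cis_mult)
  have c': "cis (- (pi / 4)) * (cis (pi / 4) * z) = z" "cis (pi / 4) * (cis (pi / 4) * z) = \<i> * z" for z
    using c by (simp_all add: mult.assoc[symmetric])
  show ?thesis by (cases a; cases b) (simp_all add: c c')
qed

lemma implementable_clique_labelled:
  fixes l :: "nat \<Rightarrow> nat"
  assumes l: "\<And>i. i < n \<Longrightarrow> l i < 2 ^ k"
  shows "implementable n k (2 ^ k) (Dg (cz_phase n (\<lambda>i j. l i = l j)))"
proof -
  let ?h = "\<lambda>m i. hadamard k (l i) m"
  let ?A = "\<lambda>x. \<Prod>j<n. \<Prod>i<j. if l i = l j then cis (- (pi / 4) * (zsign (x i) * zsign (x j))) else 1"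
  let ?B = "\<lambda>x. \<Prod>j<n. \<Prod>i<j. if l i = l j then cis (pi / 4) * ((if x i then - \<i> else 1) * (if x j then - \<i> else 1)) else 1"
  \<comment> \<open>The label of a qubit selects its row. Each gate contributes half its angle,
    \<open>pi / 2^(k+2)\<close>, and \<open>2^k\<close> equal signs add up to pi/4, the exponent of
    a CZ gate.\<close>
  have "- (pi / 2 ^ (k + 2)) * pair_sum n (\<lambda>i j. (\<Sum>m<2 ^ k. zsign (?h m i) * zsign (?h m j)) * (zsign (x i) * zsign (x j)))
    = pair_sum n (\<lambda>i j. if l i = l j then - (pi / 4) * (zsign (x i) * zsign (x j)) else 0)" for x
    unfolding pair_sum_def sum_distrib_left
    by (intro sum.cong refl) (use l in \<open>simp add: hadamard_orthogonal\<close>)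
  then have "Dg (\<lambda>x. cis (- (pi / 2 ^ (k + 2)) * pair_sum n (\<lambda>i j. (\<Sum>m<2 ^ k. zsign (?h m i) * zsign (?h m j)) * (zsign (x i) * zsign (x j)))))
    = Dg ?A"
    by (simp add: pair_sum_def cis_sum if_distrib[of cis] cong: if_cong)
  then have A: "implementable n k (2 ^ k) (Dg ?A)" using implementable_signed_sum[of n k "2 ^ k" ?h] by simp
  have s: "implementable n k 0 (Dg (\<lambda>x. if x i then - \<i> else 1))" if "i < n" for i
  proof -
    have "implementable n k 0 (Sg i \<circ> Sg i \<circ> Sg i)" using that by (intro implementable_comp0 implementable_Sg)
    moreover have "Sg i \<circ> Sg i \<circ> Sg i = Dg (\<lambda>x. if x i then - \<i> else 1)"
      unfolding Sg_def Dg_comp by (rule arg_cong[where f = Dg]) (auto simp: fun_eq_iff)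
    ultimately show ?thesis by simp
  qed
  have B: "implementable n k 0 (Dg ?B)"
  proof (intro implementable_prod finite_lessThan)
    fix i j assume "j \<in> {..<n}" "i \<in> {..<j}"
    then have "implementable n k 0 (Ph (pi / 4) \<circ> (Dg (\<lambda>x. if x i then - \<i> else 1) \<circ> Dg (\<lambda>x. if x j then - \<i> else 1)))"
      by (intro implementable_comp0 implementable_Ph s) auto
    then show "implementable n k 0 (Dg (\<lambda>x. if l i = l j then cis (pi / 4) * ((if x i then - \<i> else 1) * (if x j then - \<i> else 1)) else 1))"
      using implementable_id[of n k] by (cases "l i = l j") (simp_all add: Dg_comp Dg_one)
  qed
  have "?A x * ?B x = cz_phase n (\<lambda>i j. l i = l j) x" for x
    unfolding cz_phase_def prod.distrib[symmetric]
  proof (intro prod.cong refl)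
    fix i j
    show "(if l i = l j then cis (- (pi / 4) * (zsign (x i) * zsign (x j))) else 1) *
      (if l i = l j then cis (pi / 4) * ((if x i then - \<i> else 1) * (if x j then - \<i> else 1)) else 1)
      = (if l i = l j \<and> x i \<and> x j then -1 else 1)"
      using cis_zsign[of "x i" "x j"] by (cases "l i = l j") (simp_all only: if_True if_False simp_thms mult_1)
  qed
  then have "Dg (cz_phase n (\<lambda>i j. l i = l j)) = Dg ?A \<circ> Dg ?B"
    unfolding Dg_comp by (simp only:)
  then show ?thesis using implementable_comp0(2)[OF A B] by (simp only:)
qed

text \<open>Explains n - 1 in place of n: if all n labels are distinct, there are no edges;
  otherwise at most n - 1 labels occur, and they can be renamed to rows of a matrix of order
  \<open>2^k\<close>.\<close>

lemma implementable_clique: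
  assumes k: "n - 1 \<le> 2 ^ k"
  shows "implementable n k (2 ^ k) (Dg (cz_phase n (\<lambda>i j. l i = l j)))"
proof (cases "inj_on l {..<n}")
  case True
  then have "cz_phase n (\<lambda>i j. l i = l j) = cz_phase n (\<lambda>_ _. False)"
    by (intro cz_phase_cong) (auto simp: inj_on_def)
  also have "\<dots> = (\<lambda>_. 1)" by (auto simp: cz_phase_def)
  finally have "Dg (cz_phase n (\<lambda>i j. l i = l j)) = id" by (simp add: Dg_one)
  then show ?thesis using implementable_mono[OF implementable_id] by simp
next
  case False
  have "card (l ` {..<n}) \<noteq> n" using False eq_card_imp_inj_on[of "{..<n}" l] by auto
  moreover have "card (l ` {..<n}) \<le> n" using card_image_le[of "{..<n}" l] by simp
  ultimately have "card (l ` {..<n}) \<le> card {..<2 ^ k :: nat}" using k by simp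
  then obtain g where g: "inj_on g (l ` {..<n})" "g ` (l ` {..<n}) \<subseteq> {..<2 ^ k :: nat}"
    using card_le_inj[of "l ` {..<n}" "{..<2 ^ k :: nat}"] by auto
  have "cz_phase n (\<lambda>i j. l i = l j) = cz_phase n (\<lambda>i j. g (l i) = g (l j))"
    by (rule cz_phase_cong) (use g(1) in \<open>auto simp: inj_on_def\<close>)
  moreover have "implementable n k (2 ^ k) (Dg (cz_phase n (\<lambda>i j. g (l i) = g (l j))))"
    by (rule implementable_clique_labelled) (use g(2) in auto)
  ultimately show ?thesis by simp
qed

text \<open>A biclique is the symmetric difference of one clique and two disjoint ones.\<close>

lemma implementable_biclique:
  fixes l :: "nat \<Rightarrow> nat"
  assumes k: "n - 1 \<le> 2 ^ k" and E: "\<And>i j. i < j \<Longrightarrow> j < n \<Longrightarrow> E i j \<longleftrightarrow> src i \<and> tgt j \<and> l i = l j"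
    and st: "\<And>i. \<not> (src i \<and> tgt i)"
    and order: "\<And>i j. tgt i \<Longrightarrow> src j \<Longrightarrow> l i = l j \<Longrightarrow> j \<le> i"
  shows "implementable n k (2 * 2 ^ k) (Dg (cz_phase n E))"
proof -
  \<comment> \<open>\<open>l1\<close> joins sources and targets of equal label, \<open>l2\<close>
    keeps them apart, so exactly the source-target edges survive. The tag 2 gives every other qubit
    a label of its own.\<close>
  define l1 where "l1 v = (if src v \<or> tgt v then (l v, 0) else (v, 2 :: nat))" for v
  define l2 where "l2 v = (if src v then (l v, 0) else if tgt v then (l v, 1) else (v, 2 :: nat))" for v
  have "Dg (cz_phase n E) = Dg (cz_phase n (\<lambda>i j. l1 i = l1 j)) \<circ> Dg (cz_phase n (\<lambda>i j. l2 i = l2 j))"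
    unfolding Dg_comp cz_phase_mult
  proof (rule arg_cong[where f = Dg], rule cz_phase_cong)
    fix i j assume ij: "i < j" "j < n"
    show "E i j = ((l1 i = l1 j) \<noteq> (l2 i = l2 j))"
      unfolding E[OF ij] l1_def l2_def using st[of i] st[of j] order[of i j] ij by auto
  qed
  then show ?thesis using implementable_comp[OF implementable_clique[OF k, of l1] implementable_clique[OF k, of l2]] by (simp add: mult_2)
qed

section \<open>Graphs and CNOT layers from bicliques\<close>

primrec parity :: "nat \<Rightarrow> (nat \<Rightarrow> bool) \<Rightarrow> bool" where
  "parity 0 P = False"
| "parity (Suc j) P = (parity j P \<noteq> P j)"

lemma parity_xor: "parity j (\<lambda>i. P i \<noteq> Q i) = (parity j P \<noteq> parity j Q)"
  by (induction j) auto

lemma parity_single: "parity j (\<lambda>i. i = c \<and> Q) = (c < j \<and> Q)"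
  by (induction j) (auto simp: less_Suc_eq)

lemma parity_restrict: "c \<le> t \<Longrightarrow> parity t (\<lambda>i. i < c \<and> P i) = parity c P"
proof (induction t)
  case (Suc t)
  show ?case
  proof (cases "c = Suc t")
    case True
    have "j \<le> c \<Longrightarrow> parity j (\<lambda>i. i < c \<and> P i) = parity j P" for j by (induction j) auto
    then show ?thesis using True by blast
  next
    case False
    then show ?thesis using Suc by auto
  qed
qed simp

lemma parity_cong: "(\<And>i. i < j \<Longrightarrow> P i = Q i) \<Longrightarrow> parity j P = parity j Q"
  by (induction j) auto

lemma parity_False: "(\<And>i. i < j \<Longrightarrow> \<not> P i) \<Longrightarrow> \<not> parity j P"
  by (induction j) auto

lemma prod_parity: "(\<Prod>i<j. if P i then -1 else 1) = (if parity j P then -1 else 1 :: complex)"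
  by (induction j) auto

text \<open>All parities are read off the input \<open>x\<close>: this is the unitriangular matrix 1
  + E over the two-element field (sources as columns, targets as rows), not the successive
  application of its entries.\<close>

definition cnot_layer :: "nat \<Rightarrow> (nat \<Rightarrow> nat \<Rightarrow> bool) \<Rightarrow> state \<Rightarrow> state" where
  "cnot_layer n E x j = (if j < n then x j \<noteq> parity j (\<lambda>i. E i j \<and> x i) else x j)"

lemma parity_and: "parity j (\<lambda>i. P i \<and> q) = (parity j P \<and> q)"
  by (induction j) auto

lemma cz_phase_Suc: "cz_phase (Suc m) E x = cz_phase m E x * (if x m \<and> parity m (\<lambda>i. E i m \<and> x i) then -1 else 1)"
proof -
  have "parity m (\<lambda>i. E i m \<and> x i \<and> x m) = (x m \<and> parity m (\<lambda>i. E i m \<and> x i))"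
    using parity_and[of m "\<lambda>i. E i m \<and> x i" "x m"] by (auto simp: conj_assoc)
  then show ?thesis by (simp add: cz_phase_def prod_parity)
qed

lemma indep_cz_phase: "m \<le> q \<Longrightarrow> indep q (cz_phase m E)"
  unfolding indep_def cz_phase_def by (intro allI prod.cong refl) auto

text \<open>Hadamards on the non-sources turn each CZ into a CNOT. Since no target is a source,
  these gates do not influence each other, and their product is the simultaneous layer.\<close>

lemma hadamards_bipartite:
  assumes A: "\<And>i j. E i j \<Longrightarrow> A i \<and> \<not> A j"
  shows "hadamards {j. \<not> A j} m \<circ> Dg (cz_phase m E) \<circ> hadamards {j. \<not> A j} m = Pm (cnot_layer m E)"
proof (induction m)
  case 0
  have "cz_phase 0 E = (\<lambda>_. 1)" "cnot_layer 0 E = (\<lambda>x. x)" by (auto simp: cz_phase_def cnot_layer_def fun_eq_iff)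
  then show ?case by (simp only: hadamards.simps Dg_one Pm_id comp_id)
next
  case (Suc m)
  let ?T = "hadamards {j. \<not> A j} m" and ?p = "\<lambda>x. parity m (\<lambda>i. E i m \<and> x i)"
  show ?case
  proof (cases "A m")
    case True
    then have np: "\<not> ?p x" for x using A by (intro parity_False) auto
    have "cz_phase (Suc m) E = cz_phase m E" by (intro ext) (simp add: cz_phase_Suc np)
    moreover have "cnot_layer (Suc m) E = cnot_layer m E" by (intro ext) (auto simp: cnot_layer_def less_Suc_eq np)
    ultimately show ?thesis using True Suc by (simp only: hadamards.simps mem_Collect_eq simp_thms if_False id_comp)
  next
    case False
    let ?R = "Pm (\<lambda>x. x(m := (x m \<noteq> ?p x)))" and ?D = "Dg (cz_phase m E)" and ?H = "Had m"
    have HT: "?T \<circ> ?H = ?H \<circ> ?T" by (rule hadamards_commute) (rule Had_commute)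
    have HD: "?H \<circ> ?D = ?D \<circ> ?H" by (intro Had_Dg indep_cz_phase order_refl)
    have ind: "indep q ?p" if "q < m \<longrightarrow> \<not> A q" for q
      unfolding indep_def using that A by (intro allI parity_cong) auto
    have R: "?H \<circ> Dg (\<lambda>x. if x m \<and> ?p x then -1 else 1) \<circ> ?H = ?R"
      by (rule Had_row) (auto intro: ind)
    have TR: "?T \<circ> ?R = ?R \<circ> ?T"
      by (rule hadamards_commute, rule Had_Pm_row) (auto intro: ind)
    have cz_phase: "Dg (cz_phase (Suc m) E) = ?D \<circ> Dg (\<lambda>x. if x m \<and> ?p x then -1 else 1)"
      unfolding Dg_comp by (rule arg_cong[where f = Dg]) (auto simp: fun_eq_iff cz_phase_Suc)
    have T: "hadamards {j. \<not> A j} (Suc m) = ?H \<circ> ?T" using False by simp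
    have "hadamards {j. \<not> A j} (Suc m) \<circ> Dg (cz_phase (Suc m) E) \<circ> hadamards {j. \<not> A j} (Suc m)
      = (?H \<circ> ?T) \<circ> ?D \<circ> Dg (\<lambda>x. if x m \<and> ?p x then -1 else 1) \<circ> (?H \<circ> ?T)"
      unfolding T cz_phase by (simp only: comp_assoc)
    also have "\<dots> = ?T \<circ> (?H \<circ> ?D) \<circ> Dg (\<lambda>x. if x m \<and> ?p x then -1 else 1) \<circ> (?H \<circ> ?T)"
      unfolding HT[symmetric] by (simp only: comp_assoc)
    also have "\<dots> = ?T \<circ> ?D \<circ> (?H \<circ> Dg (\<lambda>x. if x m \<and> ?p x then -1 else 1) \<circ> ?H) \<circ> ?T"
      unfolding HD by (simp only: comp_assoc)
    also have "\<dots> = ?T \<circ> ?D \<circ> (?T \<circ> ?R)" unfolding R TR by (simp only: comp_assoc)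
    also have "\<dots> = Pm (cnot_layer m E) \<circ> ?R" unfolding Suc.IH[symmetric] by (simp only: comp_assoc)
    also have "\<dots> = Pm (cnot_layer (Suc m) E)"
      unfolding Pm_comp
    proof (rule Pm_cong)
      fix x j
      have "cnot_layer m E x i = x i" if "A i" for i
      proof -
        have "\<not> parity i (\<lambda>i'. E i' i \<and> x i')" using A that by (intro parity_False) auto
        then show ?thesis by (simp add: cnot_layer_def)
      qed
      then have "?p (cnot_layer m E x) = ?p x" using A by (intro parity_cong) auto
      then show "((\<lambda>x. x(m := (x m \<noteq> ?p x))) \<circ> cnot_layer m E) x j = cnot_layer (Suc m) E x j"
        by (auto simp: cnot_layer_def less_Suc_eq)
    qed
    finally show ?thesis .
  qed
qed

lemma implementable_cnot_layer_bipartite: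
  assumes "\<And>i j. E i j \<Longrightarrow> A i \<and> \<not> A j" "implementable n k c (Dg (cz_phase n E))"
  shows "implementable n k c (Pm (cnot_layer n E))"
proof -
  have "implementable n k c (hadamards {j. \<not> A j} n \<circ> Dg (cz_phase n E) \<circ> hadamards {j. \<not> A j} n)"
    by (intro implementable_comp0(2)[OF implementable_comp0(1)] implementable_hadamards assms(2))
  moreover have "hadamards {j. \<not> A j} n \<circ> Dg (cz_phase n E) \<circ> hadamards {j. \<not> A j} n = Pm (cnot_layer n E)"
    by (rule hadamards_bipartite) (rule assms(1))
  ultimately show ?thesis by (simp only:)
qed

lemma cz_phase_False: "(\<And>i j. i < j \<Longrightarrow> j < n \<Longrightarrow> \<not> E i j) \<Longrightarrow> Dg (cz_phase n E) = id"
proof -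
  assume "\<And>i j. i < j \<Longrightarrow> j < n \<Longrightarrow> \<not> E i j"
  then have "cz_phase n E = (\<lambda>_. 1)" unfolding cz_phase_def by (auto simp: fun_eq_iff intro!: prod.neutral)
  then show ?thesis by (simp only: Dg_one)
qed

lemma cnot_layer_False: "(\<And>i j. \<not> E i j) \<Longrightarrow> Pm (cnot_layer n E) = id"
  unfolding Pm_id[symmetric] by (rule Pm_cong) (auto simp: cnot_layer_def parity_False)

lemma implementable_stages_cz_phase:
  assumes "\<And>i. i < n \<Longrightarrow> \<tau> i < R" "\<And>r. implementable n k c (Dg (cz_phase n (\<lambda>i j. E i j \<and> \<tau> i = r)))"
  shows "implementable n k (R * c) (Dg (cz_phase n E))"
proof -
  have "implementable n k (r * c) (Dg (cz_phase n (\<lambda>i j. E i j \<and> \<tau> i < r)))" for r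
  proof (induction r)
    case 0
    have "Dg (cz_phase n (\<lambda>i j. E i j \<and> \<tau> i < 0)) = id" by (rule cz_phase_False) simp
    then show ?case using implementable_id by (simp only: mult_0)
  next
    case (Suc r)
    have "Dg (cz_phase n (\<lambda>i j. E i j \<and> \<tau> i < Suc r))
      = Dg (cz_phase n (\<lambda>i j. E i j \<and> \<tau> i = r)) \<circ> Dg (cz_phase n (\<lambda>i j. E i j \<and> \<tau> i < r))"
      unfolding Dg_comp cz_phase_mult by (rule arg_cong[where f = Dg], rule cz_phase_cong) auto
    then show ?case using implementable_comp[OF assms(2)[of r] Suc] by (simp only: mult_Suc)
  qed
  from this[of R] have "implementable n k (R * c) (Dg (cz_phase n (\<lambda>i j. E i j \<and> \<tau> i < R)))" .
  moreover have "cz_phase n (\<lambda>i j. E i j \<and> \<tau> i < R) = cz_phase n E"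
    by (rule cz_phase_cong) (use assms(1) in auto)
  ultimately show ?thesis by (simp only:)
qed

text \<open>Each stage is bipartite because edges lead to later stages. As maps, the stages are
  applied in decreasing order: stage r changes only qubits of later stages, so the sources of the
  lower stages still hold their original values.\<close>

lemma implementable_stages_cnot_layer:
  assumes \<tau>: "\<And>i. i < n \<Longrightarrow> \<tau> i < R" "\<And>i j. E i j \<Longrightarrow> \<tau> i < \<tau> j"
    and implementable: "\<And>r. implementable n k c (Dg (cz_phase n (\<lambda>i j. E i j \<and> \<tau> i = r)))"
  shows "implementable n k (R * c) (Pm (cnot_layer n E))"
proof -
  have st: "implementable n k c (Pm (cnot_layer n (\<lambda>i j. E i j \<and> \<tau> i = r)))" for r
    by (rule implementable_cnot_layer_bipartite[OF _ implementable, of r "\<lambda>i. \<tau> i = r"]) (auto dest: \<tau>(2))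
  have "implementable n k (r * c) (Pm (cnot_layer n (\<lambda>i j. E i j \<and> \<tau> i < r)))" for r
  proof (induction r)
    case 0
    have "Pm (cnot_layer n (\<lambda>i j. E i j \<and> \<tau> i < 0)) = id" by (rule cnot_layer_False) simp
    then show ?case using implementable_id by (simp only: mult_0)
  next
    case (Suc r)
    have "Pm (cnot_layer n (\<lambda>i j. E i j \<and> \<tau> i < Suc r))
      = Pm (cnot_layer n (\<lambda>i j. E i j \<and> \<tau> i = r)) \<circ> Pm (cnot_layer n (\<lambda>i j. E i j \<and> \<tau> i < r))"
      unfolding Pm_comp
    proof (rule Pm_cong)
      fix x j
      let ?y = "cnot_layer n (\<lambda>i j. E i j \<and> \<tau> i = r) x"
      have y: "?y i = x i" if "\<tau> i < r" for i
      proof -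
        have "\<not> parity i (\<lambda>i'. (E i' i \<and> \<tau> i' = r) \<and> x i')"
          using \<tau>(2) that by (intro parity_False) fastforce
        then show ?thesis by (simp add: cnot_layer_def)
      qed
      have "parity j (\<lambda>i. (E i j \<and> \<tau> i < r) \<and> ?y i) = parity j (\<lambda>i. (E i j \<and> \<tau> i < r) \<and> x i)"
        by (rule parity_cong) (use y in auto)
      then have r: "cnot_layer n (\<lambda>i j. E i j \<and> \<tau> i < r) ?y j = (if j < n then ?y j \<noteq> parity j (\<lambda>i. (E i j \<and> \<tau> i < r) \<and> x i) else ?y j)"
        by (simp only: cnot_layer_def[of n "\<lambda>i j. E i j \<and> \<tau> i < r"])
      have m: "?y j = (if j < n then x j \<noteq> parity j (\<lambda>i. (E i j \<and> \<tau> i = r) \<and> x i) else x j)"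
        and l: "cnot_layer n (\<lambda>i j. E i j \<and> \<tau> i < Suc r) x j = (if j < n then x j \<noteq> parity j (\<lambda>i. (E i j \<and> \<tau> i < Suc r) \<and> x i) else x j)"
        by (simp_all only: cnot_layer_def)
      have split: "parity j (\<lambda>i. (E i j \<and> \<tau> i < Suc r) \<and> x i)
        = (parity j (\<lambda>i. (E i j \<and> \<tau> i < r) \<and> x i) \<noteq> parity j (\<lambda>i. (E i j \<and> \<tau> i = r) \<and> x i))"
        unfolding parity_xor[symmetric] by (rule parity_cong) auto
      show "cnot_layer n (\<lambda>i j. E i j \<and> \<tau> i < Suc r) x j = (cnot_layer n (\<lambda>i j. E i j \<and> \<tau> i < r) \<circ> cnot_layer n (\<lambda>i j. E i j \<and> \<tau> i = r)) x j"
        unfolding comp_apply r m l split by (cases "j < n"; simp only: if_True if_False; blast)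
    qed
    then show ?case using implementable_comp[OF st[of r] Suc] by (simp only: mult_Suc)
  qed
  from this[of R] have "implementable n k (R * c) (Pm (cnot_layer n (\<lambda>i j. E i j \<and> \<tau> i < R)))" .
  moreover have "Pm (cnot_layer n (\<lambda>i j. E i j \<and> \<tau> i < R)) = Pm (cnot_layer n E)"
  proof (rule Pm_cong)
    fix x j
    have "parity j (\<lambda>i. (E i j \<and> \<tau> i < R) \<and> x i) = parity j (\<lambda>i. E i j \<and> x i)" if "j < n"
      by (rule parity_cong) (use \<tau>(1) that in auto)
    then show "cnot_layer n (\<lambda>i j. E i j \<and> \<tau> i < R) x j = cnot_layer n E x j"
      unfolding cnot_layer_def by (cases "j < n") (simp_all only: if_True if_False)
  qed
  ultimately show ?thesis by (simp only:)
qed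

section \<open>Layers of disjoint bicliques\<close>

text \<open>
  The sets \<open>T \<beta>\<close> have at most two elements and are found greedily: when \<open>g\<close> of them have been chosen, fewer than
  \<open>4 (g + 1)\<close> values are excluded for the next element \<open>s\<close>, namely those with \<open>s\<close> or \<open>s XOR p\<close> already in use.
\<close>

lemma xor_pairs_exist:
  fixes p :: "nat \<Rightarrow> nat"
  assumes "4 * g \<le> 2 ^ b" "\<forall>\<beta><g. p \<beta> < 2 ^ b"
  shows "\<exists>T. (\<forall>\<beta><g. T \<beta> \<subseteq> {..<2 ^ b :: nat} \<and> (\<forall>u. odd (card {t \<in> T \<beta>. bit t u}) \<longleftrightarrow> bit (p \<beta>) u)) \<and>
    (\<forall>\<beta><g. \<forall>\<gamma><g. \<beta> \<noteq> \<gamma> \<longrightarrow> T \<beta> \<inter> T \<gamma> = {}) \<and> card (\<Union>\<beta><g. T \<beta>) \<le> 2 * g"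
  using assms
proof (induction g)
  case (Suc g)
  have "4 * g \<le> 2 ^ b" "\<forall>\<beta><g. p \<beta> < 2 ^ b" using Suc.prems by auto
  from Suc.IH[OF this] obtain T where T0:
    "\<forall>\<beta><g. T \<beta> \<subseteq> {..<2 ^ b :: nat} \<and> (\<forall>u. odd (card {t \<in> T \<beta>. bit t u}) \<longleftrightarrow> bit (p \<beta>) u)"
    "\<forall>\<beta><g. \<forall>\<gamma><g. \<beta> \<noteq> \<gamma> \<longrightarrow> T \<beta> \<inter> T \<gamma> = {}" "card (\<Union>\<beta><g. T \<beta>) \<le> 2 * g"
    by (elim exE conjE)
  have T: "\<And>\<beta>. \<beta> < g \<Longrightarrow> T \<beta> \<subseteq> {..<2 ^ b}"
    "\<And>\<beta> u. \<beta> < g \<Longrightarrow> odd (card {t \<in> T \<beta>. bit t u}) \<longleftrightarrow> bit (p \<beta>) u"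
    "\<And>\<beta> \<gamma>. \<beta> < g \<Longrightarrow> \<gamma> < g \<Longrightarrow> \<beta> \<noteq> \<gamma> \<Longrightarrow> T \<beta> \<inter> T \<gamma> = {}"
    "card (\<Union>\<beta><g. T \<beta>) \<le> 2 * g"
    using T0 by blast+
  define W where "W = (\<Union>\<beta><g. T \<beta>)"
  let ?q = "p g"
  let ?x = "\<lambda>w. Bit_Operations.xor w ?q"
  have finW: "finite W" unfolding W_def
    using T(1) by (auto intro: finite_subset[OF _ finite_lessThan])
  have xx: "?x (?x w) = w" for w
    by (simp add: xor.assoc)
  have xlt: "?x w < 2 ^ b" if "w < 2 ^ b" for w
  proof -
    have "take_bit b w = w" "take_bit b ?q = ?q" using that Suc.prems(2) by (simp_all add: take_bit_nat_eq_self)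
    then have "take_bit b (?x w) = ?x w" by (simp only: take_bit_xor)
    then show ?thesis by (simp only: take_bit_nat_eq_self_iff)
  qed
  have "card (W \<union> ?x ` W) \<le> card W + card W"
    using card_Un_le[of W "?x ` W"] card_image_le[OF finW, of ?x] by linarith
  also have "\<dots> < card {..<2 ^ b :: nat}" using T(4) Suc.prems(1) by (simp add: W_def)
  finally have "\<not> {..<2 ^ b} \<subseteq> W \<union> ?x ` W"
    using card_mono[of "W \<union> ?x ` W" "{..<2 ^ b :: nat}"] finW by (meson finite_UnI finite_imageI leD)
  then obtain s where s: "s < 2 ^ b" "s \<notin> W" "s \<notin> ?x ` W" by auto
  have xs: "?x s \<notin> W" using s(3) xx by (metis imageI)
  \<comment> \<open>For \<open>?q = 0\<close> the two elements would coincide and count once instead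
    of cancelling, hence the empty set.\<close>
  define P where "P = (if ?q = 0 then {} else {s, ?x s})"
  have P: "P \<subseteq> {..<2 ^ b}" "P \<inter> W = {}" "card P \<le> 2" "finite P"
    using s xs xlt by (auto simp: P_def card_insert_if)
  have oddP: "odd (card {t \<in> P. bit t u}) \<longleftrightarrow> bit ?q u" for u
  proof (cases "?q = 0")
    case False
    have ne: "s \<noteq> ?x s"
    proof
      assume "s = ?x s"
      then have "Bit_Operations.xor s s = Bit_Operations.xor s (?x s)" by simp
      then show False using False by (simp add: xor.assoc[symmetric])
    qed
    have "{t \<in> P. bit t u} = (if bit s u then {s} else {}) \<union> (if bit (?x s) u then {?x s} else {})"
      using False by (auto simp: P_def)
    then show ?thesis using ne by (auto simp: bit_xor_iff)
  qed (simp add: P_def)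
  show ?case
  proof (intro exI[of _ "T(g := P)"] conjI allI impI)
    fix \<beta> assume "\<beta> < Suc g"
    then show "(T(g := P)) \<beta> \<subseteq> {..<2 ^ b}" using T(1) P by (auto simp: less_Suc_eq)
  next
    fix \<beta> u assume "\<beta> < Suc g"
    then show "odd (card {t \<in> (T(g := P)) \<beta>. bit t u}) \<longleftrightarrow> bit (p \<beta>) u"
      using T(2) oddP by (cases "\<beta> = g") auto
  next
    fix \<beta> \<gamma> assume "\<beta> < Suc g" "\<gamma> < Suc g" "\<beta> \<noteq> \<gamma>"
    then show "(T(g := P)) \<beta> \<inter> (T(g := P)) \<gamma> = {}"
      using T(3) P(2) unfolding W_def by (cases "\<beta> = g"; cases "\<gamma> = g") (auto simp: less_Suc_eq)
  next
    have "(\<Union>\<beta><Suc g. (T(g := P)) \<beta>) = P \<union> W" unfolding W_def by (auto simp: less_Suc_eq)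
    then show "card (\<Union>\<beta><Suc g. (T(g := P)) \<beta>) \<le> 2 * Suc g"
      using card_Un_le[of P W] P(3) T(4) by (simp add: W_def)
  qed
qed auto

lemma pattern_exists: "\<exists>p<2 ^ b. \<forall>u<b. bit (p :: nat) u \<longleftrightarrow> P u"
proof (intro exI conjI)
  let ?p = "horner_sum of_bool 2 (map P [0..<b]) :: nat"
  show "?p < 2 ^ b" using horner_sum_of_bool_2_less[of "map P [0..<b]"] by simp
  show "\<forall>u<b. bit ?p u \<longleftrightarrow> P u" by (simp add: bit_horner_sum_bit_iff)
qed

lemma implementable_xor_layers:
  assumes "\<And>t. implementable n k c (Dg (cz_phase n (F t)))"
    and "\<And>i j. i < j \<Longrightarrow> j < n \<Longrightarrow> E i j \<longleftrightarrow> parity s (\<lambda>t. F t i j)"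
  shows "implementable n k (s * c) (Dg (cz_phase n E))"
proof -
  have "implementable n k (s * c) (Dg (cz_phase n (\<lambda>i j. parity s (\<lambda>t. F t i j))))"
  proof (induction s)
    case 0
    have "Dg (cz_phase n (\<lambda>i j. parity 0 (\<lambda>t. F t i j))) = id" by (rule cz_phase_False) simp
    then show ?case using implementable_id by (simp only: mult_0)
  next
    case (Suc s)
    have "Dg (cz_phase n (\<lambda>i j. parity (Suc s) (\<lambda>t. F t i j)))
      = Dg (cz_phase n (F s)) \<circ> Dg (cz_phase n (\<lambda>i j. parity s (\<lambda>t. F t i j)))"
      unfolding Dg_comp cz_phase_mult by (rule arg_cong[where f = Dg], rule cz_phase_cong) auto
    then show ?case using implementable_comp[OF assms(1)[of s] Suc] by (simp only: mult_Suc)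
  qed
  moreover have "cz_phase n (\<lambda>i j. parity s (\<lambda>t. F t i j)) = cz_phase n E"
    by (rule cz_phase_cong) (use assms(2) in auto)
  ultimately show ?thesis by (simp only:)
qed

lemma parity_odd_card: "parity j P \<longleftrightarrow> odd (card {i. i < j \<and> P i})"
proof (induction j)
  case (Suc j)
  have "{i. i < Suc j \<and> P i} = {i. i < j \<and> P i} \<union> (if P j then {j} else {})"
    by (auto simp: less_Suc_eq)
  then show ?case using Suc by auto
qed simp

text \<open>A number t below \<open>2^b\<close> stands for the set of its bits, a subset of the
  positions in a block. For a qubit j, the sets in \<open>T j \<beta>\<close> have the neighbourhood
  of j in block \<open>\<beta>\<close> as symmetric difference, so an edge from the group to a later
  one lies in an odd number of layers exactly if it belongs to \<open>E\<close>.\<close>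

lemma implementable_out_stage:
  assumes k: "n - 1 \<le> 2 ^ k" and m: "m = g * b" "0 < b" "4 * g \<le> 2 ^ b"
    and E: "\<And>i j. E i j \<Longrightarrow> i div m = r \<and> r < j div m"
  shows "implementable n k (2 ^ b * (2 * 2 ^ k)) (Dg (cz_phase n E))"
proof (cases "m = 0")
  case True
  \<comment> \<open>Division by 0 gives 0, so \<open>r < j div m\<close> is impossible.\<close>
  then have "\<not> E i j" for i j using E by auto
  then have "Dg (cz_phase n E) = id" by (intro cz_phase_False)
  then show ?thesis using implementable_mono[OF implementable_id zero_le] by (simp only:)
next
  case False
  have "\<exists>T. \<forall>\<beta><g. T \<beta> \<subseteq> {..<2 ^ b :: nat} \<and> (\<forall>u<b. odd (card {t \<in> T \<beta>. bit t u}) \<longleftrightarrow> E (r * m + \<beta> * b + u) j) \<and>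
    (\<forall>\<gamma><g. \<beta> \<noteq> \<gamma> \<longrightarrow> T \<beta> \<inter> T \<gamma> = {})" for j
  proof -
    obtain p :: "nat \<Rightarrow> nat" where p: "\<And>\<beta>. p \<beta> < 2 ^ b" "\<And>\<beta> u. u < b \<Longrightarrow> bit (p \<beta>) u \<longleftrightarrow> E (r * m + \<beta> * b + u) j"
    proof -
      have "\<forall>\<beta>. \<exists>p::nat. p < 2 ^ b \<and> (\<forall>u<b. bit p u \<longleftrightarrow> E (r * m + \<beta> * b + u) j)"
        by (intro allI) (rule pattern_exists)
      from choice[OF this] show thesis using that by blast
    qed
    then have "\<forall>\<beta><g. p \<beta> < 2 ^ b" by blast
    from xor_pairs_exist[OF m(3) this] obtain T where
      T: "\<forall>\<beta><g. T \<beta> \<subseteq> {..<2 ^ b :: nat} \<and> (\<forall>u. odd (card {t \<in> T \<beta>. bit t u}) \<longleftrightarrow> bit (p \<beta>) u)"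
        "\<forall>\<beta><g. \<forall>\<gamma><g. \<beta> \<noteq> \<gamma> \<longrightarrow> T \<beta> \<inter> T \<gamma> = {}"
      by (elim exE conjE)
    show ?thesis
    proof (intro exI[of _ T] allI impI conjI)
      fix \<beta> assume \<beta>: "\<beta> < g"
      then show "T \<beta> \<subseteq> {..<2 ^ b}" using T(1) by blast
      show "odd (card {t \<in> T \<beta>. bit t u}) \<longleftrightarrow> E (r * m + \<beta> * b + u) j" if "u < b" for u
        using T(1) \<beta> p(2)[OF that] by simp
      show "T \<beta> \<inter> T \<gamma> = {}" if "\<gamma> < g" "\<beta> \<noteq> \<gamma>" for \<gamma>
        using T(2) \<beta> that by blast
    qed
  qed
  then have "\<forall>j. \<exists>T. \<forall>\<beta><g. T \<beta> \<subseteq> {..<2 ^ b :: nat} \<and> (\<forall>u<b. odd (card {t \<in> T \<beta>. bit t u}) \<longleftrightarrow> E (r * m + \<beta> * b + u) j) \<and>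
    (\<forall>\<gamma><g. \<beta> \<noteq> \<gamma> \<longrightarrow> T \<beta> \<inter> T \<gamma> = {})" by (rule allI)
  from choice[OF this] obtain T where T0:
    "\<forall>j. \<forall>\<beta><g. T j \<beta> \<subseteq> {..<2 ^ b :: nat} \<and> (\<forall>u<b. odd (card {t \<in> T j \<beta>. bit t u}) \<longleftrightarrow> E (r * m + \<beta> * b + u) j) \<and>
    (\<forall>\<gamma><g. \<beta> \<noteq> \<gamma> \<longrightarrow> T j \<beta> \<inter> T j \<gamma> = {})" by (elim exE)
  have T: "\<And>j \<beta>. \<beta> < g \<Longrightarrow> T j \<beta> \<subseteq> {..<2 ^ b :: nat}"
    "\<And>j \<beta> u. \<beta> < g \<Longrightarrow> u < b \<Longrightarrow> odd (card {t \<in> T j \<beta>. bit t u}) \<longleftrightarrow> E (r * m + \<beta> * b + u) j"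
    "\<And>j \<beta> \<gamma>. \<beta> < g \<Longrightarrow> \<gamma> < g \<Longrightarrow> \<beta> \<noteq> \<gamma> \<Longrightarrow> T j \<beta> \<inter> T j \<gamma> = {}"
    using T0 by blast+
  define blk where "blk i = (i mod m) div b" for i
  define off where "off i = (i mod m) mod b" for i
  have blk: "blk i < g" "off i < b" for i
    using False m by (auto simp: blk_def off_def less_mult_imp_div_less)
  have pos: "i = r * m + blk i * b + off i" if "i div m = r" for i
  proof -
    have "r * m + (blk i * b + off i) = i"
      unfolding blk_def off_def div_mult_mod_eq that[symmetric] by (rule refl)
    then show ?thesis by simp
  qed
  define F where "F t i j \<longleftrightarrow> i div m = r \<and> r < j div m \<and> bit t (off i) \<and> t \<in> T j (blk i)" for t i j
  show ?thesis
  proof (rule implementable_xor_layers[where F = F])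
    fix i j assume "i < j" "j < n"
    show "E i j \<longleftrightarrow> parity (2 ^ b) (\<lambda>t. F t i j)"
    proof (cases "i div m = r \<and> r < j div m")
      case True
      then have "{t. t < 2 ^ b \<and> F t i j} = {t \<in> T j (blk i). bit t (off i)}"
        using T(1)[OF blk(1)] by (auto simp: F_def)
      then show ?thesis using T(2)[OF blk(1)[of i] blk(2)[of i], of j] pos[of i] by (simp add: parity_odd_card True)
    next
      case False
      then show ?thesis using E by (auto simp: F_def parity_odd_card)
    qed
  next
    fix t
    \<comment> \<open>A qubit of the group carries its own block, any other one the block for which
      it uses t. Disjointness of the sets makes that block unique; if there is none, the arbitrary
      value is harmless, as \<open>tgt\<close> fails.\<close>
    define lab where "lab v = (if v div m = r then blk v else (SOME \<beta>. \<beta> < g \<and> t \<in> T v \<beta>))" for v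
    have lab: "lab j = \<beta> \<longleftrightarrow> t \<in> T j \<beta>" if "j div m \<noteq> r" "\<exists>\<beta><g. t \<in> T j \<beta>" "\<beta> < g" for j \<beta>
    proof -
      have "lab j < g \<and> t \<in> T j (lab j)" unfolding lab_def using that(1) someI_ex[OF that(2)] by simp
      then show ?thesis using T(3)[of "lab j" \<beta> j] that(3) by auto
    qed
    show "implementable n k (2 * 2 ^ k) (Dg (cz_phase n (F t)))"
    proof (rule implementable_biclique[OF k, where src = "\<lambda>i. i div m = r \<and> bit t (off i)"
          and tgt = "\<lambda>j. r < j div m \<and> (\<exists>\<beta><g. t \<in> T j \<beta>)" and l = lab])
      fix i j
      show "F t i j \<longleftrightarrow> (i div m = r \<and> bit t (off i)) \<and> (r < j div m \<and> (\<exists>\<beta><g. t \<in> T j \<beta>)) \<and> lab i = lab j"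
      proof (cases "i div m = r \<and> r < j div m \<and> (\<exists>\<beta><g. t \<in> T j \<beta>)")
        case True
        then have "lab i = blk i" by (simp add: lab_def)
        moreover have "lab j = blk i \<longleftrightarrow> t \<in> T j (blk i)" using True by (intro lab blk) auto
        ultimately show ?thesis using True by (auto simp: F_def)
      next
        case False
        then show ?thesis using blk(1)[of i] by (auto simp: F_def)
      qed
    next
      fix i j assume "r < i div m \<and> (\<exists>\<beta><g. t \<in> T i \<beta>)" "j div m = r \<and> bit t (off j)"
      then show "j \<le> i" using div_le_mono[of i j m] by (cases "j \<le> i") auto
    qed auto
  qed
qed

lemma implementable_in_stage:
  assumes k: "n - 1 \<le> 2 ^ k" and m: "0 < m"
    and E: "\<And>i j. E i j \<Longrightarrow> i < j \<and> i div m = j div m \<and> i mod m = r"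
  shows "implementable n k (2 * 2 ^ k) (Dg (cz_phase n E))"
\<comment> \<open>The star centres are the qubits at position r of their groups;
  \<open>j div m * m + r\<close> is the centre in the group of j.\<close>
proof (rule implementable_biclique[OF k, where src = "\<lambda>i. i mod m = r"
      and tgt = "\<lambda>j. r < j mod m \<and> E (j div m * m + r) j" and l = "\<lambda>v. v div m"])
  fix i j :: nat assume ij: "i < j"
  have lt: "i mod m < j mod m" if "i div m = j div m"
    using ij that by (metis div_mult_mod_eq nat_add_left_cancel_less)
  show "E i j \<longleftrightarrow> i mod m = r \<and> (r < j mod m \<and> E (j div m * m + r) j) \<and> i div m = j div m"
    using E[of i j] lt by (metis div_mult_mod_eq)
next
  fix i j assume "r < i mod m \<and> E (i div m * m + r) i" "j mod m = r" "i div m = j div m"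
  then show "j \<le> i" by (metis add_le_cancel_left div_mult_mod_eq less_imp_le)
qed auto

section \<open>Implementing the Borel factors\<close>

text \<open>Constant phases times i^q(x), where q(x) = sum of a_j x_j + 2 * sum of b_jl x_j x_l
  modulo 4.\<close>

inductive_set quad :: "nat \<Rightarrow> (state \<Rightarrow> complex) set" for n where
  quad_const: "(\<lambda>_. cis \<theta>) \<in> quad n"
| quad_S: "a < n \<Longrightarrow> (\<lambda>x. if x a then \<i> else 1) \<in> quad n"
| quad_CZ: "a < b \<Longrightarrow> b < n \<Longrightarrow> (\<lambda>x. if x a \<and> x b then -1 else 1) \<in> quad n"
| quad_mult: "c \<in> quad n \<Longrightarrow> d \<in> quad n \<Longrightarrow> (\<lambda>x. c x * d x) \<in> quad n"

lemma quad_CZ_sym: "a \<noteq> b \<Longrightarrow> a < n \<Longrightarrow> b < n \<Longrightarrow> (\<lambda>x. if x a \<and> x b then -1 else 1) \<in> quad n"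
  using quad_CZ[of a b n] quad_CZ[of b a n] by (cases "a < b") (simp_all only: conj_commute linorder_neq_iff not_less_iff_gr_or_eq, auto simp: conj_commute)

lemma quad_Z: "a < n \<Longrightarrow> (\<lambda>x. if x a then -1 else 1) \<in> quad n"
proof -
  assume "a < n"
  then have "(\<lambda>x. (if x a then \<i> else 1) * (if x a then \<i> else 1)) \<in> quad n"
    by (intro quad_mult quad_S)
  moreover have "(\<lambda>x. (if x a then \<i> else 1) * (if x a then \<i> else 1)) = (\<lambda>x :: state. if x a then -1 else 1)"
    by auto
  ultimately show ?thesis by (simp only:)
qed

text \<open>Substituting a parity keeps the exponent quadratic, because i^(x XOR y) = i^x * i^y *
  (-1)^(x y).\<close>

lemma quad_CNOT:
  assumes ct: "c \<noteq> t" "c < n" "t < n"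
  shows "d \<in> quad n \<Longrightarrow> (\<lambda>x. d (x(t := (x t \<noteq> x c)))) \<in> quad n"
proof (induction rule: quad.induct)
  case (quad_const \<theta>)
  show ?case by (rule quad.quad_const)
next
  case (quad_S a)
  show ?case
  proof (cases "a = t")
    case True
    have "(\<lambda>x. (if x t then \<i> else 1) * ((if x c then \<i> else 1) * (if x t \<and> x c then -1 else 1))) \<in> quad n"
      using ct by (intro quad_mult quad.quad_S quad_CZ_sym) auto
    moreover have "(\<lambda>x. (if x t then \<i> else 1) * ((if x c then \<i> else 1) * (if x t \<and> x c then -1 else 1)))
      = (\<lambda>x. if (x(t := (x t \<noteq> x c))) a then \<i> else 1)"
      using True by (intro ext) simp
    ultimately show ?thesis by (simp only:)
  next
    case False
    then show ?thesis using quad.quad_S[OF quad_S] by simp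
  qed
next
  case (quad_CZ a b)
  have main: "(\<lambda>x. if (x t \<noteq> x c) \<and> x e then -1 else 1) \<in> quad n" if "e \<noteq> t" "e < n" for e
  proof -
    have "(\<lambda>x. (if x t \<and> x e then -1 else 1) * (if x c \<and> x e then -1 else 1)) \<in> quad n"
    proof (rule quad_mult)
      show "(\<lambda>x. if x t \<and> x e then -1 else 1) \<in> quad n" using that ct by (intro quad_CZ_sym) auto
      show "(\<lambda>x. if x c \<and> x e then -1 else 1) \<in> quad n"
        using that ct quad_Z[of c n] quad_CZ_sym[of c e n] by (cases "c = e") auto
    qed
    moreover have "(\<lambda>x. (if x t \<and> x e then -1 else 1) * (if x c \<and> x e then -1 else 1))
      = (\<lambda>x :: state. if (x t \<noteq> x c) \<and> x e then -1 else 1 :: complex)" by auto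
    ultimately show ?thesis by (simp only:)
  qed
  consider "a = t" | "b = t" | "a \<noteq> t" "b \<noteq> t" by blast
  then show ?case
  proof cases
    case 1
    then show ?thesis using main[of b] quad_CZ by simp
  next
    case 2
    then show ?thesis using main[of a] quad_CZ by (simp add: conj_commute)
  next
    case 3
    then show ?thesis using quad.quad_CZ[OF quad_CZ] by simp
  qed
next
  case (quad_mult d e)
  then show ?case by (intro quad.quad_mult)
qed

text \<open>Products of CZ phases are symmetric differences of edge sets, and the remaining powers
  of S and scalars are local.\<close>

lemma quad_factor:
  assumes "d \<in> quad n"
  shows "\<exists>c E. d = (\<lambda>x. c x * cz_phase n E x) \<and> implementable n k 0 (Dg c)"
  using assms
proof (induction rule: quad.induct)
  case (quad_const \<theta>)
  have "cz_phase n (\<lambda>_ _. False) = (\<lambda>_. 1)" by (auto simp: cz_phase_def)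
  then show ?case using implementable_Ph[of n k \<theta>]
    by (intro exI[of _ "\<lambda>_. cis \<theta>"] exI[of _ "\<lambda>_ _. False"]) simp
next
  case (quad_S a)
  have "cz_phase n (\<lambda>_ _. False) = (\<lambda>_. 1)" by (auto simp: cz_phase_def)
  then show ?case using implementable_Sg[OF quad_S, of k] unfolding Sg_def
    by (intro exI[of _ "\<lambda>x. if x a then \<i> else 1"] exI[of _ "\<lambda>_ _. False"]) simp
next
  case (quad_CZ a b)
  have "cz_phase n (\<lambda>i j. i = a \<and> j = b) x = (if x a \<and> x b then -1 else 1)" for x
  proof -
    have "cz_phase n (\<lambda>i j. i = a \<and> j = b) x = (\<Prod>j<n. \<Prod>i<j. if i = a \<and> (j = b \<and> x a \<and> x b) then -1 else 1)"
      unfolding cz_phase_def by (intro prod.cong refl) auto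
    also have "\<dots> = (\<Prod>j<n. if j = b then (if x a \<and> x b then -1 else 1) else 1)"
    proof (intro prod.cong refl)
      fix j
      show "(\<Prod>i<j. if i = a \<and> (j = b \<and> x a \<and> x b) then -1 else 1 :: complex)
        = (if j = b then (if x a \<and> x b then -1 else 1) else 1)"
        unfolding prod_parity parity_single using quad_CZ by auto
    qed
    also have "\<dots> = (if x a \<and> x b then -1 else 1)" using quad_CZ by simp
    finally show ?thesis .
  qed
  then show ?case using implementable_Ph[of n k 0]
    by (intro exI[of _ "\<lambda>_. cis 0"] exI[of _ "\<lambda>i j. i = a \<and> j = b"]) simp
next
  case (quad_mult d e)
  then obtain c E c' E' where c: "d = (\<lambda>x. c x * cz_phase n E x)" "implementable n k 0 (Dg c)"
    "e = (\<lambda>x. c' x * cz_phase n E' x)" "implementable n k 0 (Dg c')" by blast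
  have "(\<lambda>x. d x * e x) = (\<lambda>x. (c x * c' x) * cz_phase n (\<lambda>i j. E i j \<noteq> E' i j) x)"
    unfolding c cz_phase_mult[symmetric] by (simp only: mult_ac)
  moreover have "implementable n k 0 (Dg (\<lambda>x. c x * c' x))"
    using implementable_comp0(1)[OF c(2,4)] unfolding Dg_comp .
  ultimately show ?case
    by (intro exI[of _ "\<lambda>x. c x * c' x"] exI[of _ "\<lambda>i j. E i j \<noteq> E' i j"] conjI)
qed

text \<open>A unitriangular matrix is written as (1 + N)(1 + N') with a block diagonal N
  (\<open>in_group\<close>) and a strictly block triangular N' (\<open>out_group\<close>), so that
  the star stages and the group stages apply to separate factors.\<close>

definition in_group :: "nat \<Rightarrow> (nat \<Rightarrow> nat \<Rightarrow> bool) \<Rightarrow> bool" where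
  "in_group m N \<longleftrightarrow> (\<forall>i j. N i j \<longrightarrow> i < j \<and> i div m = j div m)"

definition out_group :: "nat \<Rightarrow> (nat \<Rightarrow> nat \<Rightarrow> bool) \<Rightarrow> bool" where
  "out_group m N \<longleftrightarrow> (\<forall>i j. N i j \<longrightarrow> i div m < j div m)"

definition cnot :: "nat \<Rightarrow> nat \<Rightarrow> state \<Rightarrow> state" where
  "cnot c t x = x(t := (x t \<noteq> x c))"

text \<open>Column operation on 1 + N, sources being columns: the disjunct \<open>j = t\<close> is
  the diagonal entry of column t, and \<open>t < j\<close> restricts to the entries that
  \<open>cnot_layer\<close> reads. \<open>add_row\<close> is the analogue for rows.\<close>

definition add_col :: "nat \<Rightarrow> nat \<Rightarrow> (nat \<Rightarrow> nat \<Rightarrow> bool) \<Rightarrow> nat \<Rightarrow> nat \<Rightarrow> bool" where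
  "add_col c t N i j \<longleftrightarrow> (N i j \<noteq> (i = c \<and> (j = t \<or> t < j \<and> N t j)))"

definition add_row :: "nat \<Rightarrow> nat \<Rightarrow> (nat \<Rightarrow> nat \<Rightarrow> bool) \<Rightarrow> nat \<Rightarrow> nat \<Rightarrow> bool" where
  "add_row c t N i j \<longleftrightarrow> (N i j \<noteq> (j = t \<and> (i = c \<or> i < c \<and> N i c)))"

lemma cnot_layer_add_col:
  assumes "c < t" "t < n"
  shows "cnot_layer n N \<circ> cnot c t = cnot_layer n (add_col c t N)"
proof (intro ext)
  fix x j
  show "(cnot_layer n N \<circ> cnot c t) x j = cnot_layer n (add_col c t N) x j"
  proof (cases "j < n")
    case True
    have "parity j (\<lambda>i. N i j \<and> cnot c t x i) = parity j (\<lambda>i. (N i j \<and> x i) \<noteq> (i = t \<and> (N t j \<and> x c)))"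
      by (rule parity_cong) (auto simp: cnot_def)
    also have "\<dots> = (parity j (\<lambda>i. N i j \<and> x i) \<noteq> (t < j \<and> N t j \<and> x c))"
      by (simp only: parity_xor parity_single)
    finally have 1: "parity j (\<lambda>i. N i j \<and> cnot c t x i) = (parity j (\<lambda>i. N i j \<and> x i) \<noteq> (t < j \<and> N t j \<and> x c))" .
    have "parity j (\<lambda>i. add_col c t N i j \<and> x i) = parity j (\<lambda>i. (N i j \<and> x i) \<noteq> (i = c \<and> ((j = t \<or> t < j \<and> N t j) \<and> x c)))"
      by (rule parity_cong) (auto simp: add_col_def)
    also have "\<dots> = (parity j (\<lambda>i. N i j \<and> x i) \<noteq> (c < j \<and> (j = t \<or> t < j \<and> N t j) \<and> x c))"
      by (simp only: parity_xor parity_single)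
    finally have 2: "parity j (\<lambda>i. add_col c t N i j \<and> x i) = \<dots>" .
    have "cnot c t x j = (x j \<noteq> (j = t \<and> x c))" by (auto simp: cnot_def)
    moreover have "c < j" if "j = t \<or> t < j" using that assms by auto
    ultimately show ?thesis unfolding comp_apply cnot_layer_def 1 2 using True by (simp only: if_True) blast
  next
    case False
    then show ?thesis using assms by (simp add: cnot_layer_def cnot_def)
  qed
qed

lemma cnot_layer_add_row:
  assumes "c < t" "t < n"
  shows "cnot c t \<circ> cnot_layer n N = cnot_layer n (add_row c t N)"
proof (intro ext)
  fix x j
  have 1: "parity j (\<lambda>i. add_row c t N i j \<and> x i) = parity j (\<lambda>i. N i j \<and> x i)" if "j \<noteq> t"
    by (rule parity_cong) (use that in \<open>auto simp: add_row_def\<close>)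
  have "parity t (\<lambda>i. add_row c t N i t \<and> x i) = parity t (\<lambda>i. (N i t \<and> x i) \<noteq> ((i = c \<and> x c) \<noteq> (i < c \<and> (N i c \<and> x i))))"
    by (rule parity_cong) (auto simp: add_row_def)
  also have "\<dots> = (parity t (\<lambda>i. N i t \<and> x i) \<noteq> (x c \<noteq> parity c (\<lambda>i. N i c \<and> x i)))"
    unfolding parity_xor parity_single parity_restrict[OF less_imp_le[OF assms(1)]] using assms by simp
  finally have 2: "parity t (\<lambda>i. add_row c t N i t \<and> x i) = \<dots>" .
  show "(cnot c t \<circ> cnot_layer n N) x j = cnot_layer n (add_row c t N) x j"
  proof (cases "j = t")
    case True
    have "(cnot c t \<circ> cnot_layer n N) x t = (cnot_layer n N x t \<noteq> cnot_layer n N x c)" by (simp add: cnot_def)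
    also have "\<dots> = ((x t \<noteq> parity t (\<lambda>i. N i t \<and> x i)) \<noteq> (x c \<noteq> parity c (\<lambda>i. N i c \<and> x i)))"
      using assms by (simp add: cnot_layer_def)
    also have "\<dots> = cnot_layer n (add_row c t N) x t"
      unfolding cnot_layer_def[of n "add_row c t N"] 2 using assms(2) by (simp only: if_True) blast
    finally show ?thesis using True by simp
  next
    case False
    then show ?thesis using 1 by (simp add: cnot_def cnot_layer_def)
  qed
qed

text \<open>A CNOT e between different groups is absorbed by N'. For e inside a group, (1 + N)(1 +
  N') e = ((1 + N) e) (e (1 + N') e), and conjugation by e only adds to an entry of N' others
  belonging to the same pair of groups.\<close>

lemma unitriangular_step:
  assumes ct: "c < t" "t < n" and N: "in_group m N" "out_group m N'"
  shows "\<exists>M M'. in_group m M \<and> out_group m M' \<and> (cnot_layer n N \<circ> cnot_layer n N') \<circ> cnot c t = cnot_layer n M \<circ> cnot_layer n M'"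
proof (cases "c div m = t div m")
  case True
  have inv: "cnot c t \<circ> cnot c t = id"
    using ct by (auto simp: fun_eq_iff cnot_def)
  have "(cnot_layer n N \<circ> cnot_layer n N') \<circ> cnot c t = (cnot_layer n N \<circ> (cnot c t \<circ> cnot c t)) \<circ> (cnot_layer n N' \<circ> cnot c t)"
    unfolding inv by (simp only: comp_assoc comp_id id_comp)
  also have "\<dots> = (cnot_layer n N \<circ> cnot c t) \<circ> (cnot c t \<circ> (cnot_layer n N' \<circ> cnot c t))" by (simp only: comp_assoc)
  also have "\<dots> = cnot_layer n (add_col c t N) \<circ> cnot_layer n (add_row c t (add_col c t N'))"
    unfolding cnot_layer_add_col[OF ct] cnot_layer_add_row[OF ct] ..
  finally have "(cnot_layer n N \<circ> cnot_layer n N') \<circ> cnot c t = cnot_layer n (add_col c t N) \<circ> cnot_layer n (add_row c t (add_col c t N'))" .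
  moreover have "in_group m (add_col c t N)"
    using N(1) True ct unfolding in_group_def add_col_def by (metis less_trans)
  moreover have "out_group m (add_row c t (add_col c t N'))"
    unfolding out_group_def
  proof (intro allI impI)
    fix i j assume "add_row c t (add_col c t N') i j"
    moreover have "\<not> N' c t" "\<not> N' c c" "\<not> N' t c" "\<not> N' t t" using N(2) True unfolding out_group_def by (metis less_irrefl)+
    ultimately have "N' i j \<or> i = c \<and> N' t j \<or> j = t \<and> N' i c"
      using ct unfolding add_row_def add_col_def by (cases "i = c"; cases "j = t") auto
    then show "i div m < j div m" using N(2) True unfolding out_group_def by metis
  qed
  ultimately show ?thesis by blast
next
  case False
  then have lt: "c div m < t div m" using ct div_le_mono[of c t m] by simp
  have "(cnot_layer n N \<circ> cnot_layer n N') \<circ> cnot c t = cnot_layer n N \<circ> cnot_layer n (add_col c t N')"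
    unfolding comp_assoc cnot_layer_add_col[OF ct] ..
  moreover have "out_group m (add_col c t N')"
    using N(2) lt unfolding out_group_def add_col_def by (metis less_trans)
  ultimately show ?thesis using N(1) by blast
qed

text \<open>Generators are added on the left: diagonal ones join \<open>c\<close>, while a CNOT
  moves past \<open>Dg c\<close> by \<open>quad_CNOT\<close> and, as \<open>Pm\<close> reverses
  composition, multiplies the layers on the right.\<close>

lemma borel_normal_form:
  assumes "F \<in> borel_ops n"
  shows "\<exists>c\<in>quad n. \<exists>N N'. in_group m N \<and> out_group m N' \<and> F = Dg c \<circ> Pm (cnot_layer n N \<circ> cnot_layer n N')"
  using assms
proof (induction rule: op_words.induct)
  case words_id
  have id: "cnot_layer n (\<lambda>_ _. False) = (\<lambda>x. x)" by (auto simp: fun_eq_iff cnot_layer_def parity_False)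
  have "Pm (cnot_layer n (\<lambda>_ _. False) \<circ> cnot_layer n (\<lambda>_ _. False)) = id"
    unfolding id Pm_id[symmetric] by (rule Pm_cong) simp
  moreover have "Dg (\<lambda>_. cis 0) = id" by (simp only: cis_zero Dg_one)
  ultimately have "id = Dg (\<lambda>_. cis 0) \<circ> Pm (cnot_layer n (\<lambda>_ _. False) \<circ> cnot_layer n (\<lambda>_ _. False))"
    by (simp only: comp_id)
  moreover have "in_group m (\<lambda>_ _. False)" "out_group m (\<lambda>_ _. False)"
    by (auto simp: in_group_def out_group_def)
  ultimately show ?case using quad_const[of 0 n] by blast
next
  case (words_step g F)
  then obtain c N N' where c: "c \<in> quad n" "in_group m N" "out_group m N'" "F = Dg c \<circ> Pm (cnot_layer n N \<circ> cnot_layer n N')"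
    by blast
  have diag: ?case if "g = Dg d" "d \<in> quad n" for d
  proof -
    have "g \<circ> F = Dg (\<lambda>x. d x * c x) \<circ> Pm (cnot_layer n N \<circ> cnot_layer n N')"
      unfolding c(4) that(1) comp_assoc[symmetric] Dg_comp ..
    then show ?thesis using quad_mult[OF that(2) c(1)] c(2,3) by blast
  qed
  show ?case
    using words_step(1)
  proof (cases rule: gens_cases)
    case (Cx i j)
    obtain M M' where M: "in_group m M" "out_group m M'" "(cnot_layer n N \<circ> cnot_layer n N') \<circ> cnot i j = cnot_layer n M \<circ> cnot_layer n M'"
      using unitriangular_step[OF Cx(2,3) c(2,3)] by blast
    have g: "g = Pm (cnot i j)" unfolding Cx Cx_def cnot_def ..
    have "g \<circ> F = Dg (\<lambda>x. c (cnot i j x)) \<circ> Pm (cnot_layer n M \<circ> cnot_layer n M')"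
      unfolding g c(4) comp_assoc[symmetric] Pm_Dg unfolding comp_assoc Pm_comp unfolding M(3)[symmetric] comp_assoc ..
    moreover have "(\<lambda>x. c (cnot i j x)) \<in> quad n"
      unfolding cnot_def using Cx c(1) by (intro quad_CNOT) auto
    ultimately show ?thesis using M by blast
  next
    case (Cz i j)
    then show ?thesis using diag[of "\<lambda>x. if x i \<and> x j then -1 else 1"] quad_CZ_sym[of i j n] by (simp add: Cz_def)
  next
    case (Sg i)
    then show ?thesis using diag[of "\<lambda>x. if x i then \<i> else 1"] quad_S[of i n] by (simp add: Sg_def)
  next
    case (Ph \<theta>)
    then show ?thesis using diag[of "\<lambda>_. cis \<theta>"] quad_const[of \<theta> n] by simp
  qed
qed

text \<open>\<open>R\<close> bounds the number of groups. \<open>L\<close> is the number of biclique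
  layers for one graph: \<open>2^b\<close> for the edges leaving each group, and one for each of the
  m positions of star centres.\<close>

context
  fixes n k g b R m L :: nat
  assumes k: "n - 1 \<le> 2 ^ k" and m: "m = g * b" "0 < g" "0 < b" "4 * g \<le> 2 ^ b"
    and R: "n \<le> R * m"
  defines "L \<equiv> R * 2 ^ b + m"
begin

lemma m_pos: "0 < m" using m by simp

lemma group_less: "i < n \<Longrightarrow> i div m < R"
  using R by (simp add: less_mult_imp_div_less)

lemma out_stage:
  assumes "out_group m N"
  shows "implementable n k (2 ^ b * (2 * 2 ^ k)) (Dg (cz_phase n (\<lambda>i j. N i j \<and> i div m = r)))"
  by (rule implementable_out_stage[OF k m(1,3,4), where r = r]) (use assms in \<open>auto simp: out_group_def\<close>)

lemma in_stage:
  assumes "in_group m N"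
  shows "implementable n k (2 * 2 ^ k) (Dg (cz_phase n (\<lambda>i j. N i j \<and> i mod m = r)))"
  by (rule implementable_in_stage[OF k m_pos, where r = r]) (use assms in \<open>auto simp: in_group_def\<close>)

lemma implementable_cz_phase: "implementable n k (L * (2 * 2 ^ k)) (Dg (cz_phase n E))"
proof -
  let ?I = "\<lambda>i j. E i j \<and> i < j \<and> i div m = j div m" and ?O = "\<lambda>i j. E i j \<and> i div m < j div m"
  have I: "in_group m ?I" and O: "out_group m ?O" by (auto simp: in_group_def out_group_def)
  have "implementable n k (m * (2 * 2 ^ k)) (Dg (cz_phase n ?I))"
    by (rule implementable_stages_cz_phase[where \<tau> = "\<lambda>i. i mod m"]) (use m_pos in_stage[OF I] in auto)
  moreover have "implementable n k (R * (2 ^ b * (2 * 2 ^ k))) (Dg (cz_phase n ?O))"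
    by (rule implementable_stages_cz_phase[where \<tau> = "\<lambda>i. i div m"]) (use group_less out_stage[OF O] in auto)
  ultimately have "implementable n k (R * (2 ^ b * (2 * 2 ^ k)) + m * (2 * 2 ^ k)) (Dg (cz_phase n ?O) \<circ> Dg (cz_phase n ?I))"
    by (intro implementable_comp)
  moreover have "Dg (cz_phase n ?O) \<circ> Dg (cz_phase n ?I) = Dg (cz_phase n E)"
    unfolding Dg_comp cz_phase_mult
  proof (rule arg_cong[where f = Dg], rule cz_phase_cong)
    fix i j :: nat assume "i < j"
    then have "i div m \<le> j div m" by (intro div_le_mono) simp
    then show "((E i j \<and> i div m < j div m) \<noteq> (E i j \<and> i < j \<and> i div m = j div m)) = E i j"
      using \<open>i < j\<close> by auto
  qed
  moreover have "R * (2 ^ b * (2 * 2 ^ k)) + m * (2 * 2 ^ k) = L * (2 * 2 ^ k)"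
    by (simp add: L_def algebra_simps)
  ultimately show ?thesis by (simp only:)
qed

lemma implementable_cnot_layer:
  assumes "in_group m N" "out_group m N'"
  shows "implementable n k (L * (2 * 2 ^ k)) (Pm (cnot_layer n N \<circ> cnot_layer n N'))"
proof -
  have "implementable n k (m * (2 * 2 ^ k)) (Pm (cnot_layer n N))"
  proof (rule implementable_stages_cnot_layer[where \<tau> = "\<lambda>i. i mod m"])
    show "i mod m < j mod m" if "N i j" for i j
      using assms(1) that unfolding in_group_def by (metis div_mult_mod_eq nat_add_left_cancel_less)
  qed (use m_pos in_stage[OF assms(1)] in auto)
  moreover have "implementable n k (R * (2 ^ b * (2 * 2 ^ k))) (Pm (cnot_layer n N'))"
    by (rule implementable_stages_cnot_layer[where \<tau> = "\<lambda>i. i div m"])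
      (use group_less out_stage[OF assms(2)] assms(2) in \<open>auto simp: out_group_def\<close>)
  ultimately have "implementable n k (R * (2 ^ b * (2 * 2 ^ k)) + m * (2 * 2 ^ k)) (Pm (cnot_layer n N') \<circ> Pm (cnot_layer n N))"
    by (intro implementable_comp)
  moreover have "R * (2 ^ b * (2 * 2 ^ k)) + m * (2 * 2 ^ k) = L * (2 * 2 ^ k)"
    by (simp add: L_def algebra_simps)
  ultimately show ?thesis by (simp only: Pm_comp)
qed

text \<open>Two graphs, one for the quadratic phase and one for the CNOT part, with L layers each at
  \<open>2 * 2^k\<close> gates per layer.\<close>

lemma implementable_borel:
  assumes "F \<in> borel_ops n"
  shows "implementable n k (4 * L * 2 ^ k) F"
proof -
  obtain d N N' where d: "d \<in> quad n" "in_group m N" "out_group m N'" "F = Dg d \<circ> Pm (cnot_layer n N \<circ> cnot_layer n N')"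
    using borel_normal_form[OF assms, of m] by blast
  obtain c E where c: "d = (\<lambda>x. c x * cz_phase n E x)" "implementable n k 0 (Dg c)"
    using quad_factor[OF d(1), of k] by blast
  have "implementable n k (L * (2 * 2 ^ k)) (Dg d)"
    unfolding c(1) Dg_comp[symmetric] by (rule implementable_comp0(1)[OF c(2) implementable_cz_phase])
  then have "implementable n k (L * (2 * 2 ^ k) + L * (2 * 2 ^ k)) F"
    unfolding d(4) by (rule implementable_comp[OF _ implementable_cnot_layer[OF d(2,3)]])
  then show ?thesis by (simp add: algebra_simps)
qed

lemma implementable_big_cell:
  assumes "F \<in> big_cell n"
  shows "implementable n k (12 * L * 2 ^ k) F"
proof -
  obtain b1 b2 b3 where b: "b1 \<in> borel_ops n" "b2 \<in> borel_ops n" "b3 \<in> borel_ops n"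
    "F = b1 \<circ> (hadamards UNIV n \<circ> b2 \<circ> hadamards UNIV n) \<circ> b3"
    using assms unfolding triple_def by blast
  have "implementable n k (4 * L * 2 ^ k) (hadamards UNIV n \<circ> b2 \<circ> hadamards UNIV n)"
    by (intro implementable_comp0(2)[OF implementable_comp0(1)] implementable_hadamards implementable_borel b)
  from implementable_comp[OF implementable_comp[OF implementable_borel[OF b(1)] this] implementable_borel[OF b(3)]]
  have "implementable n k (4 * L * 2 ^ k + 4 * L * 2 ^ k + 4 * L * 2 ^ k) F"
    unfolding b(4) .
  then show ?thesis by (simp add: algebra_simps)
qed

end

section \<open>From Clifford circuits to the gate count\<close>

lemma clifford_big_cell:
  assumes "clifford_circuit n cs"
  shows "\<exists>F\<in>big_cell n. acts_as n (clifford_mat n cs) F"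
  using assms
proof (induction cs)
  case Nil
  show ?case using big_cell_id acts_as_one by (auto simp: clifford_mat_def)
next
  case (Cons g cs)
  then obtain F where F: "F \<in> big_cell n" "acts_as n (clifford_mat n cs) F"
    by (auto simp: clifford_circuit_def)
  have on: "clifford_gate_on n g" using Cons by (simp add: clifford_circuit_def)
  \<comment> \<open>The head of the list is the rightmost factor, so gates have to be absorbed on
    the right.\<close>
  have "\<exists>G. acts_as n (clifford_gate_mat n g) G \<and> F \<circ> G \<in> big_cell n"
  proof (cases g)
    case (H q)
    then show ?thesis using on acts_as_H big_cell_Had[OF _ F(1)] by auto
  next
    case (S q)
    then have "Sg q \<in> borel_ops n" using on by (intro gens_words) auto
    then show ?thesis using S on acts_as_S big_cell_borel[OF F(1)] by auto
  next
    case (CNOT c t)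
    then have "c < n" "t < n" "c \<noteq> t" using on by auto
    then show ?thesis unfolding CNOT using acts_as_CNOT big_cell_Cx_any F(1)
      by (intro exI[of _ "Cx c t"] conjI) simp_all
  next
    case (CZ c t)
    then have "Cz c t \<in> borel_ops n" using on by (intro gens_words) auto
    then show ?thesis unfolding CZ using acts_as_CZ big_cell_borel[OF F(1)]
      by (intro exI[of _ "Cz c t"] conjI) simp_all
  qed
  then obtain G where "acts_as n (clifford_gate_mat n g) G" "F \<circ> G \<in> big_cell n" by blast
  then show ?case using acts_as_mult[OF F(2)] by (auto simp: clifford_mat_def)
qed

lemma clifford_gzz:
  assumes "clifford_circuit n cs" "\<And>F. F \<in> big_cell n \<Longrightarrow> implementable n k M F"
  shows "\<exists>gs. gzz_circuit n gs \<and> eq_up_to_phase (gzz_circuit_mat n (pi / 2 ^ (k + 1)) gs) (clifford_mat n cs)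
    \<and> count_list gs GZZ \<le> M"
proof -
  obtain F where F: "F \<in> big_cell n" "acts_as n (clifford_mat n cs) F"
    using clifford_big_cell[OF assms(1)] by blast
  obtain gs \<theta> where gs: "gzz_circuit n gs" "count_list gs GZZ \<le> M"
    "acts_as n (cis \<theta> \<cdot>\<^sub>m gzz_circuit_mat n (pi / 2 ^ (k + 1)) gs) F"
    using assms(2)[OF F(1)] unfolding implementable_def by blast
  have "cis (- \<theta>) \<cdot>\<^sub>m clifford_mat n cs = cis (- \<theta>) \<cdot>\<^sub>m (cis \<theta> \<cdot>\<^sub>m gzz_circuit_mat n (pi / 2 ^ (k + 1)) gs)"
    using acts_as_unique[OF F(2) gs(3)] by simp
  also have "\<dots> = gzz_circuit_mat n (pi / 2 ^ (k + 1)) gs"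
    unfolding smult_smult cis_mult using smult_cis_0 by simp
  finally show ?thesis using gs unfolding eq_up_to_phase_def by metis
qed

lemma parameters_exist:
  assumes "1 \<le> n"
  shows "\<exists>g b R. 0 < g \<and> 0 < b \<and> 4 * g \<le> 2 ^ b \<and> n \<le> R * (g * b) \<and>
    b * (R * 2 ^ b + g * b) \<le> 16 * n \<and> ln (real n) \<le> 3 * real b"
proof -
  \<comment> \<open>Keeps the stars cheap: b * (g * b) = \<open>b^2 * 2^b / 4\<close> is at most
    \<open>4^b\<close>, hence at most n.\<close>
  have sq: "b * b \<le> 4 * 2 ^ b" for b :: nat
  proof (induction b)
    case (Suc b)
    show ?case
    proof (cases "b \<le> 2")
      case True
      then have "b = 0 \<or> b = 1 \<or> b = 2" by auto
      then show ?thesis by auto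
    next
      case False
      then have "3 * b \<le> b * b" by simp
      moreover have "Suc b * Suc b = b * b + 2 * b + 1" "2 * b + 1 \<le> 3 * b" using False by simp_all
      ultimately have "Suc b * Suc b \<le> 2 * (b * b)" by linarith
      then show ?thesis using Suc by simp
    qed
  qed simp
  have ln_le: "ln (real n) \<le> 3 * real b" if "n < 4 ^ (b + 1)" "2 \<le> b" for b
  proof -
    have "ln (real n) \<le> ln (4 ^ (b + 1))"
    proof (rule ln_mono)
      have "real n \<le> real (4 ^ (b + 1))" using that(1) by (intro of_nat_mono less_imp_le)
      then show "real n \<le> 4 ^ (b + 1)" by (simp only: of_nat_power of_nat_numeral)
    qed (use assms in simp)
    also have "\<dots> = real (b + 1) * (2 * ln 2)"
    proof -
      have "ln (4 :: real) = 2 * ln 2" using ln_mult[of 2 "2 :: real"] by simp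
      then show ?thesis unfolding ln_realpow by simp
    qed
    also have "\<dots> \<le> real (b + 1) * (2 * 1)"
      by (intro mult_left_mono) (use ln_add_one_self_le_self[of 1] in auto)
    also have "\<dots> \<le> 3 * real b" using that by simp
    finally show ?thesis .
  qed
  show ?thesis
  proof (cases "n < 16")
    case True
    \<comment> \<open>For small n the choice made below may give b < 2, where
      \<open>4 * g \<le> 2 ^ b\<close> leaves no room for a block. The values g = 1, b = 2 are taken
      instead; they need the constant 16, since n = 1 leads to 12.\<close>
    have "n \<le> (n div 2 + 1) * (1 * 2)" by presburger
    moreover have "2 * ((n div 2 + 1) * 2 ^ 2 + 1 * 2) \<le> 16 * n" using assms by simp
    moreover have "ln (real n) \<le> 3 * real (2 :: nat)" using ln_le[of 2] True assms by simp
    ultimately show ?thesis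
      by (intro exI[of _ 1] exI[of _ 2] exI[of _ "n div 2 + 1"]) simp
  next
    case False
    obtain b where b: "4 ^ b \<le> n" "n < 4 ^ (b + 1)"
      using ex_power_ivl1[of 4 n] assms by auto
    have b2: "2 \<le> b"
    proof (rule ccontr)
      assume "\<not> 2 \<le> b"
      then have "(4::nat) ^ (b + 1) \<le> 4 ^ 2" by (intro power_increasing) auto
      then show False using b False by simp
    qed
    define g :: nat where "g = 2 ^ (b - 2)"
    have g: "4 * g = 2 ^ b"
    proof -
      have "4 * g = 2 ^ (2 + (b - 2))" unfolding g_def power_add by simp
      then show ?thesis using b2 by (simp only: le_add_diff_inverse)
    qed
    let ?m = "g * b" and ?R = "n div (g * b) + 1"
    have "0 < ?m" using b2 by (simp add: g_def)
    then have R: "n \<le> ?R * ?m" using dividend_less_div_times[of ?m n] by simp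
    have dm: "?m * (n div ?m) \<le> n" by simp
    have "b \<le> 2 ^ b" using less_exp[of b] by simp
    then have "2 ^ b * b \<le> 2 ^ b * 2 ^ b" by (intro mult_left_mono) auto
    also have "\<dots> = (4::nat) ^ b" by (simp flip: power_mult_distrib)
    finally have m4: "4 * ?m \<le> n" using b g by (simp add: mult.assoc[symmetric])
    have "4 * (b * ?m) = 2 ^ b * (b * b)" unfolding g[symmetric] by simp
    also have "\<dots> \<le> 2 ^ b * (4 * 2 ^ b)" using sq by (intro mult_left_mono) auto
    also have "\<dots> = 4 * (4::nat) ^ b" by (simp flip: power_mult_distrib)
    finally have bm: "b * ?m \<le> n" using b by simp
    \<comment> \<open>From \<open>2^b = 4 g\<close> one gets \<open>b * 2^b = 4 m\<close>, so the
      number of groups times m is all that remains.\<close>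
    have "b * (?R * 2 ^ b + ?m) = 4 * (?m * (n div ?m)) + 4 * ?m + b * ?m"
      unfolding g[symmetric] by (simp add: algebra_simps)
    also have "\<dots> \<le> 16 * n" using dm m4 bm by linarith
    finally have "b * (?R * 2 ^ b + ?m) \<le> 16 * n" .
    then show ?thesis using R g ln_le[OF b(2) b2] b2
      by (intro exI[of _ g] exI[of _ b] exI[of _ ?R]) (simp add: g_def)
  qed
qed

text \<open>For k > 0, minimality gives \<open>2^(k-1) < n - 1\<close>, so a clique layer costs O(n)
  gates.\<close>

lemma Least_power_bound:
  fixes n :: nat
  assumes "1 \<le> n" and k: "k = (LEAST k. n - 1 \<le> 2 ^ k)"
  shows "n - 1 \<le> 2 ^ k" "2 ^ k \<le> 2 * n"
proof -
  have "n - 1 \<le> 2 ^ n" by (rule order_trans[OF diff_le_self less_imp_le[OF less_exp]])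
  then show "n - 1 \<le> 2 ^ k" unfolding k by (rule LeastI)
  show "2 ^ k \<le> 2 * n"
  proof (cases k)
    case (Suc k')
    then have "\<not> n - 1 \<le> 2 ^ k'" using not_less_Least[of k' "\<lambda>k. n - 1 \<le> 2 ^ k"] k by simp
    then show ?thesis using Suc by simp
  qed (use assms in simp)
qed

theorem proposition5p3:
  "\<exists>C::real. C > 0 \<and>
     (\<forall>n::nat. n \<ge> 1 \<longrightarrow>
       (\<forall>cs. clifford_circuit n cs \<longrightarrow>
         (\<exists>gs. gzz_circuit n gs \<and>
            eq_up_to_phase
              (gzz_circuit_mat n (pi / 2 ^ ((LEAST k::nat. n - 1 \<le> 2 ^ k) + 1)) gs)
              (clifford_mat n cs) \<and>
            (n \<ge> 2 \<longrightarrow> real (count_list gs GZZ) \<le> C * (real n)\<^sup>2 / ln (real n)))))"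
\<comment> \<open>1152 = 12 * 2 * 16 * 3: three Borel factors at \<open>4 L 2^k\<close> gates each,
  \<open>2^k\<close> at most 2 n, b L at most 16 n, and ln n at most 3 b.\<close>
proof (intro exI[of _ 1152] conjI allI impI)
  fix n cs assume n: "1 \<le> n" and cs: "clifford_circuit n cs"
  define k where "k = (LEAST k::nat. n - 1 \<le> 2 ^ k)"
  note kb = Least_power_bound[OF n k_def]
  obtain g b R where p: "0 < g" "0 < b" "4 * g \<le> 2 ^ b" "n \<le> R * (g * b)"
    "b * (R * 2 ^ b + g * b) \<le> 16 * n" "ln (real n) \<le> 3 * real b"
    using parameters_exist[OF n] by blast
  let ?L = "R * 2 ^ b + g * b"
  have "implementable n k (12 * ?L * 2 ^ k) F" if "F \<in> big_cell n" for F
    using implementable_big_cell[OF kb(1) refl p(1-4) that] .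
  from clifford_gzz[OF cs this] obtain gs where gs: "gzz_circuit n gs"
    "eq_up_to_phase (gzz_circuit_mat n (pi / 2 ^ (k + 1)) gs) (clifford_mat n cs)"
    "count_list gs GZZ \<le> 12 * ?L * 2 ^ k" by blast
  have "real (count_list gs GZZ) \<le> 1152 * (real n)\<^sup>2 / ln (real n)" if "2 \<le> n"
  proof -
    have ln: "0 < ln (real n)" using that by simp
    have "real (count_list gs GZZ) \<le> real (12 * ?L * 2 ^ k)" using gs(3) of_nat_mono by blast
    also have "\<dots> \<le> real (12 * ?L * (2 * n))" using kb(2) by (intro of_nat_mono mult_left_mono) auto
    finally have c: "real (count_list gs GZZ) \<le> 24 * real ?L * real n" by (simp add: algebra_simps)
    have "real ?L * ln (real n) \<le> real ?L * (3 * real b)" using p(6) by (intro mult_left_mono) auto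
    also have "\<dots> = 3 * real (b * ?L)" by simp
    also have "\<dots> \<le> 3 * real (16 * n)" using p(5) by (intro mult_left_mono of_nat_mono) auto
    finally have L: "real ?L * ln (real n) \<le> 48 * real n" by simp
    have "real (count_list gs GZZ) * ln (real n) \<le> (24 * real ?L * real n) * ln (real n)"
      using c ln by (intro mult_right_mono) auto
    also have "\<dots> = 24 * real n * (real ?L * ln (real n))" by simp
    also have "\<dots> \<le> 24 * real n * (48 * real n)" using L by (intro mult_left_mono) auto
    also have "\<dots> = 1152 * (real n)\<^sup>2" by (simp add: power2_eq_square)
    finally show ?thesis using ln by (simp add: pos_le_divide_eq)
  qed
  then show "\<exists>gs. gzz_circuit n gs \<and>
      eq_up_to_phase (gzz_circuit_mat n (pi / 2 ^ ((LEAST k::nat. n - 1 \<le> 2 ^ k) + 1)) gs) (clifford_mat n cs) \<and>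
      (n \<ge> 2 \<longrightarrow> real (count_list gs GZZ) \<le> 1152 * (real n)\<^sup>2 / ln (real n))"
    using gs unfolding k_def by blast
qed simp

end
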